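(* Let $G=(V,m,E,a)$ be a weighted directed graph with a collection of directed clusters with total (finite) edge set $\tilde E\subseteq E$. For $\beta>0$ let $L^-_\beta=L^-_{E\setminus\tilde E}+\beta L^-_{\tilde E}$ on $\ell^2(G)$, and let $\underline L^-$ be the in-degree Laplacian of the reduced graph $\underline G^-$. Then for every $z\in\mathbb C\setminus\{0\}$ in the resolvent set of $\underline L^-$ there exist $C,\beta_0>0$ such that for all $\beta\ge\beta_0$ the point $z$ is in the resolvent set of $L^-_\beta$ and $$\big\|(L^-_\beta-z)^{-1}-J^-_\uparrow(\underline L^--z)^{-1}J^-_\downarrow\big\|\le \frac{C}{\beta}.$$ In particular the left-hand side tends to $0$ as $\beta\to\infty$.
   Context: Graphs: $G=(V,m,E,a)$ has an at most countably infinite vertex set $V$, node masses $m:V\to(0,\infty)$, a locally finite edge set $E\subseteq V\times V$, and weights $a:V\times V\to[0,\infty)$ with $a(v,w)>0$ iff $(v,w)\in E$. The edge $(i,j)$ originates at $j$ and terminates at $i$. $\ell^2(G)=\{f:V\to\mathbb C:\sum_v|f(v)|^2m(v)<\infty\}$, $\langle f,g\rangle_{\ell^2(G)}=\sum_x\overline{f(x)}g(x)m(x)$. $\chi_S$ is the indicator function of $S\subseteq V$. In-degree Laplacian: $[L^-f](x)=\frac1{m(x)}\big(d^-(x)f(x)-\sum_ya(x,y)f(y)\big)$, $d^-(v)=\sum_ia(v,i)$; also $d^+(v)=\sum_ja(j,v)$. Standing assumption: there is $K>0$ with $d^\pm(v)\le K\,m(v)$ for all $v\in V$. For $F\subseteq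 E$, $L^-_F$ is the in-degree Laplacian of $(V,m,F,a\chi_F)$. Reaches of a directed graph: the reachable set of a node $i$ is the set of all nodes $j$ (including $i$) for which there is a directed path starting at $i$ and ending at $j$. A reach $R$ is a maximal reachable set. The cabal $B(R)\subseteq R$ is the set of vertices from which all other vertices of $R$ are reachable. The exclusive part $H(R)$ is the set of vertices of $R$ lying in no other reach; the common part is $C(R)=R\setminus H(R)$. Collection of directed clusters: a finite family of finite edge sets $\tilde E_i\subseteq E$ with union $\tilde E$, such that each $\tilde E_i$ determines a single reach of $(V,\tilde E)$. (Any finite $\tilde E\subseteq E$ decomposes in this way; reaches may share nodes. Each vertex not incident to an edge of $\tilde E$ forms a singleton reach of $(V,\tilde E)$.) Kernel vectors: let $R$ be a reach of $(V,\tilde E)$. $\vec\gamma^-_R$ is the unique element of $\ker L^-_{\tilde E}$ that equals $1$ on $H(R)$ and vanishes outside $R$ (its values on $C(R)$ lie in $(0,1)$). The weight vector of $R$ is $\omega_R(i)=\sum_\tau\prod_{(x,y)\in\tau}a(x,y)$, summed over all directed spanning trees $\tau\subseteq\tilde E$ of $R$ rooted at $i$ (all edges directed away from the root $i$; an empty product is $1$), and $\omega_R(i)=0$ if there are none. Set $\overleftarrow\gamma^-_R=\omega_R/\sum_j\omega_R(j)m(j)$. $P^-$ is the Riesz projection of $L^-_{\tilde E}$ at $0$: $P^-=\frac1{2\pi i}\oint_{|\zeta|=\epsilon}(\zeta-L^-_{\tilde E})^{-1}d\zeta$, with $\epsilon>0$ so small that $0$ is the only point of $\sigma(L^-_{\tilde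 E})$ in the closed disc of radius $\epsilon$. Reduced graph $\underline G^-=(\underline V^-,\underline m^-,\underline E^-,\underline a^-)$: $\underline V^-$ is the set of reaches of $(V,\tilde E)$; $\underline m^-(R)=\langle\chi_R,P^-\chi_R\rangle_{\ell^2(G)}$; $\underline a^-(R,S)=\underline m^-(R)\sum_{r\in R,\,s\in S}\overleftarrow\gamma^-_R(r)\,a(r,s)\,\vec\gamma^-_S(s)$; $\underline E^-=\{(R,S):\underline a^-(R,S)>0\}$. $\underline L^-$ is its in-degree Laplacian on $\ell^2(\underline G^-)$. $J^-_\downarrow:\ell^2(G)\to\ell^2(\underline G^-)$, $[J^-_\downarrow f](R)=\langle\overleftarrow\gamma^-_R,f\rangle_{\ell^2(G)}$; $J^-_\uparrow:\ell^2(\underline G^-)\to\ell^2(G)$, $J^-_\uparrow\underline f=\sum_R\underline f(R)\vec\gamma^-_R$. *)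

theory Defs
  imports "HOL-Complex_Analysis.Complex_Analysis"
begin

section \<open>Weighted directed graphs\<close>

text \<open>An edge \<open>(i, j)\<close> originates at \<open>j\<close> and terminates at \<open>i\<close>.  Values of \<open>mass\<close> and
  \<open>wt\<close> outside \<open>verts\<close> are irrelevant.\<close>

record 'v wgraph =
  verts :: "'v set"
  mass :: "'v \<Rightarrow> real"
  edges :: "('v \<times> 'v) set"
  wt :: "'v \<Rightarrow> 'v \<Rightarrow> real"

definition in_deg :: "'v wgraph \<Rightarrow> 'v \<Rightarrow> real" where
  "in_deg G v = (\<Sum>\<^sub>\<infinity>i\<in>verts G. wt G v i)"

definition out_deg :: "'v wgraph \<Rightarrow> 'v \<Rightarrow> real" where
  "out_deg G v = (\<Sum>\<^sub>\<infinity>j\<in>verts G. wt G j v)"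

locale wdigraph =
  fixes G :: "'v wgraph"
  assumes countable_verts: "countable (verts G)"
    and mass_pos: "v \<in> verts G \<Longrightarrow> mass G v > 0"
    and edges_subset: "edges G \<subseteq> verts G \<times> verts G"
    and locally_finite: "v \<in> verts G \<Longrightarrow> finite {w. (v, w) \<in> edges G} \<and> finite {w. (w, v) \<in> edges G}"
    and wt_nonneg: "v \<in> verts G \<Longrightarrow> w \<in> verts G \<Longrightarrow> wt G v w \<ge> 0"
    and wt_pos_iff: "v \<in> verts G \<Longrightarrow> w \<in> verts G \<Longrightarrow> wt G v w > 0 \<longleftrightarrow> (v, w) \<in> edges G"
    and bounded_degrees: "\<exists>K>0. \<forall>v\<in>verts G. in_deg G v \<le> K * mass G v \<and> out_deg G v \<le> K * mass G v"

definition restrict_edges :: "'v wgraph \<Rightarrow> ('v \<times> 'v) set \<Rightarrow> 'v wgraph" where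
  "restrict_edges G F = G\<lparr>edges := F, wt := \<lambda>x y. wt G x y * indicator F (x, y)\<rparr>"


section \<open>The weighted space \<open>\<ell>\<^sup>2(G)\<close> and its operators\<close>

text \<open>Functions on \<open>verts G\<close> are represented by functions on the whole type that vanish outside
  \<open>verts G\<close>; operators are functions whose values matter only on \<open>l2 G\<close>.\<close>

definition l2 :: "'v wgraph \<Rightarrow> ('v \<Rightarrow> complex) set" where
  "l2 G = {f. (\<forall>x. x \<notin> verts G \<longrightarrow> f x = 0) \<and> (\<lambda>x. (cmod (f x))\<^sup>2 * mass G x) summable_on verts G}"

definition l2_norm :: "'v wgraph \<Rightarrow> ('v \<Rightarrow> complex) \<Rightarrow> real" where
  "l2_norm G f = sqrt (\<Sum>\<^sub>\<infinity>x\<in>verts G. (cmod (f x))\<^sup>2 * mass G x)"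

definition l2_inner :: "'v wgraph \<Rightarrow> ('v \<Rightarrow> complex) \<Rightarrow> ('v \<Rightarrow> complex) \<Rightarrow> complex" where
  "l2_inner G f g = (\<Sum>\<^sub>\<infinity>x\<in>verts G. cnj (f x) * g x * of_real (mass G x))"

definition bounded_op ::
    "'v wgraph \<Rightarrow> 'w wgraph \<Rightarrow> (('v \<Rightarrow> complex) \<Rightarrow> ('w \<Rightarrow> complex)) \<Rightarrow> bool" where
  "bounded_op G H T \<longleftrightarrow>
     (\<forall>f\<in>l2 G. T f \<in> l2 H) \<and>
     (\<forall>f\<in>l2 G. \<forall>g\<in>l2 G. T (\<lambda>x. f x + g x) = (\<lambda>y. T f y + T g y)) \<and>
     (\<forall>f\<in>l2 G. \<forall>c. T (\<lambda>x. c * f x) = (\<lambda>y. c * T f y)) \<and>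
     (\<exists>K. \<forall>f\<in>l2 G. l2_norm H (T f) \<le> K * l2_norm G f)"

text \<open>Meaningful only for operators satisfying \<^const>\<open>bounded_op\<close>.\<close>

definition op_norm ::
    "'v wgraph \<Rightarrow> 'w wgraph \<Rightarrow> (('v \<Rightarrow> complex) \<Rightarrow> ('w \<Rightarrow> complex)) \<Rightarrow> real" where
  "op_norm G H T = (SUP f\<in>{f \<in> l2 G. l2_norm G f \<le> 1}. l2_norm H (T f))"

text \<open>\<open>resolvent G T z\<close> is \<open>(T - z)\<^sup>-\<^sup>1\<close>.\<close>

definition resolvent ::
    "'v wgraph \<Rightarrow> (('v \<Rightarrow> complex) \<Rightarrow> ('v \<Rightarrow> complex)) \<Rightarrow> complex \<Rightarrow> ('v \<Rightarrow> complex) \<Rightarrow> ('v \<Rightarrow> complex)" where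
  "resolvent G T z = inv_into (l2 G) (\<lambda>f x. T f x - z * f x)"

definition resolvent_set :: "'v wgraph \<Rightarrow> (('v \<Rightarrow> complex) \<Rightarrow> ('v \<Rightarrow> complex)) \<Rightarrow> complex set" where
  "resolvent_set G T =
     {z. bij_betw (\<lambda>f x. T f x - z * f x) (l2 G) (l2 G) \<and> bounded_op G G (resolvent G T z)}"

definition op_spectrum :: "'v wgraph \<Rightarrow> (('v \<Rightarrow> complex) \<Rightarrow> ('v \<Rightarrow> complex)) \<Rightarrow> complex set" where
  "op_spectrum G T = - resolvent_set G T"

definition riesz_radius :: "'v wgraph \<Rightarrow> (('v \<Rightarrow> complex) \<Rightarrow> ('v \<Rightarrow> complex)) \<Rightarrow> real" where
  "riesz_radius G T = (SOME \<epsilon>. \<epsilon> > 0 \<and> op_spectrum G T \<inter> cball 0 \<epsilon> \<subseteq> {0})"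

text \<open>The Riesz projection at 0.  The operator-valued contour integral is evaluated coordinatewise:
  for \<open>f \<in> l2 G\<close> the maps \<open>A \<mapsto> A f x\<close> are bounded linear functionals on the bounded operators,
  so they commute with the (norm convergent) integral and determine its value.  The minus sign turns
  \<open>(T - \<zeta>)\<^sup>-\<^sup>1\<close> into \<open>(\<zeta> - T)\<^sup>-\<^sup>1\<close>.\<close>

definition riesz_projection ::
    "'v wgraph \<Rightarrow> (('v \<Rightarrow> complex) \<Rightarrow> ('v \<Rightarrow> complex)) \<Rightarrow> ('v \<Rightarrow> complex) \<Rightarrow> ('v \<Rightarrow> complex)" where
  "riesz_projection G T f = (\<lambda>x. 1 / (2 * of_real pi * \<i>) *
     contour_integral (circlepath 0 (riesz_radius G T)) (\<lambda>\<zeta>. - resolvent G T \<zeta> f x))"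

definition laplacian :: "'v wgraph \<Rightarrow> ('v \<Rightarrow> complex) \<Rightarrow> ('v \<Rightarrow> complex)" where
  "laplacian G f = (\<lambda>x. if x \<in> verts G
     then 1 / of_real (mass G x) *
       (of_real (in_deg G x) * f x - (\<Sum>\<^sub>\<infinity>y\<in>verts G. of_real (wt G x y) * f y))
     else 0)"

definition coupled_laplacian ::
    "'v wgraph \<Rightarrow> ('v \<times> 'v) set \<Rightarrow> real \<Rightarrow> ('v \<Rightarrow> complex) \<Rightarrow> ('v \<Rightarrow> complex)" where
  "coupled_laplacian G F \<beta> f = (\<lambda>x.
     laplacian (restrict_edges G (edges G - F)) f x + of_real \<beta> * laplacian (restrict_edges G F) f x)"


section \<open>Reaches and directed clusters\<close>

text \<open>Since \<open>(i, j)\<close> is an edge from \<open>j\<close> to \<open>i\<close>, there is a directed path from \<open>j\<close> to \<open>i\<close> with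
  edges in \<open>F\<close> iff \<open>(i, j) \<in> F\<^sup>*\<close>.\<close>

definition reachable_set :: "('v \<times> 'v) set \<Rightarrow> 'v \<Rightarrow> 'v set" where
  "reachable_set F j = {i. (i, j) \<in> F\<^sup>*}"

definition reaches :: "'v set \<Rightarrow> ('v \<times> 'v) set \<Rightarrow> 'v set set" where
  "reaches V F =
     {R \<in> reachable_set F ` V. \<forall>S \<in> reachable_set F ` V. R \<subseteq> S \<longrightarrow> S = R}"

definition exclusive_part :: "'v set \<Rightarrow> ('v \<times> 'v) set \<Rightarrow> 'v set \<Rightarrow> 'v set" where
  "exclusive_part V F R = R - \<Union>(reaches V F - {R})"

text \<open>\<open>Field F\<close> is the set of vertices incident to an edge of \<open>F\<close>: each member of the family is
  required to determine, through its incident vertices, a reach of the graph with the edges of all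
  members.\<close>

definition directed_clusters :: "'v wgraph \<Rightarrow> ('v \<times> 'v) set set \<Rightarrow> bool" where
  "directed_clusters G \<E> \<longleftrightarrow> finite \<E> \<and>
     (\<forall>F\<in>\<E>. finite F \<and> F \<subseteq> edges G \<and> Field F \<in> reaches (verts G) (\<Union>\<E>))"

text \<open>Every finite set of edges is the total edge set of a collection of directed clusters.\<close>

lemma directed_clusters_exist:
  assumes "wdigraph G" and finF: "finite F" and FE: "F \<subseteq> edges G"
  obtains \<E> where "directed_clusters G \<E>" "\<Union>\<E> = F"
proof -
  let ?V = "verts G"
  define \<R> where "\<R> = {R \<in> reaches ?V F. F \<inter> R \<times> R \<noteq> {}}"
  define \<E> where "\<E> = (\<lambda>R. F \<inter> R \<times> R) ` \<R>"
  have FV: "F \<subseteq> ?V \<times> ?V" using FE wdigraph.edges_subset[OF assms(1)] by blast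
  have in_reach: "\<exists>R\<in>reaches ?V F. x \<in> R" if x: "x \<in> ?V" for x
  proof -
    define A where "A = {S \<in> reachable_set F ` ?V. x \<in> S}"
    have "A \<subseteq> reachable_set F ` insert x (Field F)"
    proof
      fix S assume "S \<in> A"
      then obtain j where j: "S = reachable_set F j" "(x, j) \<in> F\<^sup>*"
        by (auto simp: A_def reachable_set_def)
      have "j = x \<or> j \<in> Field F" using j(2) by (metis FieldI2 rtranclE)
      then show "S \<in> reachable_set F ` insert x (Field F)" using j(1) by blast
    qed
    then have "finite A" using finF by (meson finite_Field finite_imageI finite_insert finite_subset)
    moreover have "reachable_set F x \<in> A" using x by (auto simp: A_def reachable_set_def)
    ultimately obtain R where R: "R \<in> A" "\<And>S. S \<in> A \<Longrightarrow> R \<subseteq> S \<Longrightarrow> R = S"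
      by (metis finite_has_maximal empty_iff)
    then have "R \<in> reaches ?V F" unfolding reaches_def A_def by blast
    then show ?thesis using R(1) by (auto simp: A_def)
  qed
  have closed: "a \<in> R" if "R \<in> reaches ?V F" "b \<in> R" "(a, b) \<in> F" for R a b
    using that by (auto simp: reaches_def reachable_set_def intro: converse_rtrancl_into_rtrancl)
  have Un: "\<Union>\<E> = F"
  proof
    show "F \<subseteq> \<Union>\<E>"
    proof
      fix e assume e: "e \<in> F"
      obtain a b where ab: "e = (a, b)" by fastforce
      obtain R where R: "R \<in> reaches ?V F" "b \<in> R" using in_reach e ab FV by blast
      then have "e \<in> F \<inter> R \<times> R" using closed e ab by blast
      then show "e \<in> \<Union>\<E>" using R(1) unfolding \<E>_def \<R>_def by blast
    qed
  qed (auto simp: \<E>_def)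
  have field: "Field (F \<inter> R \<times> R) = R" if R: "R \<in> reaches ?V F" and ne: "F \<inter> R \<times> R \<noteq> {}" for R
  proof
    show "Field (F \<inter> R \<times> R) \<subseteq> R" by (auto simp: Field_def)
    obtain r where r: "R = reachable_set F r" using R by (auto simp: reaches_def)
    have rR: "r \<in> R" by (simp add: r reachable_set_def)
    have non_root: "v \<in> Field (F \<inter> R \<times> R) \<and> r \<in> Field (F \<inter> R \<times> R)" if v: "v \<in> R" "v \<noteq> r" for v
    proof -
      have vr: "(v, r) \<in> F\<^sup>*" using v(1) by (simp add: r reachable_set_def)
      obtain k where k: "(v, k) \<in> F" "(k, r) \<in> F\<^sup>*" using vr v(2) by (metis converse_rtranclE)
      obtain l where l: "(l, r) \<in> F" using vr v(2) by (metis rtranclE)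
      have "k \<in> R" using k(2) by (simp add: r reachable_set_def)
      then have "(v, k) \<in> F \<inter> R \<times> R" using k(1) v(1) by blast
      moreover have "(l, r) \<in> F \<inter> R \<times> R" using l rR closed[OF R rR l] by blast
      ultimately show ?thesis by (meson FieldI1 FieldI2)
    qed
    have "r \<in> Field (F \<inter> R \<times> R)"
    proof (cases "R = {r}")
      case True
      then show ?thesis using ne by (auto simp: Field_def)
    next
      case False
      then show ?thesis using non_root rR by blast
    qed
    then show "R \<subseteq> Field (F \<inter> R \<times> R)" using non_root by blast
  qed
  have "\<E> \<subseteq> Pow F" by (auto simp: \<E>_def)
  then have "finite \<E>" using finF by (meson finite_Pow_iff finite_subset)
  moreover have "finite D \<and> D \<subseteq> edges G \<and> Field D \<in> reaches ?V F" if "D \<in> \<E>" for D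
  proof -
    obtain R where R: "R \<in> reaches ?V F" "F \<inter> R \<times> R \<noteq> {}" "D = F \<inter> R \<times> R"
      using \<open>D \<in> \<E>\<close> by (auto simp: \<E>_def \<R>_def)
    then show ?thesis using field[OF R(1,2)] finF FE by auto
  qed
  ultimately have "directed_clusters G \<E>" unfolding directed_clusters_def Un by blast
  then show ?thesis using that Un by blast
qed

section \<open>Kernel vectors\<close>

definition right_kernel_vec :: "'v wgraph \<Rightarrow> ('v \<times> 'v) set \<Rightarrow> 'v set \<Rightarrow> 'v \<Rightarrow> complex" where
  "right_kernel_vec G F R = (THE f. f \<in> l2 G \<and> laplacian (restrict_edges G F) f = (\<lambda>x. 0) \<and>
     (\<forall>x \<in> exclusive_part (verts G) F R. f x = 1) \<and> (\<forall>x. x \<notin> R \<longrightarrow> f x = 0))"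

definition spanning_trees :: "('v \<times> 'v) set \<Rightarrow> 'v set \<Rightarrow> 'v \<Rightarrow> ('v \<times> 'v) set set" where
  "spanning_trees F R i = {\<tau>. i \<in> R \<and> \<tau> \<subseteq> F \<inter> R \<times> R \<and> (\<forall>v\<in>R. (v, i) \<in> \<tau>\<^sup>*) \<and>
     (\<forall>j. (i, j) \<notin> \<tau>) \<and> (\<forall>v\<in>R - {i}. \<exists>!j. (v, j) \<in> \<tau>)}"

definition tree_weight :: "'v wgraph \<Rightarrow> ('v \<times> 'v) set \<Rightarrow> 'v set \<Rightarrow> 'v \<Rightarrow> real" where
  "tree_weight G F R i = (\<Sum>\<tau>\<in>spanning_trees F R i. \<Prod>(x, y)\<in>\<tau>. wt G x y)"

definition left_kernel_vec :: "'v wgraph \<Rightarrow> ('v \<times> 'v) set \<Rightarrow> 'v set \<Rightarrow> 'v \<Rightarrow> real" where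
  "left_kernel_vec G F R i = tree_weight G F R i / (\<Sum>j\<in>R. tree_weight G F R j * mass G j)"


section \<open>The reduced graph\<close>

text \<open>\<^const>\<open>Re\<close> only adapts the type: the complex expressions are real, as the kernel vectors are.\<close>

definition reduced_mass :: "'v wgraph \<Rightarrow> ('v \<times> 'v) set \<Rightarrow> 'v set \<Rightarrow> real" where
  "reduced_mass G F R = Re (l2_inner G (indicator R)
     (riesz_projection G (laplacian (restrict_edges G F)) (indicator R)))"

definition reduced_wt :: "'v wgraph \<Rightarrow> ('v \<times> 'v) set \<Rightarrow> 'v set \<Rightarrow> 'v set \<Rightarrow> real" where
  "reduced_wt G F R S = reduced_mass G F R *
     (\<Sum>(r, s)\<in>R \<times> S. left_kernel_vec G F R r * wt G r s * Re (right_kernel_vec G F S s))"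

definition reduced_graph :: "'v wgraph \<Rightarrow> ('v \<times> 'v) set \<Rightarrow> 'v set wgraph" where
  "reduced_graph G F =
     \<lparr>verts = reaches (verts G) F,
      mass = reduced_mass G F,
      edges = {(R, S) \<in> reaches (verts G) F \<times> reaches (verts G) F. reduced_wt G F R S > 0},
      wt = reduced_wt G F\<rparr>"

definition J_down :: "'v wgraph \<Rightarrow> ('v \<times> 'v) set \<Rightarrow> ('v \<Rightarrow> complex) \<Rightarrow> ('v set \<Rightarrow> complex)" where
  "J_down G F f = (\<lambda>R. if R \<in> reaches (verts G) F
     then l2_inner G (\<lambda>x. of_real (left_kernel_vec G F R x)) f else 0)"

definition J_up :: "'v wgraph \<Rightarrow> ('v \<times> 'v) set \<Rightarrow> ('v set \<Rightarrow> complex) \<Rightarrow> ('v \<Rightarrow> complex)" where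
  "J_up G F g = (\<lambda>x. \<Sum>\<^sub>\<infinity>R\<in>reaches (verts G) F. g R * right_kernel_vec G F R x)"

definition reduction_error ::
    "'v wgraph \<Rightarrow> ('v \<times> 'v) set \<Rightarrow> complex \<Rightarrow> real \<Rightarrow> ('v \<Rightarrow> complex) \<Rightarrow> ('v \<Rightarrow> complex)" where
  "reduction_error G F z \<beta> f = (\<lambda>x. resolvent G (coupled_laplacian G F \<beta>) z f x -
     J_up G F (resolvent (reduced_graph G F) (laplacian (reduced_graph G F)) z (J_down G F f)) x)"

end

theory Submission
  imports Defs "HOL-Library.Function_Algebras"
begin

text \<open>Let \<open>M\<close> be the Laplacian of the clusters, \<open>A = L - z\<close> with \<open>L\<close> the Laplacian of the remaining
  edges, and \<open>P = J\<^sub>\<up> J\<^sub>\<down>\<close>.  The maximum principle for harmonic functions and the Markov chain tree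
  theorem show that \<open>P\<close> is the projection onto the kernel of \<open>M\<close> along its range, so \<open>1 - P\<close> has finite
  rank and \<open>M\<close> has a finite-rank inverse \<open>S\<close> on the range of \<open>1 - P\<close>.  The reduced Laplacian is
  \<open>L' = J\<^sub>\<down> L J\<^sub>\<up>\<close>, hence \<open>B = J\<^sub>\<up> (L' - z)\<^sup>-\<^sup>1 J\<^sub>\<down>\<close> inverts the compression of \<open>A\<close> to the kernel.  Then
  \<open>(A + \<beta> M) f = g\<close> is equivalent to \<open>f = B g + (1 - B A) w\<close> with \<open>w = \<beta>\<^sup>-\<^sup>1 S (g - A f)\<close>, an
  equation for \<open>w\<close> in a finite-dimensional space that is a small perturbation of the identity for
  large \<open>\<beta>\<close> and forces \<open>w\<close> to be of order \<open>1 / \<beta>\<close>.\<close>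

section \<open>Finitely supported functions\<close>

text \<open>\<open>M\<close> need not be self-adjoint on \<open>l2 G\<close>, so its kernel
  projection is oblique: besides the harmonic functions \<open>\<gamma> R\<close> it needs left null
  vectors, and these are given as tree sums. This is why a combinatorial theorem is part of an
  operator estimate. The vertex set may be infinite, but off the finite set \<open>N\<close> of
  vertices touched by cluster edges every reach is a singleton and both transfer maps just copy
  values. The linear algebra therefore lives on functions supported in \<open>N\<close>, where
  injectivity gives surjectivity by counting dimensions. The coupling parameter of the abstract
  lemma is complex because of a second use: with \<open>A = -1\<close> and \<beta> = 1/\<zeta> it
  shows that 0 is isolated in the spectrum of \<open>M\<close>. This makes the radius chosen by
  \<open>SOME\<close> in the Riesz projection meaningful, and with it the reduced masses, which are
  defined through that projection. The formula for \<open>f\<close> comes from elimination: applying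
  \<open>P\<close> and then \<open>B\<close> to the equation determines \<open>P f\<close> from
  \<open>g\<close> and \<open>w = f - P f\<close>.\<close>

definition supported :: "'v set \<Rightarrow> ('v \<Rightarrow> complex) set" where
  "supported N = {f. \<forall>x. x \<notin> N \<longrightarrow> f x = 0}"

lemma supportedD: "f \<in> supported N \<Longrightarrow> x \<notin> N \<Longrightarrow> f x = 0"
  by (simp add: supported_def)

lemma sum_fun_apply: "(\<Sum>i\<in>A. g i) x = (\<Sum>i\<in>A. g i x)"
  for g :: "'i \<Rightarrow> 'v \<Rightarrow> 'b::comm_monoid_add"
  by (induction A rule: infinite_finite_induct) auto

text \<open>Turns an abstractly given linear map into its matrix; used both to count dimensions and
  to see that an inverse obtained by choice has bounded coordinates. Linearity is asked only on
  \<open>supported N\<close> because such an inverse is known to be linear only there.\<close>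

lemma linear_supported_expand:
  fixes T :: "('v \<Rightarrow> complex) \<Rightarrow> ('w \<Rightarrow> complex)"
  assumes N: "finite N"
    and add: "\<And>f g. f \<in> supported N \<Longrightarrow> g \<in> supported N \<Longrightarrow> T (f + g) = T f + T g"
    and scale: "\<And>c f. f \<in> supported N \<Longrightarrow> T (\<lambda>x. c * f x) = (\<lambda>x. c * T f x)"
    and f: "f \<in> supported N"
  shows "T f = (\<Sum>x\<in>N. (\<lambda>y. f x * T (indicator {x}) y))"
proof -
  have z: "(\<lambda>x. 0) \<in> supported N" by (simp add: supported_def)
  have T0: "T (\<lambda>x. 0) = (\<lambda>x. 0)" using scale[OF z, of 0] by simp
  have ind: "indicator {x} \<in> supported N" if "x \<in> N" for x
    using that by (auto simp: supported_def indicator_def)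
  have "T (\<lambda>x. if x \<in> X then f x else 0) = (\<Sum>x\<in>X. (\<lambda>y. f x * T (indicator {x}) y))"
    if "X \<subseteq> N" for X
    using finite_subset[OF that N] that
  proof (induction X)
    case empty
    then show ?case using T0 by (simp add: zero_fun_def)
  next
    case (insert x X)
    have "(\<lambda>y. if y \<in> insert x X then f y else 0) =
        (\<lambda>y. f x * indicator {x} y) + (\<lambda>x. if x \<in> X then f x else 0)"
      using insert.hyps by (auto simp: fun_eq_iff indicator_def)
    moreover have "(\<lambda>y. f x * indicator {x} y) \<in> supported N" "(\<lambda>x. if x \<in> X then f x else 0) \<in> supported N"
      using insert.prems by (auto simp: supported_def indicator_def)
    ultimately have 1: "T (\<lambda>y. if y \<in> insert x X then f y else 0) =
        T (\<lambda>y. f x * indicator {x} y) + T (\<lambda>x. if x \<in> X then f x else 0)"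
      using add by simp
    have 2: "T (\<lambda>y. f x * indicator {x} y) = (\<lambda>y. f x * T (indicator {x}) y)"
      using scale[OF ind] insert.prems by blast
    have 3: "T (\<lambda>x. if x \<in> X then f x else 0) = (\<Sum>x\<in>X. (\<lambda>y. f x * T (indicator {x}) y))"
      using insert.IH insert.prems by blast
    show ?case
      unfolding sum.insert[OF insert.hyps] 1 2 3 ..
  qed
  from this[OF subset_refl]
  have "T (\<lambda>x. if x \<in> N then f x else 0) = (\<Sum>x\<in>N. (\<lambda>y. f x * T (indicator {x}) y))" .
  moreover have "(\<lambda>x. if x \<in> N then f x else 0) = f"
    using f by (auto simp: supported_def)
  ultimately show ?thesis by (simp only:)
qed

text \<open>Dimension count. An injective \<open>T\<close> sends the point indicators to
  \<open>card N\<close> independent vectors; a \<open>g\<close> outside their span would make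
  \<open>card N + 1\<close> independent vectors inside the span of the \<open>card N\<close>
  indicators.\<close>

lemma inj_imp_surj_supported:
  fixes T :: "('v \<Rightarrow> complex) \<Rightarrow> ('v \<Rightarrow> complex)"
  assumes N: "finite N"
    and closed: "\<And>f. f \<in> supported N \<Longrightarrow> T f \<in> supported N"
    and add: "\<And>f g. f \<in> supported N \<Longrightarrow> g \<in> supported N \<Longrightarrow> T (f + g) = T f + T g"
    and scale: "\<And>c f. f \<in> supported N \<Longrightarrow> T (\<lambda>x. c * f x) = (\<lambda>x. c * T f x)"
    and inj: "\<And>f. f \<in> supported N \<Longrightarrow> T f = 0 \<Longrightarrow> f = 0"
    and g: "g \<in> supported N"
  shows "\<exists>f\<in>supported N. T f = g"
proof -
  interpret vs: vector_space "\<lambda>(c::complex) (f::'v \<Rightarrow> complex) x. c * f x"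
    by unfold_locales (auto simp: fun_eq_iff algebra_simps)
  note expand = linear_supported_expand[of N T, OF N add scale]
  define e :: "'v \<Rightarrow> 'v \<Rightarrow> complex" where "e = (\<lambda>x. indicator {x})"
  define C where "C = (\<lambda>x. T (e x)) ` N"
  have e: "e x \<in> supported N" if "x \<in> N" for x
    using that by (auto simp: supported_def e_def indicator_def)
  have inj': "f = h" if "f \<in> supported N" "h \<in> supported N" "T f = T h" for f h
  proof -
    have m: "(\<lambda>x. -1 * h x) \<in> supported N" using that by (auto simp: supported_def)
    have "T (f + (\<lambda>x. -1 * h x)) = T f + (\<lambda>x. -1 * T h x)"
      using add[OF that(1) m] scale[OF that(2), of "-1"] by simp
    then have "T (f + (\<lambda>x. -1 * h x)) = 0" using that(3) by (auto simp: fun_eq_iff)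
    moreover have "f + (\<lambda>x. -1 * h x) \<in> supported N" using that by (auto simp: supported_def)
    ultimately have "f + (\<lambda>x. -1 * h x) = 0" using inj by blast
    then show ?thesis by (auto simp: fun_eq_iff)
  qed
  have inj_on: "inj_on (\<lambda>x. T (e x)) N"
  proof (rule inj_onI)
    fix x y assume "x \<in> N" "y \<in> N" "T (e x) = T (e y)"
    then have "e x = e y" using inj' e by blast
    then show "x = y" by (metis e_def indicator_simps(1) indicator_simps(2) singleton_iff zero_neq_one)
  qed
  have finC: "finite C" using N by (simp add: C_def)
  \<comment> \<open>The coefficients \<open>u\<close> are at once the values of a function on
    \<open>N\<close> and the scalars of a combination of the images, so a dependence relation in
    \<open>C\<close> becomes an element of the kernel of \<open>T\<close>.\<close>
  have comb: "T (\<lambda>x. if x \<in> N then u x else 0) = (\<Sum>x\<in>N. (\<lambda>y. u x * T (e x) y))" for u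
    by (subst expand) (auto simp: supported_def e_def intro!: sum.cong)
  have indep: "vs.independent C"
  proof (rule vs.independent_if_scalars_zero[OF finC])
    fix u v assume 0: "(\<Sum>v\<in>C. (\<lambda>x. u v * v x)) = 0" and "v \<in> C"
    then obtain x where x: "x \<in> N" "v = T (e x)" by (auto simp: C_def)
    have "T (\<lambda>x. if x \<in> N then u (T (e x)) else 0) = 0"
      using 0 unfolding comb C_def by (subst (asm) sum.reindex[OF inj_on]) (simp add: o_def)
    then have "(\<lambda>x. if x \<in> N then u (T (e x)) else 0) = 0"
      by (rule inj[rotated]) (auto simp: supported_def)
    from fun_cong[OF this, of x] show "u v = 0" using x by simp
  qed
  have span: "f \<in> vs.span (e ` N)" if f: "f \<in> supported N" for f
  proof -
    have "f = (\<Sum>x\<in>N. (\<lambda>y. f x * e x y))"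
      using linear_supported_expand[of N "\<lambda>f. f" f] N f by (simp add: e_def)
    moreover have "(\<Sum>x\<in>N. (\<lambda>y. f x * e x y)) \<in> vs.span (e ` N)"
      by (intro vs.span_sum vs.span_scale vs.span_base) auto
    ultimately show ?thesis by simp
  qed
  have cC: "card C = card N" unfolding C_def using card_image[OF inj_on] .
  have "g \<in> vs.span C"
  proof (rule ccontr)
    assume ng: "g \<notin> vs.span C"
    then have "vs.independent (insert g C)" using indep vs.independent_insertI by blast
    moreover have "insert g C \<subseteq> vs.span (e ` N)"
      using span g closed e by (auto simp: C_def)
    ultimately have "card (insert g C) \<le> card (e ` N)"
      using vs.independent_span_bound[of "e ` N" "insert g C"] N by blast
    moreover have "g \<notin> C" using ng vs.span_base by blast
    moreover have "card (e ` N) \<le> card N" using N by (rule card_image_le)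
    ultimately show False using finC cC by simp
  qed
  then obtain u where u: "g = (\<Sum>v\<in>C. (\<lambda>x. u v * v x))"
    using vs.span_finite[OF finC] by auto
  have "g = T (\<lambda>x. if x \<in> N then u (T (e x)) else 0)"
    unfolding comb u C_def by (subst sum.reindex[OF inj_on]) (simp add: o_def)
  moreover have "(\<lambda>x. if x \<in> N then u (T (e x)) else 0) \<in> supported N"
    by (simp add: supported_def)
  ultimately show ?thesis by blast
qed

section \<open>Weighted \<open>\<ell>\<^sup>2\<close> spaces and bounded operators\<close>

locale positive_mass =
  fixes G :: "'v wgraph"
  assumes mass_gt_0: "v \<in> verts G \<Longrightarrow> mass G v > 0"
begin

lemma l2_norm_nonneg [simp]: "l2_norm G f \<ge> 0"
  unfolding l2_norm_def
  by (intro real_sqrt_ge_zero infsum_nonneg) (simp add: less_imp_le mass_gt_0)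

lemma l2_norm_squared: "(l2_norm G f)\<^sup>2 = (\<Sum>\<^sub>\<infinity>x\<in>verts G. (cmod (f x))\<^sup>2 * mass G x)"
  unfolding l2_norm_def
  by (intro real_sqrt_pow2 infsum_nonneg) (simp add: less_imp_le mass_gt_0)

lemma l2_boundedI:
  assumes "\<And>x. x \<notin> verts G \<Longrightarrow> f x = 0" and c: "c \<ge> 0"
    and bd: "\<And>X. finite X \<Longrightarrow> X \<subseteq> verts G \<Longrightarrow> (\<Sum>x\<in>X. (cmod (f x))\<^sup>2 * mass G x) \<le> c\<^sup>2"
  shows "f \<in> l2 G" "l2_norm G f \<le> c"
proof -
  have s: "(\<lambda>x. (cmod (f x))\<^sup>2 * mass G x) summable_on verts G"
    by (intro nonneg_bdd_above_summable_on bdd_aboveI2[where M="c\<^sup>2"])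
      (auto simp: less_imp_le mass_gt_0 bd)
  then show "f \<in> l2 G" using assms(1) by (simp add: l2_def)
  have "(\<Sum>\<^sub>\<infinity>x\<in>verts G. (cmod (f x))\<^sup>2 * mass G x) \<le> c\<^sup>2"
    by (intro infsum_le_finite_sums s bd)
  then show "l2_norm G f \<le> c" unfolding l2_norm_def using c by (metis real_le_lsqrt real_sqrt_le_iff real_sqrt_abs abs_of_nonneg)
qed

lemma l2_sum_le:
  assumes "f \<in> l2 G" "finite X" "X \<subseteq> verts G"
  shows "(\<Sum>x\<in>X. (cmod (f x))\<^sup>2 * mass G x) \<le> (l2_norm G f)\<^sup>2"
  unfolding l2_norm_squared using assms
  by (intro finite_sum_le_infsum) (auto simp: l2_def less_imp_le mass_gt_0)

lemma l2_point_le: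
  assumes "f \<in> l2 G"
  shows "cmod (f x) \<le> inverse (sqrt (mass G x)) * l2_norm G f \<or> x \<notin> verts G"
proof (cases "x \<in> verts G")
  case True
  then have "(cmod (f x))\<^sup>2 * mass G x \<le> (l2_norm G f)\<^sup>2"
    using l2_sum_le[OF assms, of "{x}"] by simp
  then have "(cmod (f x) * sqrt (mass G x))\<^sup>2 \<le> (l2_norm G f)\<^sup>2"
    using mass_gt_0[OF True] by (simp add: power_mult_distrib)
  then have "cmod (f x) * sqrt (mass G x) \<le> l2_norm G f"
    using l2_norm_nonneg power2_le_imp_le by blast
  then show ?thesis using mass_gt_0[OF True] by (simp add: field_simps)
qed simp

lemma l2_point_bound: "\<exists>c\<ge>0. \<forall>f\<in>l2 G. cmod (f x) \<le> c * l2_norm G f"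
proof (cases "x \<in> verts G")
  case True
  then show ?thesis using l2_point_le mass_gt_0[OF True]
    by (intro exI[of _ "inverse (sqrt (mass G x))"]) auto
next
  case False
  then show ?thesis by (intro exI[of _ 0]) (auto simp: l2_def)
qed

lemma l2_norm_eq_0: "f \<in> l2 G \<Longrightarrow> l2_norm G f = 0 \<Longrightarrow> f = 0"
  using l2_point_bound by (fastforce simp: fun_eq_iff)

lemma l2_add:
  assumes f: "f \<in> l2 G" and g: "g \<in> l2 G"
  shows l2_add_mem: "f + g \<in> l2 G" and l2_triangle: "l2_norm G (f + g) \<le> l2_norm G f + l2_norm G g"
proof -
  \<comment> \<open>With the square root of the mass moved into the function, finite partial sums
    are unweighted \<open>L2_set\<close> norms and Minkowski's inequality for finite sums
    applies.\<close>
  let ?n = "\<lambda>f. \<lambda>x. cmod (f x) * sqrt (mass G x)"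
  have eq: "(L2_set (?n f) X)\<^sup>2 = (\<Sum>x\<in>X. (cmod (f x))\<^sup>2 * mass G x)"
    if "X \<subseteq> verts G" for f X
  proof -
    have "(L2_set (?n f) X)\<^sup>2 = (\<Sum>x\<in>X. (?n f x)\<^sup>2)"
      unfolding L2_set_def by (simp add: sum_nonneg)
    also have "\<dots> = (\<Sum>x\<in>X. (cmod (f x))\<^sup>2 * mass G x)"
      using that mass_gt_0 by (intro sum.cong) (auto simp: power_mult_distrib less_imp_le subset_iff)
    finally show ?thesis .
  qed
  have le: "L2_set (?n f) X \<le> l2_norm G f" if "f \<in> l2 G" "finite X" "X \<subseteq> verts G" for f X
    using l2_sum_le[OF that] eq[OF that(3), of f] l2_norm_nonneg power2_le_imp_le by metis
  have "(\<Sum>x\<in>X. (cmod ((f + g) x))\<^sup>2 * mass G x) \<le> (l2_norm G f + l2_norm G g)\<^sup>2"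
    if X: "finite X" "X \<subseteq> verts G" for X
  proof -
    have "L2_set (?n (f + g)) X \<le> L2_set (\<lambda>x. ?n f x + ?n g x) X"
      using X(2) mass_gt_0
      by (intro L2_set_mono) (auto simp: distrib_right[symmetric] norm_triangle_ineq less_imp_le subset_iff intro!: mult_right_mono)
    also have "\<dots> \<le> L2_set (?n f) X + L2_set (?n g) X" by (rule L2_set_triangle_ineq)
    also have "\<dots> \<le> l2_norm G f + l2_norm G g" using le f g X by (intro add_mono) auto
    finally have "(L2_set (?n (f + g)) X)\<^sup>2 \<le> (l2_norm G f + l2_norm G g)\<^sup>2"
      by (intro power_mono) (auto simp: L2_set_nonneg)
    then show ?thesis using eq X by simp
  qed
  moreover have "(f + g) x = 0" if "x \<notin> verts G" for x using f g that by (simp add: l2_def)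
  ultimately show "f + g \<in> l2 G" "l2_norm G (f + g) \<le> l2_norm G f + l2_norm G g"
    using l2_boundedI[of "f + g" "l2_norm G f + l2_norm G g"] by auto
qed

lemma l2_scale_mem: "f \<in> l2 G \<Longrightarrow> (\<lambda>x. c * f x) \<in> l2 G"
  using summable_on_cmult_right[of "\<lambda>x. (cmod (f x))\<^sup>2 * mass G x" "verts G" "(cmod c)\<^sup>2"]
  by (simp add: l2_def norm_mult power_mult_distrib mult.assoc)

lemma l2_norm_scale: "l2_norm G (\<lambda>x. c * f x) = cmod c * l2_norm G f"
  unfolding l2_norm_def
  by (simp add: norm_mult power_mult_distrib mult.assoc infsum_cmult_right' real_sqrt_mult)

lemma l2_uminus_mem: "f \<in> l2 G \<Longrightarrow> - f \<in> l2 G"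
  using l2_scale_mem[of f "-1"] by (simp add: fun_Compl_def)

lemma l2_diff_mem: "f \<in> l2 G \<Longrightarrow> g \<in> l2 G \<Longrightarrow> f - g \<in> l2 G"
  using l2_add_mem[of f "- g"] l2_uminus_mem[of g] by simp

lemma l2_norm_uminus: "l2_norm G (- f) = l2_norm G f"
  by (simp add: l2_norm_def)

lemma l2_norm_diff: "f \<in> l2 G \<Longrightarrow> g \<in> l2 G \<Longrightarrow> l2_norm G (f - g) \<le> l2_norm G f + l2_norm G g"
  using l2_triangle[of f "- g"] l2_uminus_mem[of g] by (simp add: l2_norm_uminus)

lemma l2_zero [simp]: "0 \<in> l2 G"
  by (simp add: l2_def)

lemma supported_l2: "finite N \<Longrightarrow> N \<subseteq> verts G \<Longrightarrow> supported N \<subseteq> l2 G"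
proof
  fix f assume N: "finite N" "N \<subseteq> verts G" and f: "f \<in> supported N"
  have "(\<lambda>x. (cmod (f x))\<^sup>2 * mass G x) summable_on verts G"
    using summable_on_cong_neutral[of N "verts G" "\<lambda>x. (cmod (f x))\<^sup>2 * mass G x"
        "\<lambda>x. (cmod (f x))\<^sup>2 * mass G x"] N f
    by (auto simp: supported_def)
  then show "f \<in> l2 G" using N(2) f by (auto simp: l2_def supported_def)
qed

end

section \<open>Algebra of bounded operators between weighted spaces\<close>

lemma bounded_op_alt:
  "bounded_op G H T \<longleftrightarrow>
     (\<forall>f\<in>l2 G. T f \<in> l2 H) \<and>
     (\<forall>f\<in>l2 G. \<forall>g\<in>l2 G. T (f + g) = T f + T g) \<and>
     (\<forall>f\<in>l2 G. \<forall>c. T (\<lambda>x. c * f x) = (\<lambda>y. c * T f y)) \<and>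
     (\<exists>K. \<forall>f\<in>l2 G. l2_norm H (T f) \<le> K * l2_norm G f)"
  by (simp add: bounded_op_def plus_fun_def)

lemma bounded_op_mem: "bounded_op G H T \<Longrightarrow> f \<in> l2 G \<Longrightarrow> T f \<in> l2 H"
  by (simp add: bounded_op_def)

lemma bounded_op_add: "bounded_op G H T \<Longrightarrow> f \<in> l2 G \<Longrightarrow> g \<in> l2 G \<Longrightarrow> T (f + g) = T f + T g"
  by (simp add: bounded_op_alt)

lemma bounded_op_scale: "bounded_op G H T \<Longrightarrow> f \<in> l2 G \<Longrightarrow> T (\<lambda>x. c * f x) = (\<lambda>y. c * T f y)"
  by (simp add: bounded_op_def)

context positive_mass
begin

lemma bounded_op_zero: "bounded_op G H T \<Longrightarrow> T 0 = 0"
  using bounded_op_scale[of G H T 0 0] l2_zero by (simp add: zero_fun_def)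

lemma bounded_op_uminus: "bounded_op G H T \<Longrightarrow> f \<in> l2 G \<Longrightarrow> T (- f) = - T f"
  using bounded_op_scale[of G H T f "-1"] by (simp add: fun_Compl_def)

lemma bounded_op_diff: "bounded_op G H T \<Longrightarrow> f \<in> l2 G \<Longrightarrow> g \<in> l2 G \<Longrightarrow> T (f - g) = T f - T g"
  using bounded_op_add[of G H T f "- g"] bounded_op_uminus[of H T g] l2_uminus_mem[of g] by simp

lemma bounded_op_bound:
  assumes "bounded_op G H T"
  obtains K where "K > 0" "\<And>f. f \<in> l2 G \<Longrightarrow> l2_norm H (T f) \<le> K * l2_norm G f"
proof -
  obtain K where K: "\<forall>f\<in>l2 G. l2_norm H (T f) \<le> K * l2_norm G f"
    using assms by (auto simp: bounded_op_def)
  \<comment> \<open>The bound in \<open>bounded_op\<close> may be negative or 0;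
    \<open>\<bar>K\<bar> + 1\<close> makes it positive, so that later estimates can divide by
    it.\<close>
  have "l2_norm H (T f) \<le> (\<bar>K\<bar> + 1) * l2_norm G f" if "f \<in> l2 G" for f
  proof -
    have "K * l2_norm G f \<le> (\<bar>K\<bar> + 1) * l2_norm G f" by (intro mult_right_mono) auto
    then show ?thesis using K that by force
  qed
  then show ?thesis using that[of "\<bar>K\<bar> + 1"] by simp
qed

lemma bounded_op_id: "bounded_op G G (\<lambda>f. f)"
  by (auto simp: bounded_op_def intro!: exI[of _ 1])

lemma bounded_op_comp:
  assumes T: "bounded_op G H T" and H: "positive_mass H" and S: "bounded_op H K S"
  shows "bounded_op G K (\<lambda>f. S (T f))"
proof -
  obtain k where k: "k > 0" "\<And>f. f \<in> l2 G \<Longrightarrow> l2_norm H (T f) \<le> k * l2_norm G f"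
    using bounded_op_bound[OF T] by blast
  obtain l where l: "l > 0" "\<And>f. f \<in> l2 H \<Longrightarrow> l2_norm K (S f) \<le> l * l2_norm H f"
    using positive_mass.bounded_op_bound[OF H S] by blast
  have "l2_norm K (S (T f)) \<le> (l * k) * l2_norm G f" if f: "f \<in> l2 G" for f
    using order.trans[OF l(2)[OF bounded_op_mem[OF T f]] mult_left_mono[OF k(2)[OF f]]] l(1)
    by (simp add: mult.assoc)
  then show ?thesis
    using T S unfolding bounded_op_alt by auto
qed

lemma bounded_op_plus:
  assumes T: "bounded_op G H T" and H: "positive_mass H" and S: "bounded_op G H S"
  shows "bounded_op G H (\<lambda>f. T f + S f)"
proof -
  obtain k where k: "k > 0" "\<And>f. f \<in> l2 G \<Longrightarrow> l2_norm H (T f) \<le> k * l2_norm G f"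
    using bounded_op_bound[OF T] by blast
  obtain l where l: "l > 0" "\<And>f. f \<in> l2 G \<Longrightarrow> l2_norm H (S f) \<le> l * l2_norm G f"
    using bounded_op_bound[OF S] by blast
  have "l2_norm H (T f + S f) \<le> (k + l) * l2_norm G f" if f: "f \<in> l2 G" for f
    using positive_mass.l2_triangle[OF H bounded_op_mem[OF T f] bounded_op_mem[OF S f]]
      k(2)[OF f] l(2)[OF f] by (simp add: distrib_right)
  moreover have "(\<lambda>y. c * (T f + S f) y) = T (\<lambda>x. c * f x) + S (\<lambda>x. c * f x)" if f: "f \<in> l2 G" for f c
    using bounded_op_scale[OF T f] bounded_op_scale[OF S f] by (simp add: fun_eq_iff distrib_left)
  ultimately have "\<exists>k. \<forall>f\<in>l2 G. l2_norm H (T f + S f) \<le> k * l2_norm G f"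
      "\<forall>f\<in>l2 G. \<forall>c. T (\<lambda>x. c * f x) + S (\<lambda>x. c * f x) = (\<lambda>y. c * (T f + S f) y)" by auto
  then show ?thesis
    using T S positive_mass.l2_add_mem[OF H] unfolding bounded_op_alt by (simp add: ac_simps)
qed

lemma bounded_op_cmul:
  assumes T: "bounded_op G H T" and H: "positive_mass H"
  shows "bounded_op G H (\<lambda>f x. c * T f x)"
proof -
  obtain k where k: "k > 0" "\<And>f. f \<in> l2 G \<Longrightarrow> l2_norm H (T f) \<le> k * l2_norm G f"
    using bounded_op_bound[OF T] by blast
  have "l2_norm H (\<lambda>x. c * T f x) \<le> (cmod c * k) * l2_norm G f" if f: "f \<in> l2 G" for f
    using mult_left_mono[OF k(2)[OF f], of "cmod c"] positive_mass.l2_norm_scale[OF H]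
    by (simp add: mult.assoc)
  then have "\<exists>k. \<forall>f\<in>l2 G. l2_norm H (\<lambda>x. c * T f x) \<le> k * l2_norm G f" by blast
  then show ?thesis
    using T positive_mass.l2_scale_mem[OF H] unfolding bounded_op_alt
    by (simp add: fun_eq_iff distrib_left mult.left_commute)
qed

lemma bounded_op_minus:
  assumes "bounded_op G H T" "positive_mass H" "bounded_op G H S"
  shows "bounded_op G H (\<lambda>f. T f - S f)"
proof -
  have "bounded_op G H (\<lambda>f. T f + (\<lambda>x. (-1) * S f x))"
    by (intro bounded_op_plus bounded_op_cmul assms)
  moreover have "T f + (\<lambda>x. (-1) * S f x) = T f - S f" for f by (auto simp: fun_eq_iff)
  ultimately show ?thesis by simp
qed

text \<open>Only the bound is recorded: the functionals are coordinates of maps whose linearity is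
  established separately.\<close>

definition bounded_functional :: "(('v \<Rightarrow> complex) \<Rightarrow> complex) \<Rightarrow> bool" where
  "bounded_functional \<phi> \<longleftrightarrow> (\<exists>c. \<forall>f\<in>l2 G. cmod (\<phi> f) \<le> c * l2_norm G f)"

lemma bounded_functional_point: "bounded_functional (\<lambda>f. f x)"
  using l2_point_bound by (auto simp: bounded_functional_def)

lemma bounded_functional_diff:
  assumes "bounded_functional \<phi>" "bounded_functional \<psi>"
  shows "bounded_functional (\<lambda>f. \<phi> f - \<psi> f)"
proof -
  obtain c d where c: "\<And>f. f \<in> l2 G \<Longrightarrow> cmod (\<phi> f) \<le> c * l2_norm G f"
    and d: "\<And>f. f \<in> l2 G \<Longrightarrow> cmod (\<psi> f) \<le> d * l2_norm G f"
    using assms by (auto simp: bounded_functional_def)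
  have "cmod (\<phi> f - \<psi> f) \<le> (c + d) * l2_norm G f" if "f \<in> l2 G" for f
    using c[OF that] d[OF that] norm_triangle_ineq4[of "\<phi> f" "\<psi> f"] by (simp add: distrib_right)
  then show ?thesis by (auto simp: bounded_functional_def)
qed

lemma bounded_functional_sum:
  assumes "\<And>i. i \<in> I \<Longrightarrow> bounded_functional (\<phi> i)"
  shows "bounded_functional (\<lambda>f. \<Sum>i\<in>I. k i * \<phi> i f)"
proof -
  obtain c where c: "\<And>i f. i \<in> I \<Longrightarrow> f \<in> l2 G \<Longrightarrow> cmod (\<phi> i f) \<le> c i * l2_norm G f"
    using assms unfolding bounded_functional_def by metis
  have "cmod (\<Sum>i\<in>I. k i * \<phi> i f) \<le> (\<Sum>i\<in>I. cmod (k i) * c i) * l2_norm G f" if "f \<in> l2 G" for f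
    unfolding sum_distrib_right using c[OF _ that]
    by (intro order.trans[OF norm_sum] sum_mono) (auto simp: norm_mult mult.assoc intro!: mult_left_mono)
  then show ?thesis by (auto simp: bounded_functional_def)
qed

lemma bounded_functional_op:
  assumes T: "bounded_op G H T" and H: "positive_mass H"
  shows "bounded_functional (\<lambda>f. T f x)"
proof -
  obtain k where k: "k > 0" "\<And>f. f \<in> l2 G \<Longrightarrow> l2_norm H (T f) \<le> k * l2_norm G f"
    using bounded_op_bound[OF T] by blast
  obtain c where c: "c \<ge> 0" "\<And>f. f \<in> l2 H \<Longrightarrow> cmod (f x) \<le> c * l2_norm H f"
    using positive_mass.l2_point_bound[OF H] by blast
  have "cmod (T f x) \<le> (c * k) * l2_norm G f" if f: "f \<in> l2 G" for f
    using order.trans[OF c(2)[OF bounded_op_mem[OF T f]] mult_left_mono[OF k(2)[OF f] c(1)]]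
    by (simp add: mult.assoc)
  then show ?thesis by (auto simp: bounded_functional_def)
qed

text \<open>Off a finite set of coordinates \<open>T\<close> merely moves coordinates along \<iota>
  without increasing their weighted squares; these contribute at most the square of the norm of
  \<open>f\<close>, and the finitely many other coordinates contribute \<open>D\<close> times it.
  The map \<iota> is the identity for operators on \<open>G\<close>, and passes between a vertex and
  its singleton reach for the transfer maps.\<close>

lemma bounded_opI_finite:
  assumes H: "positive_mass H"
    and add: "\<And>f g. f \<in> l2 G \<Longrightarrow> g \<in> l2 G \<Longrightarrow> T (f + g) = T f + T g"
    and scale: "\<And>c f. f \<in> l2 G \<Longrightarrow> T (\<lambda>x. c * f x) = (\<lambda>y. c * T f y)"
    and out: "\<And>f y. f \<in> l2 G \<Longrightarrow> y \<notin> verts H \<Longrightarrow> T f y = 0"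
    and N: "finite N"
    and pt: "\<And>y. y \<in> N \<Longrightarrow> bounded_functional (\<lambda>f. T f y)"
    and inj: "inj_on \<iota> (verts H - N)" "\<iota> ` (verts H - N) \<subseteq> verts G"
    and eq: "\<And>f y. f \<in> l2 G \<Longrightarrow> y \<in> verts H - N \<Longrightarrow>
        (cmod (T f y))\<^sup>2 * mass H y \<le> (cmod (f (\<iota> y)))\<^sup>2 * mass G (\<iota> y)"
  shows "bounded_op G H T"
proof -
  obtain c where c: "\<And>y f. y \<in> N \<Longrightarrow> f \<in> l2 G \<Longrightarrow> cmod (T f y) \<le> c y * l2_norm G f"
    using pt unfolding bounded_functional_def by metis
  \<comment> \<open>\<open>N\<close> may contain points outside \<open>verts H\<close>, where the
    mass has no sign; the absolute value keeps every term nonnegative.\<close>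
  define D where "D = (\<Sum>y\<in>N. (c y)\<^sup>2 * \<bar>mass H y\<bar>)"
  have D: "D \<ge> 0" unfolding D_def by (intro sum_nonneg) auto
  have *: "T f \<in> l2 H \<and> l2_norm H (T f) \<le> sqrt (1 + D) * l2_norm G f" if f: "f \<in> l2 G" for f
  proof -
    have "(\<Sum>y\<in>Y. (cmod (T f y))\<^sup>2 * mass H y) \<le> (sqrt (1 + D) * l2_norm G f)\<^sup>2"
      if Y: "finite Y" "Y \<subseteq> verts H" for Y
    proof -
      have "(\<Sum>y\<in>Y. (cmod (T f y))\<^sup>2 * mass H y) =
          (\<Sum>y\<in>Y - N. (cmod (T f y))\<^sup>2 * mass H y) + (\<Sum>y\<in>Y \<inter> N. (cmod (T f y))\<^sup>2 * mass H y)"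
        using sum.Int_Diff[OF Y(1), of _ N] by (simp add: add.commute)
      moreover have "(\<Sum>y\<in>Y - N. (cmod (T f y))\<^sup>2 * mass H y)
          \<le> (\<Sum>y\<in>Y - N. (cmod (f (\<iota> y)))\<^sup>2 * mass G (\<iota> y))"
        using Y f by (intro sum_mono eq) auto
      moreover have "\<dots> = (\<Sum>x\<in>\<iota> ` (Y - N). (cmod (f x))\<^sup>2 * mass G x)"
        using Y inj_on_subset[OF inj(1), of "Y - N"] by (subst sum.reindex) auto
      moreover have "\<dots> \<le> (l2_norm G f)\<^sup>2"
        using Y inj(2) by (intro l2_sum_le f) auto
      moreover have "(\<Sum>y\<in>Y \<inter> N. (cmod (T f y))\<^sup>2 * mass H y)
          \<le> (\<Sum>y\<in>Y \<inter> N. (c y * l2_norm G f)\<^sup>2 * \<bar>mass H y\<bar>)"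
        using c[OF _ f] Y positive_mass.mass_gt_0[OF H]
        by (intro sum_mono mult_mono power_mono) (auto simp: less_imp_le subset_iff)
      moreover have "\<dots> \<le> (\<Sum>y\<in>N. (c y * l2_norm G f)\<^sup>2 * \<bar>mass H y\<bar>)"
        using N by (intro sum_mono2) auto
      moreover have "\<dots> = D * (l2_norm G f)\<^sup>2"
        unfolding D_def sum_distrib_right by (intro sum.cong) (auto simp: power_mult_distrib)
      ultimately have "(\<Sum>y\<in>Y. (cmod (T f y))\<^sup>2 * mass H y) \<le> (1 + D) * (l2_norm G f)\<^sup>2"
        by (simp add: algebra_simps)
      then show ?thesis using D by (simp add: power_mult_distrib)
    qed
    then show ?thesis
      using positive_mass.l2_boundedI[OF H, of "T f" "sqrt (1 + D) * l2_norm G f"] out[OF f] D by auto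
  qed
  then show ?thesis unfolding bounded_op_alt using add scale by blast
qed

lemma bounded_op_finite_range:
  assumes N: "finite N" "N \<subseteq> verts G"
    and "\<And>f g. f \<in> l2 G \<Longrightarrow> g \<in> l2 G \<Longrightarrow> T (f + g) = T f + T g"
    and "\<And>c f. f \<in> l2 G \<Longrightarrow> T (\<lambda>x. c * f x) = (\<lambda>y. c * T f y)"
    and range: "\<And>f. f \<in> l2 G \<Longrightarrow> T f \<in> supported N"
    and "\<And>y. y \<in> N \<Longrightarrow> bounded_functional (\<lambda>f. T f y)"
  shows "bounded_op G G T"
proof (rule bounded_opI_finite[where \<iota>="\<lambda>x. x"])
  show "T f y = 0" if "f \<in> l2 G" "y \<notin> verts G" for f y
    using supportedD[OF range[OF that(1)]] that(2) N(2) by blast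
  show "(cmod (T f y))\<^sup>2 * mass G y \<le> (cmod (f y))\<^sup>2 * mass G y"
    if "f \<in> l2 G" "y \<in> verts G - N" for f y
    using supportedD[OF range[OF that(1)], of y] that(2) mass_gt_0[of y] by simp
qed (use assms positive_mass_axioms in auto)

text \<open>An a priori bound on a solution of \<open>(T - z) f = g\<close> is also a bound on the
  resolvent, because injectivity identifies that solution with
  \<open>resolvent G T z g\<close>.\<close>

lemma resolvent_setI:
  assumes T: "\<And>f. f \<in> l2 G \<Longrightarrow> T f \<in> l2 G"
      "\<And>f g. f \<in> l2 G \<Longrightarrow> g \<in> l2 G \<Longrightarrow> T (f + g) = T f + T g"
      "\<And>f c. f \<in> l2 G \<Longrightarrow> T (\<lambda>x. c * f x) = (\<lambda>y. c * T f y)"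
    and inj: "\<And>f. f \<in> l2 G \<Longrightarrow> (\<lambda>x. T f x - z * f x) = 0 \<Longrightarrow> f = 0"
    and surj: "\<And>g. g \<in> l2 G \<Longrightarrow> \<exists>f\<in>l2 G. (\<lambda>x. T f x - z * f x) = g \<and> l2_norm G f \<le> K * l2_norm G g"
  shows "z \<in> resolvent_set G T"
proof -
  let ?U = "\<lambda>f x. T f x - z * f x"
  have U: "?U f \<in> l2 G" if "f \<in> l2 G" for f
    using l2_diff_mem[OF T(1)[OF that] l2_scale_mem[OF that, of z]] by (simp add: fun_diff_def)
  have add: "?U (f + g) = ?U f + ?U g" if "f \<in> l2 G" "g \<in> l2 G" for f g
    using T(2)[OF that] by (simp add: fun_eq_iff algebra_simps)
  have scale: "?U (\<lambda>x. c * f x) = (\<lambda>x. c * ?U f x)" if "f \<in> l2 G" for f c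
    using T(3)[OF that] by (simp add: fun_eq_iff algebra_simps)
  have inj_on: "inj_on ?U (l2 G)"
  proof (rule inj_onI)
    fix f g assume f: "f \<in> l2 G" and g: "g \<in> l2 G" and e: "?U f = ?U g"
    have "?U (f + (\<lambda>x. (-1) * g x)) = ?U f + (\<lambda>x. (-1) * ?U g x)"
      unfolding T(2)[OF f l2_scale_mem[OF g]] T(3)[OF g] by (simp add: fun_eq_iff algebra_simps)
    also have "\<dots> = 0" using e by (auto simp: fun_eq_iff)
    finally have "f + (\<lambda>x. (-1) * g x) = 0"
      using inj[OF l2_add_mem[OF f l2_scale_mem[OF g]]] by blast
    then show "f = g" by (simp add: fun_eq_iff)
  qed
  have bij: "bij_betw ?U (l2 G) (l2 G)"
    unfolding bij_betw_def using inj_on U surj by fast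
  let ?R = "resolvent G T z"
  have R: "?R g \<in> l2 G" "?U (?R g) = g" if "g \<in> l2 G" for g
    using bij_betw_inv_into_right[OF bij that] that bij_betw_apply[OF bij_betw_inv_into[OF bij] that]
    by (simp_all only: resolvent_def)
  have RU: "?R (?U f) = f" if "f \<in> l2 G" for f
    using that inj_on unfolding resolvent_def by (rule inv_into_f_f[rotated])
  have "?R (f + g) = ?R f + ?R g" if "f \<in> l2 G" "g \<in> l2 G" for f g
    using RU[OF l2_add_mem[OF R(1)[OF that(1)] R(1)[OF that(2)]]]
    unfolding add[OF R(1)[OF that(1)] R(1)[OF that(2)]] R(2)[OF that(1)] R(2)[OF that(2)] .
  moreover have "?R (\<lambda>x. c * f x) = (\<lambda>x. c * ?R f x)" if "f \<in> l2 G" for f c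
    using RU[OF l2_scale_mem[OF R(1)[OF that]]]
    unfolding scale[OF R(1)[OF that]] using R(2)[OF that] by metis
  moreover have "l2_norm G (?R g) \<le> K * l2_norm G g" if "g \<in> l2 G" for g
    using surj[OF that] RU by fastforce
  ultimately have "bounded_op G G ?R" unfolding bounded_op_alt using R(1) by blast
  then show ?thesis using bij by (simp add: resolvent_set_def)
qed

lemma resolvent_eqs:
  assumes "z \<in> resolvent_set G T"
  shows "bounded_op G G (resolvent G T z)"
    and "\<And>g. g \<in> l2 G \<Longrightarrow> (\<lambda>x. T (resolvent G T z g) x - z * resolvent G T z g x) = g"
    and "\<And>f. f \<in> l2 G \<Longrightarrow> resolvent G T z (\<lambda>x. T f x - z * f x) = f"
proof -
  let ?U = "\<lambda>f x. T f x - z * f x"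
  have bij: "bij_betw ?U (l2 G) (l2 G)" and b: "bounded_op G G (resolvent G T z)"
    using assms by (auto simp: resolvent_set_def)
  show "bounded_op G G (resolvent G T z)" by (rule b)
  show "?U (resolvent G T z g) = g" if "g \<in> l2 G" for g
    unfolding resolvent_def by (rule bij_betw_inv_into_right[OF bij that])
  show "resolvent G T z (?U f) = f" if "f \<in> l2 G" for f
    unfolding resolvent_def by (rule bij_betw_inv_into_left[OF bij that])
qed

end

section \<open>Strong coupling in the abstract\<close>

context positive_mass
begin

text \<open>If \<open>f\<close> solves the equation, \<open>P M = 0\<close> leaves
  \<open>P A f = P g\<close>; applying \<open>B\<close> gives \<open>P f = B g - B A w\<close> for
  \<open>w = f - P f\<close>. Applying \<open>S\<close> gives
  \<open>w = S (g - A f) / \<beta>\<close>, where \<open>A f\<close> is again linear in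
  \<open>g\<close> and \<open>w\<close>. The four identities for \<open>B\<close> say that on the
  range of \<open>P\<close> it is the inverse of the compression \<open>P A P\<close>.\<close>

lemma strong_coupling:
  assumes bA: "bounded_op G G A" and bM: "bounded_op G G M" and bP: "bounded_op G G P"
    and bS: "bounded_op G G S" and bB: "bounded_op G G B"
    and N: "finite N" "N \<subseteq> verts G" and SN: "\<And>f. f \<in> l2 G \<Longrightarrow> S f \<in> supported N"
    and MS: "\<And>f. f \<in> l2 G \<Longrightarrow> M (S f) = f - P f" and SM: "\<And>f. f \<in> l2 G \<Longrightarrow> S (M f) = f - P f"
    and MP: "\<And>f. f \<in> l2 G \<Longrightarrow> M (P f) = 0" and PM: "\<And>f. f \<in> l2 G \<Longrightarrow> P (M f) = 0"
    and PB: "\<And>f. f \<in> l2 G \<Longrightarrow> P (B f) = B f" and BP: "\<And>f. f \<in> l2 G \<Longrightarrow> B (P f) = B f"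
    and PAB: "\<And>f. f \<in> l2 G \<Longrightarrow> P (A (B f)) = P f" and BAP: "\<And>f. f \<in> l2 G \<Longrightarrow> B (A (P f)) = P f"
  shows "\<exists>C>0. \<exists>b>0. \<forall>\<beta>::complex. cmod \<beta> \<ge> b \<longrightarrow>
      (\<forall>f\<in>l2 G. (\<lambda>x. A f x + \<beta> * M f x) = 0 \<longrightarrow> f = 0) \<and>
      (\<forall>g\<in>l2 G. \<exists>f\<in>l2 G. (\<lambda>x. A f x + \<beta> * M f x) = g \<and>
         l2_norm G (f - B g) \<le> C / cmod \<beta> * l2_norm G g)"
proof -
  note G = positive_mass_axioms
  note mem = bounded_op_mem[OF bA] bounded_op_mem[OF bM] bounded_op_mem[OF bP]
    bounded_op_mem[OF bS] bounded_op_mem[OF bB] l2_add_mem l2_diff_mem l2_scale_mem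
  \<comment> \<open>\<open>E w\<close> completes \<open>w\<close> by the kernel vector that makes
    \<open>P A\<close> vanish. With \<open>f = B g + E w\<close> one gets
    \<open>S (g - A f) = T g - D w\<close>, so the equation for \<open>w\<close> becomes
    \<open>w + D w / \<beta> = T g / \<beta>\<close>.\<close>
  define E where "E = (\<lambda>w. w - B (A w))"
  define D where "D = (\<lambda>w. S (A (E w)))"
  define T where "T = (\<lambda>g. S (g - A (B g)))"
  have bE: "bounded_op G G E" unfolding E_def
    by (intro bounded_op_minus bounded_op_id G bounded_op_comp[OF bA G bB])
  have bD: "bounded_op G G D" unfolding D_def
    by (intro bounded_op_comp[OF bounded_op_comp[OF bE G bA] G bS])
  have "bounded_op G G (\<lambda>g. g - A (B g))"
    by (intro bounded_op_minus bounded_op_id G bounded_op_comp[OF bB G bA])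
  then have bT: "bounded_op G G T" unfolding T_def by (intro bounded_op_comp[OF _ G bS])
  obtain d where d: "d > 0" "\<And>f. f \<in> l2 G \<Longrightarrow> l2_norm G (D f) \<le> d * l2_norm G f"
    using bounded_op_bound[OF bD] by blast
  obtain c where c: "c > 0" "\<And>f. f \<in> l2 G \<Longrightarrow> l2_norm G (T f) \<le> c * l2_norm G f"
    using bounded_op_bound[OF bT] by blast
  obtain e where e: "e > 0" "\<And>f. f \<in> l2 G \<Longrightarrow> l2_norm G (E f) \<le> e * l2_norm G f"
    using bounded_op_bound[OF bE] by blast
  have E: "E w \<in> l2 G" if "w \<in> l2 G" for w using bounded_op_mem[OF bE that] .
  have D: "D w \<in> l2 G" if "w \<in> l2 G" for w using bounded_op_mem[OF bD that] .
  have Tm: "T w \<in> l2 G" if "w \<in> l2 G" for w using bounded_op_mem[OF bT that] .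
  have ME: "M (E w) = M w" if "w \<in> l2 G" for w
  proof -
    have "M (B (A w)) = 0" using PB[of "A w"] MP[of "B (A w)"] that mem by simp
    then show ?thesis unfolding E_def using bounded_op_diff[OF bM] that mem by simp
  qed
  have MB: "M (B g) = 0" if "g \<in> l2 G" for g using PB[of g] MP[of "B g"] that mem by simp
  have PAE: "P (A (E w)) = 0" if "w \<in> l2 G" for w
    unfolding E_def using PAB[of "A w"] that mem bounded_op_diff[OF bA] bounded_op_diff[OF bP] by simp

  \<comment> \<open>The threshold \<open>2 * d\<close> makes \<open>D / \<beta>\<close> shrink norms
    by 1/2; this gives uniqueness below and the factor 2 in the final constant.\<close>
  have half: "l2_norm G (\<lambda>x. 1 / \<beta> * D w x) \<le> l2_norm G w / 2"
    if w: "w \<in> l2 G" and \<beta>: "cmod \<beta> \<ge> 2 * d" for w \<beta>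
  proof -
    have "l2_norm G (\<lambda>x. 1 / \<beta> * D w x) = l2_norm G (D w) / cmod \<beta>"
      by (subst l2_norm_scale) (simp add: norm_divide)
    also have "\<dots> \<le> (d * l2_norm G w) / (2 * d)"
      using d(1) \<beta> by (intro frac_le d(2) w) auto
    finally show ?thesis using d(1) by simp
  qed
  have contr: "w = 0" if w: "w \<in> l2 G" and \<beta>: "cmod \<beta> \<ge> 2 * d" and eq: "w = (\<lambda>x. - (1 / \<beta> * D w x))" for w \<beta>
  proof -
    have "l2_norm G w = l2_norm G (\<lambda>x. 1 / \<beta> * D w x)"
      by (subst eq) (simp add: l2_norm_def)
    then have "l2_norm G w = 0" using half[OF w \<beta>] l2_norm_nonneg[of w] by linarith
    then show ?thesis using l2_norm_eq_0[OF w] by blast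
  qed

  have uniq: "f = 0"
    if f: "f \<in> l2 G" and eq: "(\<lambda>x. A f x + \<beta> * M f x) = 0" and \<beta>: "cmod \<beta> \<ge> 2 * d" for f \<beta>
  proof -
    have "\<beta> \<noteq> 0" using \<beta> d by auto
    define w where "w = f - P f"
    have w: "w \<in> l2 G" using f mem by (simp add: w_def)
    have eq': "A f + (\<lambda>x. \<beta> * M f x) = 0" using eq by (simp add: plus_fun_def)
    \<comment> \<open>\<open>P\<close> removes the large term \<open>\<beta> M f\<close> from the
      equation, while \<open>S\<close> isolates it as \<open>\<beta> w\<close>.\<close>
    have "P (A f + (\<lambda>x. \<beta> * M f x)) = P (A f)"
      using f mem PM[OF f] bounded_op_add[OF bP] bounded_op_scale[OF bP]
      by (simp add: fun_eq_iff)
    then have PAf: "P (A f) = 0" using eq' bounded_op_zero[OF bP] by simp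
    have "S (A f + (\<lambda>x. \<beta> * M f x)) = S (A f) + (\<lambda>x. \<beta> * w x)"
      using f mem SM[OF f] bounded_op_add[OF bS] bounded_op_scale[OF bS] by (simp add: w_def)
    then have SAf: "S (A f) + (\<lambda>x. \<beta> * w x) = 0" using eq' bounded_op_zero[OF bS] by simp
    have "A f = A (P f) + A w"
      using bounded_op_add[OF bA, of "P f" w] f w mem by (simp add: w_def)
    then have "B (A f) = P f + B (A w)"
      using bounded_op_add[OF bB, of "A (P f)" "A w"] f w mem BAP[OF f] by simp
    moreover have "B (A f) = 0"
      using BP[of "A f"] PAf f mem bounded_op_zero[OF bB] by simp
    ultimately have "P f = - B (A w)" by (simp add: add_eq_0_iff2)
    moreover have "f = w + P f" by (simp add: w_def)
    ultimately have fE: "f = E w" unfolding E_def by (metis uminus_add_conv_diff add.commute)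
    have "w = (\<lambda>x. - (1 / \<beta> * D w x))"
    proof
      fix x have "D w x + \<beta> * w x = 0"
        using fun_cong[OF SAf, of x] by (simp add: D_def fE[symmetric])
      then show "w x = - (1 / \<beta> * D w x)"
        using \<open>\<beta> \<noteq> 0\<close> by (simp add: field_simps add_eq_0_iff)
    qed
    then have "w = 0" using contr w \<beta> by blast
    then show "f = 0" using fE bounded_op_zero[OF bE] by simp
  qed

  have ex: "\<exists>f\<in>l2 G. (\<lambda>x. A f x + \<beta> * M f x) = g \<and>
      l2_norm G (f - B g) \<le> (2 * c * e) / cmod \<beta> * l2_norm G g"
    if g: "g \<in> l2 G" and \<beta>: "cmod \<beta> \<ge> 2 * d" for g \<beta>
  proof -
    have \<beta>0: "\<beta> \<noteq> 0" using \<beta> d by auto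
    note sub = subsetD[OF supported_l2[OF N]]
    define U where "U = (\<lambda>w x. w x + 1 / \<beta> * D w x)"
    \<comment> \<open>\<open>D\<close> takes values in \<open>supported N\<close>, so
      \<open>U\<close> is an endomorphism of a finite-dimensional space, and its injectivity follows
      from the contraction estimate.\<close>
    have "\<exists>w\<in>supported N. U w = (\<lambda>x. 1 / \<beta> * T g x)"
    proof (rule inj_imp_surj_supported[OF N(1)])
      show "U f \<in> supported N" if "f \<in> supported N" for f
        using SN[of "A (E f)"] mem E sub[OF that] that by (simp add: U_def D_def supported_def)
      show "U (f + h) = U f + U h" if "f \<in> supported N" "h \<in> supported N" for f h
        using bounded_op_add[OF bD sub[OF that(1)] sub[OF that(2)]]
        by (simp add: U_def fun_eq_iff algebra_simps add_divide_distrib)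
      show "U (\<lambda>x. a * f x) = (\<lambda>x. a * U f x)" if "f \<in> supported N" for f a
        using bounded_op_scale[OF bD sub[OF that], of a]
        by (simp add: U_def fun_eq_iff algebra_simps)
      show "f = 0" if "f \<in> supported N" "U f = 0" for f
        using contr[OF sub[OF that(1)] \<beta>] that(2)
        by (auto simp: U_def fun_eq_iff eq_neg_iff_add_eq_0)
      show "(\<lambda>x. 1 / \<beta> * T g x) \<in> supported N"
        using SN[of "g - A (B g)"] mem g by (simp add: T_def supported_def)
    qed
    then obtain w where wN: "w \<in> supported N" and Uw: "U w = (\<lambda>x. 1 / \<beta> * T g x)" by blast
    have w: "w \<in> l2 G" using sub[OF wN] .
    define f where "f = B g + E w"
    have f: "f \<in> l2 G" using g w mem E by (simp add: f_def)
    have "A f = A (B g) + A (E w)"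
      using bounded_op_add[OF bA] g w mem E by (simp add: f_def)
    then have "S (g - A f) = T g - D w"
      using bounded_op_diff[OF bS, of "g - A (B g)" "A (E w)"] g w mem E
      by (simp add: T_def D_def diff_diff_eq)
    moreover have "w = (\<lambda>x. 1 / \<beta> * (T g - D w) x)"
      using Uw by (auto simp: U_def fun_eq_iff algebra_simps diff_divide_distrib)
    ultimately have weq: "w = (\<lambda>x. 1 / \<beta> * S (g - A f) x)" by simp
    \<comment> \<open>Conversely, \<open>M S = 1 - P\<close>, and \<open>P (g - A f) = 0\<close>
      because \<open>P A B = P\<close> and \<open>P A E = 0\<close>; so \<open>M f\<close> is
      exactly \<open>(g - A f) / \<beta>\<close>.\<close>
    have "M f = M w" using bounded_op_add[OF bM] MB[OF g] ME[OF w] g w mem E by (simp add: f_def)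
    also have "M w = (\<lambda>x. 1 / \<beta> * M (S (g - A f)) x)"
      using bounded_op_scale[OF bM] weq f g mem by metis
    also have "M (S (g - A f)) = g - A f - P (g - A f)" using MS f g mem by simp
    also have "P (g - A f) = P g - P (A f)" using bounded_op_diff[OF bP] f g mem by simp
    also have "P (A f) = P g"
      using bounded_op_add[OF bA] bounded_op_add[OF bP] PAB[OF g] PAE[OF w] g w mem E
      by (simp add: f_def)
    finally have "M f = (\<lambda>x. 1 / \<beta> * (g x - A f x))" by (simp add: fun_eq_iff)
    then have "(\<lambda>x. A f x + \<beta> * M f x) = g" using \<beta>0 by (auto simp: fun_eq_iff)
    moreover have "l2_norm G (f - B g) \<le> (2 * c * e) / cmod \<beta> * l2_norm G g"
    proof -
      \<comment> \<open>Half of the norm of \<open>w\<close> is absorbed into the left side, which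
        bounds \<open>w\<close> by \<open>2 * c / cmod \<beta>\<close>; the factor \<open>e\<close>
        comes from \<open>f - B g = E w\<close>.\<close>
      have wT: "w = (\<lambda>x. 1 / \<beta> * T g x) - (\<lambda>x. 1 / \<beta> * D w x)"
        unfolding Uw[symmetric] U_def by auto
      have "l2_norm G w \<le> l2_norm G (\<lambda>x. 1 / \<beta> * T g x) + l2_norm G (\<lambda>x. 1 / \<beta> * D w x)"
        using wT l2_norm_diff[OF l2_scale_mem[OF Tm[OF g]] l2_scale_mem[OF D[OF w]], of "1 / \<beta>" "1 / \<beta>"] by simp
      then have "l2_norm G w \<le> 2 * l2_norm G (\<lambda>x. 1 / \<beta> * T g x)" using half[OF w \<beta>] by simp
      also have "\<dots> = 2 * (l2_norm G (T g) / cmod \<beta>)"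
        by (subst l2_norm_scale) (simp add: norm_divide)
      also have "\<dots> \<le> 2 * (c * l2_norm G g / cmod \<beta>)"
        by (intro mult_left_mono divide_right_mono c(2) g) auto
      finally have "l2_norm G w \<le> 2 * (c * l2_norm G g / cmod \<beta>)" .
      then have "l2_norm G (E w) \<le> e * (2 * (c * l2_norm G g / cmod \<beta>))"
        using e(2)[OF w] mult_left_mono[of "l2_norm G w" _ e] e(1) by (meson less_imp_le order_trans)
      moreover have "f - B g = E w" by (simp add: f_def)
      ultimately show ?thesis by (simp add: mult_ac)
    qed
    ultimately show ?thesis using f by blast
  qed
  show ?thesis
    using uniq ex c(1) e(1) d(1) by (intro exI[of _ "2 * c * e"] exI[of _ "2 * d"] conjI) auto
qed

end

section \<open>Reaches and harmonic functions\<close>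

text \<open>Absorbing the degree into the sum leaves only differences of values. \<open>Y\<close>
  may be any finite set containing the in-neighbours of \<open>x\<close>, a freedom that the reduced
  graph uses.\<close>

lemma laplacian_eq:
  assumes x: "x \<in> verts G" and Y: "finite Y" "Y \<subseteq> verts G"
    and 0: "\<And>y. y \<in> verts G - Y \<Longrightarrow> wt G x y = 0"
  shows "laplacian G f x = (\<Sum>y\<in>Y. of_real (wt G x y) * (f x - f y)) / of_real (mass G x)"
proof -
  have "in_deg G x = infsum (\<lambda>y. wt G x y) Y"
    unfolding in_deg_def using Y 0 by (intro infsum_cong_neutral) auto
  then have 1: "in_deg G x = (\<Sum>y\<in>Y. wt G x y)" using Y by simp
  have "(\<Sum>\<^sub>\<infinity>y\<in>verts G. of_real (wt G x y) * f y) = infsum (\<lambda>y. of_real (wt G x y) * f y) Y"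
    using Y 0 by (intro infsum_cong_neutral) auto
  then have 2: "(\<Sum>\<^sub>\<infinity>y\<in>verts G. of_real (wt G x y) * f y) = (\<Sum>y\<in>Y. of_real (wt G x y) * f y)"
    using Y by simp
  show ?thesis
    unfolding laplacian_def 1 2 using x
    by (simp add: sum_distrib_right sum_subtractf right_diff_distrib diff_divide_distrib)
qed

text \<open>\<open>F\<close> is the total edge set of the clusters; reaches, kernel vectors and
  operators are all formed from it.\<close>

locale clustered = wdigraph G for G :: "'v wgraph" +
  fixes F :: "('v \<times> 'v) set"
  assumes finite_F: "finite F" and F_edges: "F \<subseteq> edges G"
begin

sublocale positive_mass G
  by unfold_locales (rule mass_pos)

abbreviation "Rs \<equiv> reaches (verts G) F"
abbreviation "N \<equiv> Field F"

text \<open>The numerator of the cluster Laplacian: whether a function is harmonic at a vertex does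
  not depend on the mass there.\<close>

definition lapsum :: "('v \<Rightarrow> complex) \<Rightarrow> 'v \<Rightarrow> complex" where
  "lapsum f x = (\<Sum>y\<in>F `` {x}. of_real (wt G x y) * (f x - f y))"

definition cabal :: "'v set \<Rightarrow> 'v set" where
  "cabal R = {r \<in> verts G. reachable_set F r = R}"

lemma finite_N: "finite N"
  using finite_F by (rule finite_Field)

lemma N_verts: "N \<subseteq> verts G"
  using F_edges edges_subset by (auto simp: Field_def)

lemma F_verts: "(x, y) \<in> F \<Longrightarrow> x \<in> verts G \<and> y \<in> verts G"
  using F_edges edges_subset by auto

lemma F_N: "(x, y) \<in> F \<Longrightarrow> x \<in> N \<and> y \<in> N"
  by (auto simp: Field_def)

lemma wt_F_pos: "(x, y) \<in> F \<Longrightarrow> wt G x y > 0"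
  using F_edges F_verts wt_pos_iff by blast

lemma finite_pred: "finite (F `` {x})"
  using finite_F by (rule finite_Image)

lemma laplacian_F: "laplacian (restrict_edges G F) f x = lapsum f x / of_real (mass G x)"
proof (cases "x \<in> verts G")
  case True
  have "F `` {x} \<subseteq> verts G" using F_verts by blast
  then have "laplacian (restrict_edges G F) f x =
      (\<Sum>y\<in>F `` {x}. of_real (wt (restrict_edges G F) x y) * (f x - f y)) /
        of_real (mass (restrict_edges G F) x)"
    using True finite_pred by (intro laplacian_eq) (auto simp: restrict_edges_def)
  also have "\<dots> = lapsum f x / of_real (mass G x)"
    unfolding lapsum_def restrict_edges_def by (intro arg_cong2[where f="(/)"] sum.cong) auto
  finally show ?thesis .
next
  case False
  then have "F `` {x} = {}" using F_verts by blast
  then show ?thesis using False by (simp add: laplacian_def lapsum_def restrict_edges_def)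
qed

lemma laplacian_F_eq_0: "laplacian (restrict_edges G F) f = (\<lambda>x. 0) \<longleftrightarrow> (\<forall>x. lapsum f x = 0)"
proof -
  have "lapsum f x = 0" if "x \<notin> verts G" for x
  proof -
    have "F `` {x} = {}" using F_verts that by blast
    then show ?thesis by (simp add: lapsum_def)
  qed
  moreover have "mass G x \<noteq> 0" if "x \<in> verts G" for x using mass_pos[OF that] by simp
  ultimately show ?thesis unfolding fun_eq_iff laplacian_F by auto
qed

lemma lapsum_add: "lapsum (f + g) x = lapsum f x + lapsum g x"
  by (simp add: lapsum_def sum.distrib[symmetric] algebra_simps)

lemma lapsum_scale: "lapsum (\<lambda>x. c * f x) x = c * lapsum f x"
  by (simp add: lapsum_def sum_distrib_left algebra_simps)

lemma lapsum_diff: "lapsum (f - g) x = lapsum f x - lapsum g x"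
  by (simp add: lapsum_def sum_subtractf[symmetric] algebra_simps)

lemma lapsum_diff': "lapsum (\<lambda>x. f x - g x) x = lapsum f x - lapsum g x"
  using lapsum_diff[of f g x] by (simp only: fun_diff_def)

lemma lapsum_const: "(\<And>y. (x, y) \<in> F \<Longrightarrow> f y = f x) \<Longrightarrow> lapsum f x = 0"
  by (auto simp: lapsum_def intro!: sum.neutral)

lemma lapsum_outside: "x \<notin> N \<Longrightarrow> lapsum f x = 0"
  by (rule lapsum_const) (auto dest: F_N)

lemma rtrancl_verts: "(x, y) \<in> F\<^sup>* \<Longrightarrow> y \<in> verts G \<Longrightarrow> x \<in> verts G"
  by (induction rule: converse_rtrancl_induct) (auto dest: F_verts)

lemma rtrancl_N: "(x, y) \<in> F\<^sup>* \<Longrightarrow> x = y \<or> (x \<in> N \<and> y \<in> N)"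
  by (induction rule: rtrancl_induct) (auto dest: F_N)

section \<open>Structure of reaches and cabals\<close>

lemma reachE:
  assumes "R \<in> Rs" obtains r where "r \<in> cabal R"
  using assms unfolding reaches_def cabal_def by blast

text \<open>Everything reachable from \<open>r\<close> is reachable from a root of \<open>S\<close>,
  so \<open>S\<close> contains \<open>R\<close>, and maximality makes them equal. Distinct reaches
  thus have disjoint cabals, which can serve as boundary components.\<close>

lemma cabal_reaches:
  assumes "r \<in> cabal R" "R \<in> Rs" "r \<in> S" "S \<in> Rs" shows "S = R"
proof -
  obtain s where s: "s \<in> verts G" "S = reachable_set F s"
    using assms(4) unfolding reaches_def by blast
  have "(r, s) \<in> F\<^sup>*" using assms(3) s by (simp add: reachable_set_def)
  then have "R \<subseteq> S" using assms(1) s unfolding cabal_def reachable_set_def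
    by (auto intro: rtrancl_trans)
  then show ?thesis using assms(2,4) unfolding reaches_def by blast
qed

lemma cabal_subset: "cabal R \<subseteq> R"
  by (auto simp: cabal_def reachable_set_def)

text \<open>A predecessor reaches all that \<open>x\<close> reaches, and by maximality no more. So
  at a cabal vertex the cluster Laplacian only sees values on the same cabal.\<close>

lemma cabal_pred:
  assumes "(x, y) \<in> F" "x \<in> cabal R" "R \<in> Rs" shows "y \<in> cabal R"
proof -
  have y: "y \<in> verts G" using assms F_verts by blast
  have "reachable_set F x \<subseteq> reachable_set F y"
    using assms(1) by (auto simp: reachable_set_def intro: rtrancl_into_rtrancl)
  then have "R \<subseteq> reachable_set F y" using assms(2) by (simp add: cabal_def)
  then have "reachable_set F y = R" using assms(3) y unfolding reaches_def by blast
  then show ?thesis using y by (simp add: cabal_def)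
qed

lemma reach_root: "r \<in> cabal R \<Longrightarrow> x \<in> R \<Longrightarrow> (x, r) \<in> F\<^sup>*"
  by (auto simp: cabal_def reachable_set_def)

lemma reach_succ: "R \<in> Rs \<Longrightarrow> y \<in> R \<Longrightarrow> (x, y) \<in> F \<Longrightarrow> x \<in> R"
  by (auto simp: reaches_def reachable_set_def intro: converse_rtrancl_into_rtrancl)

lemma reach_subset: "R \<in> Rs \<Longrightarrow> R \<subseteq> verts G"
  using rtrancl_verts by (auto simp: reaches_def reachable_set_def)

lemma finite_reach: "R \<in> Rs \<Longrightarrow> finite R"
proof -
  assume "R \<in> Rs"
  then obtain r where "R = reachable_set F r" by (auto simp: reaches_def)
  then have "R \<subseteq> insert r N" using rtrancl_N by (auto simp: reachable_set_def)
  then show ?thesis using finite_N finite_subset by blast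
qed

text \<open>Only \<open>x\<close> itself and vertices of the finite set \<open>N\<close> can have
  paths to \<open>x\<close>, so among the reachable sets containing \<open>x\<close> there is a
  maximal one even when the graph is infinite.\<close>

lemma reach_ex:
  assumes x: "x \<in> verts G" shows "\<exists>R\<in>Rs. x \<in> R"
proof -
  define A where "A = {S \<in> reachable_set F ` verts G. x \<in> S}"
  have "A \<subseteq> reachable_set F ` insert x N"
    using rtrancl_N by (auto simp: A_def reachable_set_def)
  then have "finite A" using finite_N by (meson finite_imageI finite_insert finite_subset)
  moreover have "reachable_set F x \<in> A" using x by (auto simp: A_def reachable_set_def)
  ultimately obtain R where R: "R \<in> A" "\<And>S. S \<in> A \<Longrightarrow> R \<subseteq> S \<Longrightarrow> R = S"
    by (metis finite_has_maximal empty_iff)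
  then have "R \<in> Rs" unfolding reaches_def A_def by blast
  then show ?thesis using R(1) by (auto simp: A_def)
qed

lemma root_ex:
  assumes "x \<in> verts G" obtains R r where "R \<in> Rs" "r \<in> cabal R" "x \<in> R" "(x, r) \<in> F\<^sup>*"
  using reach_ex[OF assms] reachE reach_root by metis

lemma isolated_reach:
  assumes "x \<in> verts G" "x \<notin> N"
  shows "R \<in> Rs \<and> x \<in> R \<longleftrightarrow> R = {x}" and "cabal {x} = {x}"
proof -
  have eq: "R = {x}" if R: "R \<in> Rs" "x \<in> R" for R
  proof -
    obtain r where r: "r \<in> verts G" "R = reachable_set F r" using R(1) by (auto simp: reaches_def)
    then have "x = r" using R(2) rtrancl_N assms by (auto simp: reachable_set_def)
    then show ?thesis using r rtrancl_N assms by (auto simp: reachable_set_def)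
  qed
  have "{x} \<in> Rs" using reach_ex[OF assms(1)] eq by blast
  then show "R \<in> Rs \<and> x \<in> R \<longleftrightarrow> R = {x}" using eq by blast
  have "cabal {x} \<noteq> {}" using reachE[OF \<open>{x} \<in> Rs\<close>] by blast
  then show "cabal {x} = {x}" using cabal_subset[of "{x}"] by blast
qed

text \<open>The dichotomy behind the finiteness arguments: reaches inside \<open>N\<close> are
  finite in number, all others are single vertices touched by no cluster edge.\<close>

lemma reach_cases:
  assumes "R \<in> Rs"
  shows "R \<subseteq> N \<or> (\<exists>x\<in>verts G - N. R = {x})"
proof (cases "R \<subseteq> N")
  case False
  then obtain x where x: "x \<in> R" "x \<notin> N" by blast
  then have "x \<in> verts G" using reach_subset assms by blast
  then show ?thesis using isolated_reach(1)[of x R] x assms by auto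
qed simp

lemma finite_reaches_at: "finite {R \<in> Rs. x \<in> R}"
proof (cases "x \<in> N")
  case True
  have "R \<subseteq> N" if "R \<in> Rs" "x \<in> R" for R
    using reach_cases[OF that(1)] that(2) True by auto
  then have "{R \<in> Rs. x \<in> R} \<subseteq> Pow N" by auto
  then show ?thesis using finite_N finite_subset by blast
next
  case False
  then show ?thesis
  proof (cases "x \<in> verts G")
    case True
    then have "{R \<in> Rs. x \<in> R} \<subseteq> {{x}}" using isolated_reach(1) False by auto
    then show ?thesis using finite_subset by blast
  next
    case False
    then have "{R \<in> Rs. x \<in> R} = {}" using reach_subset by blast
    then show ?thesis by (metis finite.emptyI)
  qed
qed

text \<open>At a positive maximum all summands are nonnegative, so the inequality forces equality
  with every predecessor. The maximal value then propagates upstream inside \<open>A\<close>, which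
  is closed under predecessors, until it meets an ancestor with \<open>u \<le> 0\<close>.\<close>

lemma maximum_principle:
  fixes u :: "'v \<Rightarrow> real"
  assumes A: "finite A" "\<And>x y. x \<in> A \<Longrightarrow> (x, y) \<in> F \<Longrightarrow> y \<in> A"
    and sub: "\<And>x. x \<in> A \<Longrightarrow> u x > 0 \<Longrightarrow> (\<Sum>y\<in>F `` {x}. wt G x y * (u x - u y)) \<le> 0"
    and anc: "\<And>x. x \<in> A \<Longrightarrow> \<exists>y. (x, y) \<in> F\<^sup>* \<and> u y \<le> 0"
    and x: "x \<in> A"
  shows "u x \<le> 0"
proof (rule ccontr)
  assume neg: "\<not> u x \<le> 0"
  obtain w where w: "w \<in> A" "\<And>y. y \<in> A \<Longrightarrow> u y \<le> u w"
  proof -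
    have "Max (u ` A) \<in> u ` A" using A(1) x by (intro Max_in) auto
    then obtain w where "w \<in> A" "u w = Max (u ` A)" by auto
    then show ?thesis using that[of w] A(1) by simp
  qed
  have pos: "u w > 0" using neg w(2)[OF x] by simp
  have "y \<in> A \<and> u y = u w" if "(w, y) \<in> F\<^sup>*" for y
    using that
  proof (induction rule: rtrancl_induct)
    case base
    show ?case using w by simp
  next
    case (step y v)
    then have y: "y \<in> A" "u y = u w" by auto
    have nn: "wt G y v' * (u y - u v') \<ge> 0" if "v' \<in> F `` {y}" for v'
      using that wt_F_pos[of y v'] w(2)[OF A(2)[OF y(1)], of v'] y(2) by simp
    have "0 < u y" using y(2) pos by simp
    then have "(\<Sum>v\<in>F `` {y}. wt G y v * (u y - u v)) \<le> 0" by (rule sub[OF y(1)])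
    then have "(\<Sum>v\<in>F `` {y}. wt G y v * (u y - u v)) = 0"
      using sum_nonneg[OF nn] by (rule order.antisym)
    then have "wt G y v * (u y - u v) = 0"
      using sum_nonneg_eq_0_iff[OF finite_pred, of y "\<lambda>v. wt G y v * (u y - u v)"] nn step(2) by blast
    then have "u y = u v" using wt_F_pos[OF step(2)] by auto
    then show ?case using y(2) A(2)[OF y(1) step(2)] by metis
  qed
  then show False using anc[OF w(1)] pos by (metis not_le)
qed

text \<open>The modulus of a harmonic function is subharmonic by the triangle inequality.
  Harmonicity is asked only where \<open>f\<close> is nonzero, so \<open>A\<close> may contain
  boundary points at which \<open>f\<close> is prescribed to be 0.\<close>

lemma harmonic_zero:
  assumes A: "finite A" "\<And>x y. x \<in> A \<Longrightarrow> (x, y) \<in> F \<Longrightarrow> y \<in> A"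
    and harm: "\<And>x. x \<in> A \<Longrightarrow> f x \<noteq> 0 \<Longrightarrow> lapsum f x = 0"
    and anc: "\<And>x. x \<in> A \<Longrightarrow> \<exists>y. (x, y) \<in> F\<^sup>* \<and> f y = 0"
    and x: "x \<in> A"
  shows "f x = 0"
proof -
  have "cmod (f x) \<le> 0"
  proof (rule maximum_principle[OF A _ _ x])
    fix x assume x: "x \<in> A" "cmod (f x) > 0"
    have "(\<Sum>y\<in>F `` {x}. of_real (wt G x y) * f x) = (\<Sum>y\<in>F `` {x}. of_real (wt G x y) * f y)"
      using harm[OF x(1)] x(2) by (simp add: lapsum_def right_diff_distrib sum_subtractf)
    then have "cmod ((\<Sum>y\<in>F `` {x}. of_real (wt G x y)) * f x) = cmod (\<Sum>y\<in>F `` {x}. of_real (wt G x y) * f y)"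
      by (simp add: sum_distrib_right)
    also have "\<dots> \<le> (\<Sum>y\<in>F `` {x}. wt G x y * cmod (f y))"
      using wt_F_pos by (intro order.trans[OF norm_sum] sum_mono) (auto simp: norm_mult abs_of_pos)
    finally have "cmod (\<Sum>y\<in>F `` {x}. of_real (wt G x y)) * cmod (f x) \<le> (\<Sum>y\<in>F `` {x}. wt G x y * cmod (f y))"
      by (simp add: norm_mult)
    moreover have "cmod (\<Sum>y\<in>F `` {x}. of_real (wt G x y)) = (\<Sum>y\<in>F `` {x}. wt G x y)"
    proof -
      have "(\<Sum>y\<in>F `` {x}. wt G x y) \<ge> 0" using wt_F_pos by (intro sum_nonneg) (auto simp: less_imp_le)
      then show ?thesis by (simp flip: of_real_sum)
    qed
    ultimately show "(\<Sum>y\<in>F `` {x}. wt G x y * (cmod (f x) - cmod (f y))) \<le> 0"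
      by (simp add: right_diff_distrib sum_subtractf sum_distrib_right)
  qed (use anc in auto)
  then show ?thesis by simp
qed

subsection \<open>Right kernel vectors\<close>

lemma exclusive_cabal: "R \<in> Rs \<Longrightarrow> cabal R \<subseteq> exclusive_part (verts G) F R"
proof -
  assume R: "R \<in> Rs"
  have "x \<in> R - \<Union>(Rs - {R})" if "x \<in> cabal R" for x
    using cabal_reaches[OF that R] cabal_subset[of R] that by auto
  then show ?thesis by (auto simp only: exclusive_part_def)
qed

text \<open>Every vertex has an ancestor in some cabal, and the difference vanishes on all cabals:
  that of \<open>R\<close> lies in the exclusive part, and the others are disjoint from
  \<open>R\<close>.\<close>

lemma kernel_vec_unique:
  assumes R: "R \<in> Rs"
    and f: "\<forall>x. lapsum f x = 0" "\<forall>x \<in> exclusive_part (verts G) F R. f x = 1" "\<forall>x. x \<notin> R \<longrightarrow> f x = 0"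
    and h: "\<forall>x. lapsum h x = 0" "\<forall>x \<in> exclusive_part (verts G) F R. h x = 1" "\<forall>x. x \<notin> R \<longrightarrow> h x = 0"
  shows "f = h"
proof
  fix x
  show "f x = h x"
  proof (cases "x \<in> R")
    case True
    have "(f - h) x = 0"
    proof (rule harmonic_zero[of "R \<union> N"])
      show "finite (R \<union> N)" using finite_reach[OF R] finite_N by simp
      show "\<exists>y. (x, y) \<in> F\<^sup>* \<and> (f - h) y = 0" if x: "x \<in> R \<union> N" for x
      proof -
        have "x \<in> verts G" using x reach_subset[OF R] N_verts by blast
        then obtain S r where r: "S \<in> Rs" "r \<in> cabal S" "(x, r) \<in> F\<^sup>*" using root_ex by metis
        have "(f - h) r = 0"
        proof (cases "r \<in> R")
          case True
          then have "S = R" using cabal_reaches r R by metis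
          then show ?thesis using exclusive_cabal[OF R] r f(2) h(2) by auto
        qed (use f(3) h(3) in simp)
        then show ?thesis using r(3) by blast
      qed
    qed (use f(1) h(1) True F_N in \<open>auto simp: lapsum_diff lapsum_diff'\<close>)
    then show ?thesis by simp
  qed (use f(3) h(3) in simp)
qed

text \<open>A Dirichlet problem: the union \<open>Z\<close> of all cabals is the boundary, the
  indicator of \<open>cabal R\<close> the boundary value. The square system is injective by the
  maximum principle, hence solvable; the value 1 on the exclusive part and the vanishing off
  \<open>R\<close> are derived afterwards.\<close>

lemma kernel_vec_exists:
  assumes R: "R \<in> Rs"
  shows "\<exists>f. (\<forall>x. lapsum f x = 0) \<and> (\<forall>x \<in> exclusive_part (verts G) F R. f x = 1) \<and> (\<forall>x. x \<notin> R \<longrightarrow> f x = 0)"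
proof -
  define A where "A = N \<union> R"
  define Z where "Z = {x \<in> verts G. reachable_set F x \<in> Rs}"
  have A: "finite A" "A \<subseteq> verts G"
    using finite_N finite_reach[OF R] N_verts reach_subset[OF R] by (auto simp: A_def)
  have A_pred: "y \<in> A" if "x \<in> A" "(x, y) \<in> F" for x y using F_N that by (auto simp: A_def)
  have Z: "x \<in> cabal (reachable_set F x)" if "x \<in> Z" for x using that by (simp add: Z_def cabal_def)
  have anc: "\<exists>r\<in>Z. (x, r) \<in> F\<^sup>*" if "x \<in> verts G" for x
    using root_ex[OF that] by (fastforce simp: Z_def cabal_def)
  \<comment> \<open>Rows at boundary vertices prescribe values, the other rows in \<open>A\<close>
    prescribe the Laplacian. Outside \<open>A\<close> the map is the identity, which preserves the
    support.\<close>
  define T where "T = (\<lambda>f x. if x \<in> A - Z then lapsum f x else f x)"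
  have "\<exists>f\<in>supported A. T f = indicator (cabal R)"
  proof (rule inj_imp_surj_supported[OF A(1)])
    show "T f \<in> supported A" if "f \<in> supported A" for f
      using that by (simp add: T_def supported_def)
    show "T (f + g) = T f + T g" for f g by (simp add: T_def fun_eq_iff lapsum_add)
    show "T (\<lambda>x. c * f x) = (\<lambda>x. c * T f x)" for c f by (simp add: T_def fun_eq_iff lapsum_scale)
    show "indicator (cabal R) \<in> supported A"
      using cabal_subset[of R] by (auto simp: supported_def A_def indicator_def)
    fix f assume f: "f \<in> supported A" "T f = 0"
    have Tf: "(if x \<in> A - Z then lapsum f x else f x) = 0" for x
      using fun_cong[OF f(2), of x] by (simp add: T_def)
    have fZ: "f x = 0" if "x \<in> Z" for x using Tf[of x] that by simp
    have "f x = 0" if "x \<in> A" for x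
    proof (rule harmonic_zero[OF A(1) A_pred _ _ that])
      show "lapsum f x = 0" if "x \<in> A" "f x \<noteq> 0" for x
        using Tf[of x] that fZ by (auto split: if_splits)
      show "\<exists>y. (x, y) \<in> F\<^sup>* \<and> f y = 0" if "x \<in> A" for x
        using anc that A(2) fZ by (meson subsetD)
    qed
    then show "f = 0" using f(1) by (auto simp: supported_def fun_eq_iff)
  qed
  then obtain f where f: "f \<in> supported A" "T f = indicator (cabal R)" by blast
  have Tf: "(if x \<in> A - Z then lapsum f x else f x) = indicator (cabal R) x" for x
    using fun_cong[OF f(2), of x] by (simp add: T_def)
  have fZ: "f x = indicator (cabal R) x" if "x \<in> Z" for x using Tf[of x] that by simp
  have cab: "x \<in> Z" if "x \<in> cabal S" "S \<in> Rs" for x S using that by (simp add: Z_def cabal_def)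
  \<comment> \<open>The system imposes no Laplace equation on \<open>Z\<close>; there
    \<open>f\<close> is harmonic because its boundary values are constant on each cabal and cabals
    are closed under predecessors.\<close>
  have harm: "lapsum f x = 0" for x
  proof (cases "x \<in> Z")
    case True
    show ?thesis
    proof (rule lapsum_const)
      fix y assume y: "(x, y) \<in> F"
      let ?S = "reachable_set F x"
      have S: "?S \<in> Rs" "x \<in> cabal ?S" using True by (auto simp: Z_def cabal_def)
      have y: "y \<in> cabal ?S" using cabal_pred y S by blast
      then have "x \<in> cabal R \<longleftrightarrow> y \<in> cabal R"
        using S by (auto simp: cabal_def)
      then show "f y = f x" using fZ[OF cab[OF y S(1)]] fZ[OF True] by (simp add: indicator_def)
    qed
  next
    case False
    show ?thesis
    proof (cases "x \<in> A")
      case True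
      have "x \<notin> cabal R" using cab False R by blast
      then show ?thesis using Tf[of x] True False by simp
    next
      case False
      then show ?thesis by (intro lapsum_outside) (simp add: A_def)
    qed
  qed
  have root: "f r = (if S = R then 1 else 0)" if "r \<in> cabal S" "S \<in> Rs" for r S
    using fZ[OF cab[OF that]] that R by (auto simp: cabal_def indicator_def)
  \<comment> \<open>The complement of a reach is closed under predecessors, and the roots of reaches
    through a vertex off \<open>R\<close> carry the boundary value 0.\<close>
  have off: "f x = 0" if x: "x \<notin> R" for x
  proof (cases "x \<in> A")
    case True
    show ?thesis
    proof (rule harmonic_zero[of "A - R"])
      show "y \<in> A - R" if "x \<in> A - R" "(x, y) \<in> F" for x y
        using that A_pred reach_succ[OF R] by blast
      show "\<exists>y. (x, y) \<in> F\<^sup>* \<and> f y = 0" if x: "x \<in> A - R" for x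
      proof -
        obtain S r where r: "S \<in> Rs" "r \<in> cabal S" "x \<in> S" "(x, r) \<in> F\<^sup>*"
          using root_ex[of x] x A(2) by blast
        then have "f r = 0" using root[OF r(2,1)] x by auto
        then show ?thesis using r by blast
      qed
    qed (use A harm True x in auto)
  qed (rule supportedD[OF f(1)])
  \<comment> \<open>The exclusive part is closed under predecessors and all its vertices descend
    from the cabal of \<open>R\<close>, where \<open>f - 1\<close> vanishes.\<close>
  have on: "f x = 1" if x: "x \<in> exclusive_part (verts G) F R" for x
  proof -
    have cs: "lapsum (\<lambda>_. 1) x = 0" for x by (rule lapsum_const) simp
    have "(f - (\<lambda>_. 1)) x = 0"
    proof (rule harmonic_zero[of "exclusive_part (verts G) F R"])
      show "finite (exclusive_part (verts G) F R)" using finite_reach[OF R] by (simp add: exclusive_part_def)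
      show "y \<in> exclusive_part (verts G) F R" if xy: "x \<in> exclusive_part (verts G) F R" "(x, y) \<in> F" for x y
      proof -
        have "S = R" if "S \<in> Rs" "y \<in> S" for S
          using reach_succ[OF that xy(2)] xy(1) that(1) by (auto simp: exclusive_part_def)
        moreover have "\<exists>S\<in>Rs. y \<in> S" using reach_ex F_verts xy(2) by blast
        ultimately show ?thesis by (auto simp: exclusive_part_def)
      qed
      show "\<exists>y. (x, y) \<in> F\<^sup>* \<and> (f - (\<lambda>_. 1)) y = 0" if x: "x \<in> exclusive_part (verts G) F R" for x
      proof -
        obtain r where r: "r \<in> cabal R" using reachE[OF R] .
        then have "(x, r) \<in> F\<^sup>*" using reach_root x by (auto simp: exclusive_part_def)
        then show ?thesis using root[OF r R] by auto
      qed
    qed (use x harm cs in \<open>auto simp: lapsum_diff lapsum_diff'\<close>)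
    then show ?thesis by simp
  qed
  show ?thesis using harm on off by blast
qed

abbreviation "\<gamma> \<equiv> right_kernel_vec G F"

lemma right_kernel_vec:
  assumes R: "R \<in> Rs"
  shows "\<forall>x. lapsum (\<gamma> R) x = 0" "\<forall>x \<in> exclusive_part (verts G) F R. \<gamma> R x = 1"
    "\<And>x. x \<notin> R \<Longrightarrow> \<gamma> R x = 0"
proof -
  let ?P = "\<lambda>f. f \<in> l2 G \<and> laplacian (restrict_edges G F) f = (\<lambda>x. 0) \<and>
     (\<forall>x \<in> exclusive_part (verts G) F R. f x = 1) \<and> (\<forall>x. x \<notin> R \<longrightarrow> f x = 0)"
  obtain f where f: "(\<forall>x. lapsum f x = 0) \<and> (\<forall>x \<in> exclusive_part (verts G) F R. f x = 1) \<and> (\<forall>x. x \<notin> R \<longrightarrow> f x = 0)"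
    using kernel_vec_exists[OF R] by blast
  have "f \<in> supported R" using f by (simp add: supported_def)
  then have "f \<in> l2 G" using supported_l2[OF finite_reach reach_subset] R by blast
  then have "?P f" using f by (simp add: laplacian_F_eq_0)
  moreover have "h = f" if "?P h" for h
    using kernel_vec_unique[OF R, of h f] that f by (simp add: laplacian_F_eq_0)
  ultimately have "?P (\<gamma> R)" unfolding right_kernel_vec_def by (rule theI)
  then show "\<forall>x. lapsum (\<gamma> R) x = 0" "\<forall>x \<in> exclusive_part (verts G) F R. \<gamma> R x = 1"
    "\<And>x. x \<notin> R \<Longrightarrow> \<gamma> R x = 0"
    by (auto simp: laplacian_F_eq_0)
qed

lemma right_kernel_vec_cabal:
  assumes "R \<in> Rs" "S \<in> Rs" "x \<in> cabal S" shows "\<gamma> R x = (if R = S then 1 else 0)"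
proof (cases "R = S")
  case True
  then show ?thesis using right_kernel_vec(2)[OF assms(1)] exclusive_cabal[OF assms(1)] assms(3) by auto
next
  case False
  then have "x \<notin> R" using cabal_reaches assms by blast
  then show ?thesis using right_kernel_vec(3) assms(1) False by simp
qed

lemma right_kernel_vec_supported: "R \<in> Rs \<Longrightarrow> \<gamma> R \<in> supported R"
  using right_kernel_vec(3) by (simp add: supported_def)

lemma right_kernel_vec_l2: "R \<in> Rs \<Longrightarrow> \<gamma> R \<in> l2 G"
  using supported_l2[OF finite_reach reach_subset] right_kernel_vec_supported by blast

text \<open>The weights are real, so the imaginary part is harmonic as well, and it vanishes on
  every cabal.\<close>

lemma right_kernel_vec_real: 
  assumes R: "R \<in> Rs" shows "\<gamma> R x = of_real (Re (\<gamma> R x))"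
proof (cases "x \<in> R")
  case True
  let ?f = "\<lambda>x. of_real (Im (\<gamma> R x)) :: complex"
  have "?f x = 0"
  proof (rule harmonic_zero[of "R \<union> N"])
    show "finite (R \<union> N)" using finite_reach[OF R] finite_N by simp
    show "\<exists>y. (x, y) \<in> F\<^sup>* \<and> ?f y = 0" if x: "x \<in> R \<union> N" for x
    proof -
      have "x \<in> verts G" using x reach_subset[OF R] N_verts by blast
      then obtain S r where r: "S \<in> Rs" "r \<in> cabal S" "(x, r) \<in> F\<^sup>*" using root_ex by metis
      then show ?thesis using right_kernel_vec_cabal[OF R r(1,2)] by (intro exI[of _ r]) auto
    qed
    have "lapsum ?f x = of_real (Im (lapsum (\<gamma> R) x))" for x
      by (simp add: lapsum_def)
    then show "lapsum ?f x = 0" for x using right_kernel_vec(1)[OF R] by simp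
  qed (use True F_N in auto)
  then show ?thesis by (simp add: complex_eq_iff)
qed (use right_kernel_vec(3)[OF R] in simp)

text \<open>The maximum principle for \<open>- Re (\<gamma> R x)\<close>, which is 0 or -1 on every
  cabal. Nonnegativity is what makes the reduced masses positive.\<close>

lemma right_kernel_vec_nonneg:
  assumes R: "R \<in> Rs" shows "Re (\<gamma> R x) \<ge> 0"
proof (cases "x \<in> R")
  case True
  have "- Re (\<gamma> R x) \<le> 0"
  proof (rule maximum_principle[of "R \<union> N"])
    show "finite (R \<union> N)" using finite_reach[OF R] finite_N by simp
    show "\<exists>y. (x, y) \<in> F\<^sup>* \<and> - Re (\<gamma> R y) \<le> 0" if x: "x \<in> R \<union> N" for x
    proof -
      have "x \<in> verts G" using x reach_subset[OF R] N_verts by blast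
      then obtain S r where r: "S \<in> Rs" "r \<in> cabal S" "(x, r) \<in> F\<^sup>*" using root_ex by metis
      then show ?thesis using right_kernel_vec_cabal[OF R r(1,2)] by (intro exI[of _ r]) auto
    qed
    have "(\<Sum>y\<in>F `` {x}. wt G x y * (- Re (\<gamma> R x) - - Re (\<gamma> R y))) = - Re (lapsum (\<gamma> R) x)" for x
      by (simp add: lapsum_def sum_negf[symmetric] algebra_simps)
    then show "(\<Sum>y\<in>F `` {x}. wt G x y * (- Re (\<gamma> R x) - - Re (\<gamma> R y))) \<le> 0" for x
      using right_kernel_vec(1)[OF R] by simp
  qed (use True F_N in auto)
  then show ?thesis by simp
qed (use right_kernel_vec(3)[OF R] in simp)

lemma right_kernel_vec_isolated:
  assumes "x \<in> verts G" "x \<notin> N" shows "\<gamma> {x} = indicator {x}"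
proof
  fix y
  have "{x} \<in> Rs" "cabal {x} = {x}" using isolated_reach[OF assms] by blast+
  then show "\<gamma> {x} y = indicator {x} y"
    using right_kernel_vec(3)[of "{x}" y] right_kernel_vec_cabal[of "{x}" "{x}" x]
    by (cases "y = x") auto
qed

section \<open>The upward map and harmonic functions\<close>

lemma lapsum_sum: "lapsum (\<lambda>x. \<Sum>i\<in>I. c i * f i x) x = (\<Sum>i\<in>I. c i * lapsum (f i) x)"
  unfolding lapsum_def sum_distrib_left sum_subtractf[symmetric]
  by (subst sum.swap) (simp add: algebra_simps)

lemma lapsum_cong: "(\<And>y. y \<in> N \<Longrightarrow> f y = g y) \<Longrightarrow> lapsum f x = lapsum g x"
  unfolding lapsum_def by (intro sum.cong) (auto dest: F_N)

lemma sum_reaches_at: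
  assumes "finite Y" "\<And>R. R \<in> Rs \<Longrightarrow> x \<in> R \<Longrightarrow> R \<in> Y" "Y \<subseteq> Rs"
  shows "(\<Sum>R\<in>Y. g R * \<gamma> R x) = (\<Sum>R | R \<in> Rs \<and> x \<in> R. g R * \<gamma> R x)"
  using assms right_kernel_vec(3) by (intro sum.mono_neutral_right) auto

lemma J_up_eq: "J_up G F g x = (\<Sum>R | R \<in> Rs \<and> x \<in> R. g R * \<gamma> R x)"
proof -
  have "J_up G F g x = infsum (\<lambda>R. g R * \<gamma> R x) {R \<in> Rs. x \<in> R}"
    unfolding J_up_def using right_kernel_vec(3) by (intro infsum_cong_neutral) auto
  then show ?thesis using finite_reaches_at by simp
qed

lemma finite_reaches_N: "finite {R \<in> Rs. R \<subseteq> N}"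
  by (rule finite_subset[of _ "Pow N"]) (auto simp: finite_N)

text \<open>On \<open>N\<close> the sum runs over a finite set of reaches that does not depend on
  \<open>x\<close>, so it can be exchanged with the Laplacian.\<close>

lemma J_up_N: "x \<in> N \<Longrightarrow> J_up G F g x = (\<Sum>R | R \<in> Rs \<and> R \<subseteq> N. g R * \<gamma> R x)"
  unfolding J_up_eq using reach_cases
  by (intro sum_reaches_at[symmetric] finite_reaches_N) auto

lemma lapsum_J_up: "lapsum (J_up G F g) x = 0"
proof -
  have "lapsum (J_up G F g) x = lapsum (\<lambda>x. \<Sum>R | R \<in> Rs \<and> R \<subseteq> N. g R * \<gamma> R x) x"
    by (rule lapsum_cong) (rule J_up_N)
  then show ?thesis using right_kernel_vec(1) by (simp add: lapsum_sum)
qed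

lemma J_up_cabal:
  assumes "x \<in> cabal S" "S \<in> Rs" shows "J_up G F g x = g S"
proof -
  have "{R \<in> Rs. x \<in> R} = {S}" using cabal_reaches assms cabal_subset by blast
  then show ?thesis unfolding J_up_eq using right_kernel_vec_cabal[OF assms(2,2,1)] by simp
qed

lemma J_up_isolated: "x \<in> verts G \<Longrightarrow> x \<notin> N \<Longrightarrow> J_up G F g x = g {x}"
  using J_up_cabal[of x "{x}"] isolated_reach by blast

text \<open>Uniqueness for the Dirichlet problem with the cabals as boundary. A vertex off
  \<open>N\<close> is its own cabal, so the maximum principle is applied on the finite set
  \<open>N\<close> alone.\<close>

lemma harmonic_determined:
  assumes f: "\<And>x. lapsum f x = 0" and 0: "\<And>R r. R \<in> Rs \<Longrightarrow> r \<in> cabal R \<Longrightarrow> f r = 0"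
    and x: "x \<in> verts G"
  shows "f x = 0"
proof (cases "x \<in> N")
  case True
  show ?thesis
  proof (rule harmonic_zero[OF finite_N _ _ _ True])
    show "\<exists>y. (w, y) \<in> F\<^sup>* \<and> f y = 0" if "w \<in> N" for w
      using root_ex[of w] that N_verts 0 by (metis subsetD)
  qed (use F_N f in auto)
next
  case False
  have "{x} \<in> Rs" "x \<in> cabal {x}" using isolated_reach[OF x False] by blast+
  then show ?thesis by (rule 0)
qed

text \<open>Constants are harmonic and \<open>J_up\<close> reproduces the value 1 on every cabal, so
  the vectors \<open>\<gamma> R\<close> form a partition of unity. This accounts for the degree term
  of the reduced Laplacian.\<close>

lemma J_up_one:
  assumes x: "x \<in> verts G" shows "J_up G F (\<lambda>_. 1) x = 1"
proof -
  have "lapsum (\<lambda>_. 1) x = 0" for x by (rule lapsum_const) simp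
  then have 1: "lapsum (J_up G F (\<lambda>_. 1) - (\<lambda>_. 1)) x = 0" for x
    by (simp only: lapsum_diff lapsum_J_up) simp
  have "(J_up G F (\<lambda>_. 1) - (\<lambda>_. 1)) x = 0"
  proof (rule harmonic_determined[OF 1 _ x])
    show "(J_up G F (\<lambda>_. 1) - (\<lambda>_. 1)) r = 0" if "R \<in> Rs" "r \<in> cabal R" for R r
      using J_up_cabal[OF that(2,1)] by simp
  qed
  then show ?thesis by simp
qed

lemma sum_right_kernel_vec:
  assumes "x \<in> verts G" "finite Y" "\<And>R. R \<in> Rs \<Longrightarrow> x \<in> R \<Longrightarrow> R \<in> Y" "Y \<subseteq> Rs"
  shows "(\<Sum>R\<in>Y. \<gamma> R x) = 1"
  using J_up_one[OF assms(1)] sum_reaches_at[OF assms(2-4), where g="\<lambda>_. 1"] by (simp add: J_up_eq)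

text \<open>The maximum principle on the cabal itself, applied to \<open>f - f y\<close>: the cabal
  is closed under predecessors and all its vertices descend from \<open>y\<close>.\<close>

lemma harmonic_const_cabal:
  assumes f: "\<And>x. lapsum f x = 0" and R: "R \<in> Rs" and x: "x \<in> cabal R" "y \<in> cabal R"
  shows "f x = f y"
proof -
  have cs: "lapsum (\<lambda>_. f y) x = 0" for x by (rule lapsum_const) simp
  have "(f - (\<lambda>_. f y)) x = 0"
  proof (rule harmonic_zero[of "cabal R"])
    show "finite (cabal R)" using finite_reach[OF R] cabal_subset finite_subset by blast
    show "\<exists>z. (w, z) \<in> F\<^sup>* \<and> (f - (\<lambda>_. f y)) z = 0" if "w \<in> cabal R" for w
      using reach_root[OF x(2)] that cabal_subset by (intro exI[of _ y]) auto
  qed (use cabal_pred R x f cs in \<open>auto simp: lapsum_diff lapsum_diff'\<close>)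
  then show ?thesis by simp
qed

end

section \<open>Spanning trees and left kernel vectors\<close>

text \<open>The path is cut at its first visit to \<open>s\<close>.\<close>

lemma rtrancl_first_arrival:
  assumes "(v, s) \<in> \<phi>\<^sup>*"
  shows "(v, s) \<in> (\<phi> - {s} \<times> UNIV)\<^sup>*"
  using assms
proof (induction rule: converse_rtrancl_induct)
  case (step v w)
  then show ?case by (cases "v = s") (auto intro: converse_rtrancl_into_rtrancl)
qed simp

lemma rtrancl_avoid_or_reach:
  assumes "(v, s) \<in> \<phi>\<^sup>*"
  shows "(v, s) \<in> (\<phi> - {t} \<times> UNIV)\<^sup>* \<or> (v, t) \<in> (\<phi> - {t} \<times> UNIV)\<^sup>*"
  using assms
proof (induction rule: converse_rtrancl_induct)
  case (step v w)
  then show ?case by (cases "v = t") (auto intro: converse_rtrancl_into_rtrancl)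
qed simp

text \<open>In a functional relation a path cannot leave a cycle, so a cyclic vertex leading to
  \<open>r\<close> puts \<open>r\<close> on the cycle, although \<open>r\<close> has no successor in
  \<tau>.\<close>

lemma no_cycle_before_sink:
  assumes cyc: "(x, x) \<in> \<tau>\<^sup>+" and "(x, r) \<in> \<tau>\<^sup>*" and det: "\<And>v j k. (v, j) \<in> \<tau> \<Longrightarrow> (v, k) \<in> \<tau> \<Longrightarrow> j = k"
    and sink: "\<And>j. (r, j) \<notin> \<tau>"
  shows False
proof -
  have "(r, r) \<in> \<tau>\<^sup>+"
    using assms(2)
  proof (induction rule: rtrancl_induct)
    case (step y y')
    obtain k where "(y, k) \<in> \<tau>" "(k, y) \<in> \<tau>\<^sup>*" using step.IH by (metis tranclD)
    then have "(y', y) \<in> \<tau>\<^sup>*" using det step(2) by blast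
    then show ?case using step(2) by (rule rtrancl_into_trancl1)
  qed (rule cyc)
  then show False using sink by (metis tranclD)
qed

lemma spanning_trees_det:
  "\<tau> \<in> spanning_trees F R i \<Longrightarrow> (v, j) \<in> \<tau> \<Longrightarrow> (v, k) \<in> \<tau> \<Longrightarrow> j = k"
  unfolding spanning_trees_def by (cases "v = i") blast+

lemma finite_spanning_trees: "finite F \<Longrightarrow> finite (spanning_trees F R i)"
  by (rule finite_subset[of _ "Pow F"]) (auto simp: spanning_trees_def)

text \<open>Both sides of the balance equation of the Markov chain tree theorem count the functional
  graphs on \<open>R\<close> in which every vertex leads to \<open>s\<close>; such a graph arises from a tree rooted at \<open>s\<close> by
  adding the edge of the cycle that leaves \<open>s\<close>, and from a tree rooted at the predecessor of \<open>s\<close> on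
  the cycle by adding the edge of the cycle that enters \<open>s\<close>.\<close>

definition functional_graphs :: "('v \<times> 'v) set \<Rightarrow> 'v set \<Rightarrow> 'v \<Rightarrow> ('v \<times> 'v) set set" where
  "functional_graphs F R s = {\<phi>. \<phi> \<subseteq> F \<inter> R \<times> R \<and> (\<forall>v\<in>R. \<exists>!j. (v, j) \<in> \<phi>) \<and> (\<forall>v\<in>R. (v, s) \<in> \<phi>\<^sup>*)}"

text \<open>The disjunction covers both ways of closing a tree: the added edge leaves the
  distinguished vertex \<open>s\<close> or enters it.\<close>

lemma insert_edge_functional_graph:
  assumes \<tau>: "\<tau> \<in> spanning_trees F R r" and e: "(r, y) \<in> F" "y \<in> R" and s: "s = r \<or> s = y"
  shows "insert (r, y) \<tau> \<in> functional_graphs F R s"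
proof -
  have r: "r \<in> R" "\<tau> \<subseteq> F \<inter> R \<times> R" "\<And>j. (r, j) \<notin> \<tau>" "\<And>v. v \<in> R \<Longrightarrow> (v, r) \<in> \<tau>\<^sup>*"
    "\<And>v. v \<in> R - {r} \<Longrightarrow> \<exists>!j. (v, j) \<in> \<tau>"
    using \<tau> by (auto simp: spanning_trees_def)
  have "\<exists>!j. (v, j) \<in> insert (r, y) \<tau>" if "v \<in> R" for v
    using r(3) r(5)[of v] that by (cases "v = r") auto
  moreover have "(v, s) \<in> (insert (r, y) \<tau>)\<^sup>*" if "v \<in> R" for v
  proof -
    have "(v, r) \<in> (insert (r, y) \<tau>)\<^sup>*"
      using r(4)[OF that] by (rule rtrancl_mono[THEN subsetD, rotated]) auto
    then show ?thesis using s by (auto intro: rtrancl_into_rtrancl)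
  qed
  ultimately show ?thesis using e r(1,2) by (auto simp: functional_graphs_def)
qed

text \<open>\<open>r\<close> lies on the cycle through \<open>s\<close>; hence all vertices lead to
  \<open>r\<close>, and their paths up to the first arrival survive the deletion of the edge at
  \<open>r\<close>.\<close>

lemma remove_edge_spanning_tree:
  assumes \<phi>: "\<phi> \<in> functional_graphs F R s" and r: "r \<in> R" "(s, r) \<in> \<phi>\<^sup>*" and e: "(r, y) \<in> \<phi>"
  shows "\<phi> - {(r, y)} \<in> spanning_trees F R r"
proof -
  have p: "\<phi> \<subseteq> F \<inter> R \<times> R" "\<And>v. v \<in> R \<Longrightarrow> \<exists>!j. (v, j) \<in> \<phi>" "\<And>v. v \<in> R \<Longrightarrow> (v, s) \<in> \<phi>\<^sup>*"
    using \<phi> by (auto simp: functional_graphs_def)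
  have eq: "\<phi> - {(r, y)} = \<phi> - {r} \<times> UNIV" using p(2)[OF r(1)] e by auto
  have "(v, r) \<in> (\<phi> - {(r, y)})\<^sup>*" if "v \<in> R" for v
    unfolding eq using p(3)[OF that] r(2) by (intro rtrancl_first_arrival) simp
  moreover have "(r, j) \<notin> \<phi> - {(r, y)}" for j using p(2)[OF r(1)] e by auto
  moreover have "\<exists>!j. (v, j) \<in> \<phi> - {(r, y)}" if "v \<in> R - {r}" for v using p(2)[of v] that by auto
  ultimately show ?thesis using p(1) r(1) by (auto simp: spanning_trees_def)
qed

lemma bij_betw_leaving_edge:
  assumes s: "s \<in> R"
  shows "bij_betw (\<lambda>(y, \<tau>). insert (s, y) \<tau>) ({y \<in> R. (s, y) \<in> F} \<times> spanning_trees F R s)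
    (functional_graphs F R s)"
proof (rule bij_betw_imageI)
  have out: "(s, j) \<notin> \<tau>" if "\<tau> \<in> spanning_trees F R s" for \<tau> j
    using that by (auto simp: spanning_trees_def)
  show "inj_on (\<lambda>(y, \<tau>). insert (s, y) \<tau>) ({y \<in> R. (s, y) \<in> F} \<times> spanning_trees F R s)"
  proof (rule inj_onI, clarify)
    fix y \<tau> y' \<tau>'
    assume t: "\<tau> \<in> spanning_trees F R s" "\<tau>' \<in> spanning_trees F R s"
      and eq: "insert (s, y) \<tau> = insert (s, y') \<tau>'"
    have "y = y'" using eq out[OF t(2), of y] by auto
    moreover have "\<tau> = \<tau>'"
      using eq out[OF t(1), of y'] out[OF t(2), of y'] unfolding \<open>y = y'\<close> by (simp add: insert_ident)
    ultimately show "y = y' \<and> \<tau> = \<tau>'" ..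
  qed
  show "(\<lambda>(y, \<tau>). insert (s, y) \<tau>) ` ({y \<in> R. (s, y) \<in> F} \<times> spanning_trees F R s) = functional_graphs F R s"
  proof (intro equalityI subsetI)
    fix \<phi> assume \<phi>: "\<phi> \<in> functional_graphs F R s"
    then obtain y where y: "(s, y) \<in> \<phi>" using s by (auto simp: functional_graphs_def)
    then have "\<phi> - {(s, y)} \<in> spanning_trees F R s" "y \<in> R" "(s, y) \<in> F"
      using remove_edge_spanning_tree[OF \<phi> s _ y] \<phi> by (auto simp: functional_graphs_def)
    then show "\<phi> \<in> (\<lambda>(y, \<tau>). insert (s, y) \<tau>) ` ({y \<in> R. (s, y) \<in> F} \<times> spanning_trees F R s)"
      using y by (intro image_eqI[of _ _ "(y, \<phi> - {(s, y)})"]) auto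
  qed (auto intro: insert_edge_functional_graph)
qed

text \<open>The delicate point is injectivity. If trees with different roots \<open>r\<close> and
  \<open>r'\<close> closed to the same graph, each would contain the closing edge of the other. The
  path from \<open>s\<close> to \<open>r\<close> then yields a cycle: in the second tree if it
  avoids \<open>r'\<close>, in the first if it meets \<open>r'\<close>.\<close>

lemma bij_betw_entering_edge:
  assumes s: "s \<in> R"
  shows "bij_betw (\<lambda>(r, \<tau>). insert (r, s) \<tau>) (SIGMA r:{r \<in> R. (r, s) \<in> F}. spanning_trees F R r)
    (functional_graphs F R s)"
proof (rule bij_betw_imageI)
  have out: "(r, j) \<notin> \<tau>" if "\<tau> \<in> spanning_trees F R r" for \<tau> r j
    using that by (auto simp: spanning_trees_def)
  have no: False
    if t: "\<tau> \<in> spanning_trees F R r" "\<tau>' \<in> spanning_trees F R r'"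
      and eq: "insert (r, s) \<tau> = insert (r', s) \<tau>'" and ne: "r \<noteq> r'" for r \<tau> r' \<tau>'
  proof -
    have "(r', s) \<in> insert (r, s) \<tau>" "(r, s) \<in> insert (r', s) \<tau>'"
      unfolding eq by (simp, simp add: eq[symmetric])
    then have e: "(r', s) \<in> \<tau>" "(r, s) \<in> \<tau>'" using ne by auto
    have sr: "(s, r) \<in> \<tau>\<^sup>*" "(s, r') \<in> \<tau>'\<^sup>*" using t s by (auto simp: spanning_trees_def)
    \<comment> \<open>Deleting the edge at \<open>r'\<close> from the first tree leaves only edges
      that both trees share.\<close>
    let ?\<sigma> = "\<tau> - {r'} \<times> UNIV"
    have sub: "?\<sigma>\<^sup>* \<subseteq> \<tau>\<^sup>*" "?\<sigma>\<^sup>* \<subseteq> \<tau>'\<^sup>*" using eq by (auto intro!: rtrancl_mono)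
    from rtrancl_avoid_or_reach[OF sr(1), of r'] show False
    proof
      assume "(s, r) \<in> ?\<sigma>\<^sup>*"
      then have "(s, s) \<in> \<tau>'\<^sup>+" using sub(2) e(2) by (blast intro: rtrancl_into_trancl1)
      then show False
        by (rule no_cycle_before_sink[OF _ sr(2)]) (use out t(2) spanning_trees_det[OF t(2)] in auto)
    next
      assume "(s, r') \<in> ?\<sigma>\<^sup>*"
      then have "(s, s) \<in> \<tau>\<^sup>+" using sub(1) e(1) by (blast intro: rtrancl_into_trancl1)
      then show False
        by (rule no_cycle_before_sink[OF _ sr(1)]) (use out t(1) spanning_trees_det[OF t(1)] in auto)
    qed
  qed
  show "inj_on (\<lambda>(r, \<tau>). insert (r, s) \<tau>) (SIGMA r:{r \<in> R. (r, s) \<in> F}. spanning_trees F R r)"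
  proof (rule inj_onI, clarify)
    fix r \<tau> r' \<tau>'
    assume t: "\<tau> \<in> spanning_trees F R r" "\<tau>' \<in> spanning_trees F R r'"
      and eq: "insert (r, s) \<tau> = insert (r', s) \<tau>'"
    have "r = r'" using no[OF t eq] by blast
    moreover have "\<tau> = \<tau>'"
      using eq out[OF t(1), of s] out[OF t(2), of s] unfolding \<open>r = r'\<close> by (simp add: insert_ident)
    ultimately show "r = r' \<and> \<tau> = \<tau>'" ..
  qed
  show "(\<lambda>(r, \<tau>). insert (r, s) \<tau>) ` (SIGMA r:{r \<in> R. (r, s) \<in> F}. spanning_trees F R r) = functional_graphs F R s"
  proof (intro equalityI subsetI)
    fix \<phi> assume \<phi>: "\<phi> \<in> functional_graphs F R s"
    then have p: "\<phi> \<subseteq> F \<inter> R \<times> R" "\<And>v. v \<in> R \<Longrightarrow> (v, s) \<in> \<phi>\<^sup>*" by (auto simp: functional_graphs_def)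
    obtain y where y: "(s, y) \<in> \<phi>" using s \<phi> by (auto simp: functional_graphs_def)
    then have "(s, s) \<in> \<phi>\<^sup>+" using p by (meson IntD2 SigmaD2 rtrancl_into_trancl2 subsetD)
    then obtain r where r: "(s, r) \<in> \<phi>\<^sup>*" "(r, s) \<in> \<phi>" by (metis tranclD2)
    then have "r \<in> R" "(r, s) \<in> F" using p(1) by auto
    moreover have "\<phi> - {(r, s)} \<in> spanning_trees F R r"
      using remove_edge_spanning_tree[OF \<phi> \<open>r \<in> R\<close> r] .
    ultimately show "\<phi> \<in> (\<lambda>(r, \<tau>). insert (r, s) \<tau>) ` (SIGMA r:{r \<in> R. (r, s) \<in> F}. spanning_trees F R r)"
      using r by (intro image_eqI[of _ _ "(r, \<phi> - {(r, s)})"]) auto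
  qed (use s in \<open>auto intro: insert_edge_functional_graph\<close>)
qed

text \<open>A breadth-first tree: each vertex is joined to a neighbour strictly closer to
  \<open>r\<close>.\<close>

lemma spanning_tree_exists:
  assumes r: "r \<in> R" and conn: "\<And>v. v \<in> R \<Longrightarrow> (v, r) \<in> (F \<inter> R \<times> R)\<^sup>*"
  shows "spanning_trees F R r \<noteq> {}"
proof -
  let ?F = "F \<inter> R \<times> R"
  define d where "d = (\<lambda>v. LEAST n. (v, r) \<in> ?F ^^ n)"
  have d: "(v, r) \<in> ?F ^^ d v" if "v \<in> R" for v
    unfolding d_def using conn[OF that] by (metis LeastI_ex rtrancl_imp_relpow)
  have "\<exists>y. (v, y) \<in> ?F \<and> d y < d v" if v: "v \<in> R - {r}" for v
  proof -
    obtain k where k: "d v = Suc k" using d[of v] v by (cases "d v") auto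
    then obtain y where y: "(v, y) \<in> ?F" "(y, r) \<in> ?F ^^ k"
      using d[of v] v by (metis DiffD1 relpow_Suc_D2)
    then have "d y \<le> k" unfolding d_def by (intro Least_le)
    then show ?thesis using y k by auto
  qed
  then obtain p where p: "\<And>v. v \<in> R - {r} \<Longrightarrow> (v, p v) \<in> ?F \<and> d (p v) < d v" by metis
  define \<tau> where "\<tau> = {(v, p v) | v. v \<in> R - {r}}"
  have "(v, r) \<in> \<tau>\<^sup>*" if "v \<in> R" for v
    using that
  proof (induction "d v" arbitrary: v rule: less_induct)
    case less
    show ?case
    proof (cases "v = r")
      case False
      then have v: "v \<in> R - {r}" using less.prems by simp
      then have "(p v, r) \<in> \<tau>\<^sup>*" using less.hyps p by blast
      moreover have "(v, p v) \<in> \<tau>" using v by (auto simp: \<tau>_def)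
      ultimately show ?thesis by (rule converse_rtrancl_into_rtrancl[rotated])
    qed simp
  qed
  moreover have "\<tau> \<subseteq> ?F" using p by (auto simp: \<tau>_def)
  ultimately have "\<tau> \<in> spanning_trees F R r" using r by (auto simp: spanning_trees_def \<tau>_def)
  then show ?thesis by blast
qed

section \<open>Tree weights as left null vectors\<close>

context clustered
begin

lemma tree_edges_weight:
  assumes "\<tau> \<in> spanning_trees F R r"
  shows "(\<Prod>(x, y)\<in>insert (r, s) \<tau>. wt G x y) = wt G r s * (\<Prod>(x, y)\<in>\<tau>. wt G x y)"
proof -
  have "finite \<tau>" "(r, s) \<notin> \<tau>"
    using assms finite_F finite_subset by (auto simp: spanning_trees_def)
  then show ?thesis by simp
qed

lemma tree_weight_outside: "r \<notin> R \<Longrightarrow> tree_weight G F R r = 0"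
  by (simp add: tree_weight_def spanning_trees_def)

lemma tree_weight_nonneg: "tree_weight G F R r \<ge> 0"
  unfolding tree_weight_def
  by (intro sum_nonneg prod_nonneg) (auto simp: spanning_trees_def less_imp_le dest!: subsetD intro!: less_imp_le[OF wt_F_pos])

text \<open>A tree rooted at \<open>r\<close> shows that \<open>r\<close> reaches all of
  \<open>R\<close>, so only cabal vertices can carry weight.\<close>

lemma tree_weight_cabal:
  assumes R: "R \<in> Rs" and r: "r \<notin> cabal R"
  shows "tree_weight G F R r = 0"
proof -
  have "\<tau> \<notin> spanning_trees F R r" for \<tau>
  proof
    assume "\<tau> \<in> spanning_trees F R r"
    then have t: "r \<in> R" "\<tau> \<subseteq> F" "\<And>v. v \<in> R \<Longrightarrow> (v, r) \<in> \<tau>\<^sup>*" by (auto simp: spanning_trees_def)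
    then have "R \<subseteq> reachable_set F r" using rtrancl_mono[OF t(2)] by (auto simp: reachable_set_def)
    moreover have "r \<in> verts G" using t(1) reach_subset[OF R] by blast
    ultimately have "r \<in> cabal R" using R by (auto simp: reaches_def cabal_def)
    then show False using r by blast
  qed
  then have "spanning_trees F R r = {}" by blast
  then show ?thesis by (simp add: tree_weight_def)
qed

lemma tree_weight_pos:
  assumes R: "R \<in> Rs" and r: "r \<in> cabal R"
  shows "tree_weight G F R r > 0"
proof -
  have rR: "r \<in> R" using r cabal_subset by blast
  have "(v, r) \<in> (F \<inter> R \<times> R)\<^sup>*" if "v \<in> R" for v
    using reach_root[OF r that]
  proof (induction rule: converse_rtrancl_induct)
    case (step v w)
    have "w \<in> R" using step(2) r by (auto simp: cabal_def reachable_set_def)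
    then have "(v, w) \<in> F \<inter> R \<times> R" using step(1) reach_succ[OF R] by blast
    then show ?case using step.IH by (rule converse_rtrancl_into_rtrancl)
  qed simp
  then have "spanning_trees F R r \<noteq> {}" by (rule spanning_tree_exists[OF rR])
  moreover have "(\<Prod>(x, y)\<in>\<tau>. wt G x y) > 0" if "\<tau> \<in> spanning_trees F R r" for \<tau>
    using that wt_F_pos by (intro prod_pos) (auto simp: spanning_trees_def)
  ultimately show ?thesis
    unfolding tree_weight_def using finite_spanning_trees[OF finite_F] by (intro sum_pos) auto
qed

text \<open>Both sides are the total weight of the functional graphs for \<open>s\<close>, since
  adding an edge multiplies the tree weight by the weight of that edge. For \<open>s\<close> in the
  cabal all its predecessors lie in \<open>R\<close>, so the sum on the right misses none.\<close>

lemma tree_weight_balance: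
  assumes R: "R \<in> Rs" and s: "s \<in> cabal R"
  shows "(\<Sum>r | r \<in> R \<and> (r, s) \<in> F. tree_weight G F R r * wt G r s) =
    tree_weight G F R s * (\<Sum>y\<in>F `` {s}. wt G s y)"
proof -
  let ?w = "\<lambda>\<tau>. \<Prod>(x, y)\<in>\<tau>. wt G x y"
  have sR: "s \<in> R" using s cabal_subset by blast
  have "(\<Sum>r | r \<in> R \<and> (r, s) \<in> F. tree_weight G F R r * wt G r s) =
      (\<Sum>r\<in>{r \<in> R. (r, s) \<in> F}. \<Sum>\<tau>\<in>spanning_trees F R r. ?w (insert (r, s) \<tau>))"
    unfolding tree_weight_def sum_distrib_right
    by (intro sum.cong refl) (simp add: tree_edges_weight mult.commute)
  also have "\<dots> = (\<Sum>(r, \<tau>)\<in>(SIGMA r:{r \<in> R. (r, s) \<in> F}. spanning_trees F R r). ?w (insert (r, s) \<tau>))"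
    using finite_reach[OF R] finite_spanning_trees[OF finite_F] by (subst sum.Sigma) auto
  also have "\<dots> = (\<Sum>\<phi>\<in>functional_graphs F R s. ?w \<phi>)"
    using sum.reindex_bij_betw[OF bij_betw_entering_edge[OF sR], of ?w F]
    by (simp add: case_prod_unfold)
  also have "\<dots> = (\<Sum>(y, \<tau>)\<in>{y \<in> R. (s, y) \<in> F} \<times> spanning_trees F R s. ?w (insert (s, y) \<tau>))"
    using sum.reindex_bij_betw[OF bij_betw_leaving_edge[OF sR], of ?w F]
    by (simp add: case_prod_unfold)
  also have "\<dots> = (\<Sum>y\<in>{y \<in> R. (s, y) \<in> F}. \<Sum>\<tau>\<in>spanning_trees F R s. ?w (insert (s, y) \<tau>))"
    by (simp add: sum.cartesian_product)
  also have "\<dots> = (\<Sum>y\<in>{y \<in> R. (s, y) \<in> F}. \<Sum>\<tau>\<in>spanning_trees F R s. wt G s y * ?w \<tau>)"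
    by (intro sum.cong refl tree_edges_weight)
  also have "{y \<in> R. (s, y) \<in> F} = F `` {s}"
    using cabal_pred[OF _ s R] cabal_subset by blast
  finally show ?thesis
    unfolding tree_weight_def by (simp add: sum_product sum.swap[of _ "F `` {s}"] mult.commute)
qed

text \<open>Only cabal vertices carry weight and the cabal is closed under predecessors; after
  exchanging the double sum, the coefficient of each \<open>f y\<close> is the difference of the two
  sides of the balance equation.\<close>

lemma tree_weight_left_null:
  assumes R: "R \<in> Rs"
  shows "(\<Sum>x\<in>R. of_real (tree_weight G F R x) * lapsum f x) = 0"
proof -
  let ?\<omega> = "tree_weight G F R" and ?B = "cabal R"
  have fin: "finite R" "finite ?B" and sub: "?B \<subseteq> R"
    using finite_reach[OF R] cabal_subset finite_subset by blast+
  have pred: "F `` {x} = {y \<in> ?B. (x, y) \<in> F}" if "x \<in> ?B" for x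
    using cabal_pred[OF _ that R] by blast
  have "(\<Sum>x\<in>R. of_real (?\<omega> x) * lapsum f x) = (\<Sum>x\<in>?B. of_real (?\<omega> x) * lapsum f x)"
    using fin sub tree_weight_cabal[OF R] by (intro sum.mono_neutral_right) auto
  also have "\<dots> = (\<Sum>x\<in>?B. of_real (?\<omega> x * (\<Sum>y\<in>F `` {x}. wt G x y)) * f x) -
      (\<Sum>x\<in>?B. \<Sum>y\<in>F `` {x}. of_real (?\<omega> x * wt G x y) * f y)"
    by (simp add: lapsum_def sum_subtractf[symmetric] sum_distrib_left sum_distrib_right algebra_simps)
  also have "(\<Sum>x\<in>?B. \<Sum>y\<in>F `` {x}. of_real (?\<omega> x * wt G x y) * f y) =
      (\<Sum>x\<in>?B. \<Sum>y\<in>{y \<in> ?B. (x, y) \<in> F}. of_real (?\<omega> x * wt G x y) * f y)"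
    using pred by (intro sum.cong) auto
  also have "\<dots> = (\<Sum>y\<in>?B. \<Sum>x\<in>{x \<in> ?B. (x, y) \<in> F}. of_real (?\<omega> x * wt G x y) * f y)"
    by (rule sum.swap_restrict) (use fin in auto)
  also have "\<dots> = (\<Sum>y\<in>?B. of_real (\<Sum>x\<in>{x \<in> ?B. (x, y) \<in> F}. ?\<omega> x * wt G x y) * f y)"
    by (simp add: sum_distrib_right)
  also have "\<dots> = (\<Sum>y\<in>?B. of_real (?\<omega> y * (\<Sum>z\<in>F `` {y}. wt G y z)) * f y)"
  proof (intro sum.cong refl arg_cong2[where f="(*)"] arg_cong[where f=of_real])
    fix y assume y: "y \<in> ?B"
    have "(\<Sum>x\<in>{x \<in> ?B. (x, y) \<in> F}. ?\<omega> x * wt G x y) = (\<Sum>x | x \<in> R \<and> (x, y) \<in> F. ?\<omega> x * wt G x y)"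
      using fin sub tree_weight_cabal[OF R] by (intro sum.mono_neutral_left) auto
    then show "(\<Sum>x\<in>{x \<in> ?B. (x, y) \<in> F}. ?\<omega> x * wt G x y) = ?\<omega> y * (\<Sum>z\<in>F `` {y}. wt G y z)"
      using tree_weight_balance[OF R y] by simp
  qed
  finally show ?thesis by simp
qed

section \<open>Left kernel vectors and the downward map\<close>

abbreviation "\<l> \<equiv> left_kernel_vec G F"

lemma tree_weight_total_pos:
  assumes R: "R \<in> Rs" shows "(\<Sum>j\<in>R. tree_weight G F R j * mass G j) > 0"
proof -
  obtain r where r: "r \<in> cabal R" using reachE[OF R] .
  then have rR: "r \<in> R" "r \<in> verts G" using cabal_subset reach_subset[OF R] by blast+
  show ?thesis
  proof (rule sum_pos2[OF finite_reach[OF R] rR(1)])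
    show "tree_weight G F R r * mass G r > 0" using tree_weight_pos[OF R r] mass_pos[OF rR(2)] by simp
    show "tree_weight G F R i * mass G i \<ge> 0" if "i \<in> R" for i
      using tree_weight_nonneg[of R i] mass_pos[of i] that reach_subset[OF R] by (simp add: less_imp_le subset_iff)
  qed
qed

lemma left_kernel_vec_cabal: "R \<in> Rs \<Longrightarrow> r \<notin> cabal R \<Longrightarrow> \<l> R r = 0"
  by (simp add: left_kernel_vec_def tree_weight_cabal)

lemma left_kernel_vec_total: "R \<in> Rs \<Longrightarrow> (\<Sum>j\<in>R. \<l> R j * mass G j) = 1"
  using tree_weight_total_pos[of R] by (simp add: left_kernel_vec_def sum_divide_distrib[symmetric])

lemma left_kernel_vec_null:
  "R \<in> Rs \<Longrightarrow> (\<Sum>x\<in>R. of_real (\<l> R x) * lapsum f x) = 0"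
  using tree_weight_left_null[of R f] by (simp add: left_kernel_vec_def sum_divide_distrib[symmetric])

lemma J_down_eq:
  assumes R: "R \<in> Rs"
  shows "J_down G F f R = (\<Sum>x\<in>R. of_real (\<l> R x * mass G x) * f x)"
proof -
  have "J_down G F f R = infsum (\<lambda>x. cnj (of_real (\<l> R x)) * f x * of_real (mass G x)) R"
    unfolding J_down_def l2_inner_def using R reach_subset[OF R]
    by (simp, intro infsum_cong_neutral) (auto simp: left_kernel_vec_def tree_weight_outside)
  then show ?thesis using finite_reach[OF R] by (simp add: mult_ac)
qed

lemma J_down_outside: "R \<notin> Rs \<Longrightarrow> J_down G F f R = 0"
  by (simp add: J_down_def)

text \<open>The division by the mass in \<open>M\<close> cancels the mass in the inner product, so
  the left null property says that \<open>J_down\<close> annihilates the range of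
  \<open>M\<close>.\<close>

lemma J_down_lapsum:
  "J_down G F (\<lambda>x. lapsum f x / of_real (mass G x)) = (\<lambda>R. 0)"
proof
  fix R show "J_down G F (\<lambda>x. lapsum f x / of_real (mass G x)) R = 0"
  proof (cases "R \<in> Rs")
    case True
    have "(\<Sum>x\<in>R. of_real (\<l> R x * mass G x) * (lapsum f x / of_real (mass G x))) =
        (\<Sum>x\<in>R. of_real (\<l> R x) * lapsum f x)"
    proof (rule sum.cong[OF refl])
      fix x assume "x \<in> R"
      then have "mass G x \<noteq> 0" using mass_pos[of x] reach_subset[OF True] by (auto simp: subset_iff)
      then show "of_real (\<l> R x * mass G x) * (lapsum f x / of_real (mass G x)) = of_real (\<l> R x) * lapsum f x"
        by simp
    qed
    then show ?thesis using J_down_eq[OF True] left_kernel_vec_null[OF True] by simp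
  qed (rule J_down_outside)
qed

text \<open>\<open>\<l> R\<close> is a probability density with respect to the mass and is carried
  by the cabal.\<close>

lemma J_down_cabal_const:
  assumes R: "R \<in> Rs" and f: "\<And>r. r \<in> cabal R \<Longrightarrow> f r = c"
  shows "J_down G F f R = c"
proof -
  have "J_down G F f R = (\<Sum>x\<in>R. of_real (\<l> R x * mass G x) * c)"
    unfolding J_down_eq[OF R] using left_kernel_vec_cabal[OF R] f by (intro sum.cong) auto
  also have "\<dots> = of_real (\<Sum>x\<in>R. \<l> R x * mass G x) * c"
    by (simp add: sum_distrib_right)
  finally show ?thesis using left_kernel_vec_total[OF R] by simp
qed

lemma J_down_J_up: "R \<in> Rs \<Longrightarrow> J_down G F (J_up G F g) R = g R"
  using J_up_cabal by (intro J_down_cabal_const) auto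

lemma J_down_isolated: "x \<in> verts G \<Longrightarrow> x \<notin> N \<Longrightarrow> J_down G F f {x} = f x"
  using isolated_reach(1)[of x "{x}"] isolated_reach(2)[of x] by (intro J_down_cabal_const) auto

lemma J_down_add: "J_down G F (f + g) = J_down G F f + J_down G F g"
proof
  fix R show "J_down G F (f + g) R = (J_down G F f + J_down G F g) R"
    by (cases "R \<in> Rs") (simp_all add: J_down_eq J_down_outside distrib_left sum.distrib)
qed

lemma J_down_scale: "J_down G F (\<lambda>x. c * f x) = (\<lambda>R. c * J_down G F f R)"
proof
  fix R show "J_down G F (\<lambda>x. c * f x) R = c * J_down G F f R"
    by (cases "R \<in> Rs") (simp_all add: J_down_eq J_down_outside sum_distrib_left mult.left_commute)
qed

lemma J_up_add: "J_up G F (f + g) = J_up G F f + J_up G F g"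
  by (simp add: fun_eq_iff J_up_eq distrib_right sum.distrib)

lemma J_up_scale: "J_up G F (\<lambda>x. c * f x) = (\<lambda>R. c * J_up G F f R)"
  by (simp add: fun_eq_iff J_up_eq sum_distrib_left mult.assoc)

lemma J_up_outside: "x \<notin> verts G \<Longrightarrow> J_up G F f x = 0"
  using reach_subset unfolding J_up_eq by (intro sum.neutral) auto

end

section \<open>The kernel projection and the reduced masses\<close>

text \<open>The difference quotient deviates from \<open>D\<close> by at most \<open>C\<close> times
  the distance. Working within \<open>S\<close> gives derivatives also at boundary points of a
  closed disc, where the contour runs.\<close>

lemma has_field_derivative_quadratic:
  fixes f :: "complex \<Rightarrow> complex"
  assumes \<delta>: "\<delta> > 0" and bd: "\<And>y. y \<in> S \<Longrightarrow> cmod (y - x) < \<delta> \<Longrightarrow> cmod (f y - f x - (y - x) * D) \<le> C * (cmod (y - x))\<^sup>2"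
  shows "(f has_field_derivative D) (at x within S)"
proof -
  have lim: "((\<lambda>y. C * cmod (y - x)) \<longlongrightarrow> 0) (at x within S)"
    by (auto intro!: tendsto_eq_intros)
  have "eventually (\<lambda>y. norm ((f y - f x) / (y - x) - D) \<le> C * cmod (y - x)) (at x within S)"
    unfolding eventually_at
  proof (intro exI[of _ \<delta>] conjI ballI impI \<delta>)
    fix y assume y: "y \<in> S" "y \<noteq> x \<and> dist y x < \<delta>"
    then have n: "cmod (y - x) > 0" by simp
    have "(f y - f x) / (y - x) - D = (f y - f x - (y - x) * D) / (y - x)" using y by (simp add: field_simps)
    then have "norm ((f y - f x) / (y - x) - D) = cmod (f y - f x - (y - x) * D) / cmod (y - x)"
      by (simp add: norm_divide)
    also have "\<dots> \<le> C * (cmod (y - x))\<^sup>2 / cmod (y - x)"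
      using bd[OF y(1)] y(2) by (intro divide_right_mono) (auto simp: dist_norm)
    also have "\<dots> = C * cmod (y - x)" using n by (simp add: power2_eq_square)
    finally show "norm ((f y - f x) / (y - x) - D) \<le> C * cmod (y - x)" .
  qed
  then have "((\<lambda>y. (f y - f x) / (y - x) - D) \<longlongrightarrow> 0) (at x within S)"
    using lim by (rule Lim_null_comparison)
  then show ?thesis unfolding has_field_derivative_iff by (rule LIM_zero_cancel)
qed

section \<open>The projection onto the kernel of the cluster Laplacian\<close>

context clustered
begin

abbreviation "M \<equiv> laplacian (restrict_edges G F)"

definition kernel_proj :: "('v \<Rightarrow> complex) \<Rightarrow> ('v \<Rightarrow> complex)" where
  "kernel_proj f = J_up G F (J_down G F f)"

lemma M_eq: "M f = (\<lambda>x. lapsum f x / of_real (mass G x))"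
  using laplacian_F by (simp add: fun_eq_iff)

lemma J_down_M: "J_down G F (M f) = 0"
  unfolding M_eq J_down_lapsum by (simp add: zero_fun_def)

lemma J_up_0: "J_up G F 0 = 0"
  by (simp add: fun_eq_iff J_up_eq)

lemma kernel_proj_M: "kernel_proj (M f) = 0"
  by (simp add: kernel_proj_def J_down_M J_up_0)

lemma M_J_up: "M (J_up G F g) = 0"
  by (simp add: M_eq lapsum_J_up fun_eq_iff)

lemma M_kernel_proj: "M (kernel_proj f) = 0"
  by (simp add: kernel_proj_def M_J_up)

lemma J_down_J_up_id: "(\<And>R. R \<notin> Rs \<Longrightarrow> g R = 0) \<Longrightarrow> J_down G F (J_up G F g) = g"
  using J_down_J_up J_down_outside by (fastforce simp: fun_eq_iff)

lemma J_down_kernel_proj: "J_down G F (kernel_proj f) = J_down G F f"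
  unfolding kernel_proj_def by (intro J_down_J_up_id J_down_outside)

lemma kernel_proj_idem: "kernel_proj (kernel_proj f) = kernel_proj f"
  unfolding kernel_proj_def[of "kernel_proj f"] J_down_kernel_proj by (simp add: kernel_proj_def)

lemma kernel_proj_add: "kernel_proj (f + g) = kernel_proj f + kernel_proj g"
  by (simp add: kernel_proj_def J_down_add J_up_add)

lemma kernel_proj_scale: "kernel_proj (\<lambda>x. c * f x) = (\<lambda>x. c * kernel_proj f x)"
  by (simp add: kernel_proj_def J_down_scale J_up_scale)

lemma kernel_proj_outside: "x \<in> verts G \<Longrightarrow> x \<notin> N \<Longrightarrow> kernel_proj f x = f x"
  by (simp add: kernel_proj_def J_up_isolated J_down_isolated)

lemma kernel_proj_off: "x \<notin> verts G \<Longrightarrow> kernel_proj f x = 0"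
  by (simp add: kernel_proj_def J_up_outside)

lemma M_add: "M (f + g) = M f + M g"
  unfolding M_eq by (simp add: fun_eq_iff lapsum_add add_divide_distrib del: plus_fun_apply) simp

lemma M_scale: "M (\<lambda>x. c * f x) = (\<lambda>x. c * M f x)"
  by (simp add: M_eq lapsum_scale)

lemma M_supported: "M f \<in> supported N"
  by (simp add: M_eq supported_def lapsum_outside)

lemma bounded_functional_J_down: "bounded_functional (\<lambda>f. J_down G F f R)"
proof (cases "R \<in> Rs")
  case True
  then show ?thesis
    by (simp only: J_down_eq) (intro bounded_functional_sum bounded_functional_point)
next
  case False
  then show ?thesis by (auto simp: J_down_outside bounded_functional_def intro: exI[of _ 0])
qed

lemma bounded_op_kernel_proj: "bounded_op G G kernel_proj"
proof (rule bounded_opI_finite[where \<iota>="\<lambda>x. x", OF positive_mass_axioms _ _ _ finite_N])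
  show "bounded_functional (\<lambda>f. kernel_proj f y)" if "y \<in> N" for y
  proof -
    have "kernel_proj f y = (\<Sum>R | R \<in> Rs \<and> R \<subseteq> N. \<gamma> R y * J_down G F f R)" for f
      by (simp add: kernel_proj_def J_up_N[OF that] mult.commute)
    then show ?thesis by (simp only:) (intro bounded_functional_sum bounded_functional_J_down)
  qed
qed (auto simp: kernel_proj_add kernel_proj_scale kernel_proj_outside kernel_proj_off)

lemma bounded_op_M: "bounded_op G G M"
proof (rule bounded_op_finite_range[OF finite_N N_verts M_add M_scale M_supported])
  show "bounded_functional (\<lambda>f. M f y)" for y
    unfolding M_eq lapsum_def sum_divide_distrib times_divide_eq_left[symmetric]
    by (intro bounded_functional_sum bounded_functional_diff bounded_functional_point)
qed

text \<open>A harmonic function is constant on each cabal and \<open>J_down\<close> averages over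
  the cabal, so \<open>f\<close> and its projection have the same boundary values.\<close>

lemma kernel_proj_fix:
  assumes f: "\<And>x. lapsum f x = 0" "\<And>x. x \<notin> verts G \<Longrightarrow> f x = 0"
  shows "kernel_proj f = f"
proof
  fix x
  show "kernel_proj f x = f x"
  proof (cases "x \<in> verts G")
    case True
    have "(f - kernel_proj f) x = 0"
    proof (rule harmonic_determined[OF _ _ True])
      show "lapsum (f - kernel_proj f) x = 0" for x
        by (simp only: lapsum_diff f(1) kernel_proj_def lapsum_J_up) simp
      show "(f - kernel_proj f) r = 0" if "R \<in> Rs" "r \<in> cabal R" for R r
        using J_up_cabal[OF that(2,1)] J_down_cabal_const[OF that(1), of f "f r"]
          harmonic_const_cabal[OF f(1) that(1) _ that(2)] by (simp add: kernel_proj_def)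
    qed
    then show ?thesis by simp
  qed (use f(2) in \<open>simp add: kernel_proj_def J_up_outside\<close>)
qed

lemma lapsum_eq_0_iff_M: "M f = 0 \<longleftrightarrow> (\<forall>x. lapsum f x = 0)"
  using laplacian_F_eq_0 by (simp add: zero_fun_def)

lemma complement_supported: "f \<in> l2 G \<Longrightarrow> f - kernel_proj f \<in> supported N"
  unfolding supported_def l2_def using kernel_proj_outside kernel_proj_off by fastforce

text \<open>\<open>M + P\<close> is injective on \<open>supported N\<close>: applying
  \<open>P\<close> to \<open>M f + P f = 0\<close> gives \<open>P f = 0\<close>, then
  \<open>M f = 0\<close>, hence \<open>f = P f = 0\<close>. The reduced inverse is
  \<open>S = (M + P)^-1 (1 - P)\<close>, so that \<open>P S = 0\<close> and therefore
  \<open>M S = 1 - P\<close>.\<close>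

lemma reduced_inverse_exists:
  obtains S where "bounded_op G G S" "\<And>f. f \<in> l2 G \<Longrightarrow> S f \<in> supported N"
    "\<And>f. f \<in> l2 G \<Longrightarrow> M (S f) = f - kernel_proj f" "\<And>f. f \<in> l2 G \<Longrightarrow> S (M f) = f - kernel_proj f"
    "\<And>f. f \<in> l2 G \<Longrightarrow> kernel_proj (S f) = 0"
proof -
  let ?X = "supported N" and ?P = kernel_proj
  note sub = subsetD[OF supported_l2[OF finite_N N_verts]]
  note P = bounded_op_kernel_proj
  define T where "T = (\<lambda>f. M f + ?P f)"
  have T_add: "T (f + g) = T f + T g" for f g by (simp add: T_def M_add kernel_proj_add)
  have T_scale: "T (\<lambda>x. c * f x) = (\<lambda>x. c * T f x)" for c f
    by (simp add: T_def M_scale kernel_proj_scale fun_eq_iff distrib_left)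
  have T_closed: "T f \<in> ?X" if "f \<in> ?X" for f
  proof -
    have "?P f x = 0" if "x \<notin> N" for x
      using kernel_proj_outside[of x f] that supportedD[OF \<open>f \<in> ?X\<close>] by (cases "x \<in> verts G") (auto simp: kernel_proj_def J_up_outside)
    then show ?thesis using M_supported[of f] by (simp add: T_def supported_def)
  qed
  have PT: "?P (T f) = ?P f" for f by (simp add: T_def kernel_proj_add kernel_proj_M kernel_proj_idem)
  have P0: "?P 0 = 0" using bounded_op_zero[OF P] .
  have T_inj: "f = 0" if f: "f \<in> ?X" "T f = 0" for f
  proof -
    have Pf: "?P f = 0" using PT[of f] f(2) P0 by simp
    then have "M f = 0" using f(2) by (simp add: T_def)
    then have "?P f = f"
      using sub[OF f(1)] by (intro kernel_proj_fix) (auto simp: lapsum_eq_0_iff_M l2_def)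
    then show ?thesis using Pf by simp
  qed
  have T_inj': "f = g" if "f \<in> ?X" "g \<in> ?X" "T f = T g" for f g
  proof -
    have "T (f + (\<lambda>x. (-1) * g x)) = 0"
      unfolding T_add T_scale using that(3) by (simp add: fun_eq_iff)
    moreover have "f + (\<lambda>x. (-1) * g x) \<in> ?X" using that by (simp add: supported_def)
    ultimately have "f + (\<lambda>x. (-1) * g x) = 0" by (rule T_inj[rotated])
    then show ?thesis by (simp add: fun_eq_iff)
  qed
  have "\<forall>h\<in>?X. \<exists>f\<in>?X. T f = h"
    using inj_imp_surj_supported[OF finite_N T_closed T_add T_scale T_inj] by blast
  then obtain U where U: "\<And>h. h \<in> ?X \<Longrightarrow> U h \<in> ?X" "\<And>h. h \<in> ?X \<Longrightarrow> T (U h) = h" by metis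
  have UT: "U h = f" if "h \<in> ?X" "f \<in> ?X" "T f = h" for f h
    using T_inj'[OF U(1)[OF that(1)] that(2)] U(2)[OF that(1)] that(3) by simp
  have U_add: "U (f + g) = U f + U g" if "f \<in> ?X" "g \<in> ?X" for f g
    using U that by (intro UT) (auto simp: T_add supported_def)
  have U_scale: "U (\<lambda>x. c * f x) = (\<lambda>x. c * U f x)" if "f \<in> ?X" for f c
    using U that by (intro UT) (auto simp: T_scale supported_def)
  define S where "S = (\<lambda>f. U (f - ?P f))"
  note Q = complement_supported
  have S_supp: "S f \<in> ?X" if "f \<in> l2 G" for f using U(1)[OF Q[OF that]] by (simp add: S_def)
  have bS: "bounded_op G G S"
  proof (rule bounded_op_finite_range[OF finite_N N_verts _ _ S_supp])
    show "S (f + g) = S f + S g" if "f \<in> l2 G" "g \<in> l2 G" for f g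
      using U_add[OF Q[OF that(1)] Q[OF that(2)]] by (simp add: S_def kernel_proj_add algebra_simps)
    show "S (\<lambda>x. c * f x) = (\<lambda>y. c * S f y)" if "f \<in> l2 G" for c f
    proof -
      have "(\<lambda>x. c * f x) - ?P (\<lambda>x. c * f x) = (\<lambda>x. c * (f - ?P f) x)"
        by (simp add: kernel_proj_scale fun_eq_iff algebra_simps)
      then show ?thesis unfolding S_def by (simp only: U_scale[OF Q[OF that]])
    qed
    show "bounded_functional (\<lambda>f. S f y)" for y
    proof -
      \<comment> \<open>\<open>U\<close> is known only through a choice; expanding it in point
        indicators shows that each coordinate of \<open>S\<close> is a finite combination of bounded
        functionals.\<close>
      have eq: "S f y = (\<Sum>x\<in>N. U (indicator {x}) y * (f x - ?P f x))" if "f \<in> l2 G" for f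
        unfolding S_def
        using linear_supported_expand[of N U "f - ?P f", OF finite_N U_add U_scale Q[OF that]]
        by (simp add: sum_fun_apply mult.commute)
      have "bounded_functional (\<lambda>f. \<Sum>x\<in>N. U (indicator {x}) y * (f x - ?P f x))"
        by (intro bounded_functional_sum bounded_functional_diff bounded_functional_point
            bounded_functional_op[OF P positive_mass_axioms])
      then show ?thesis using eq by (simp add: bounded_functional_def)
    qed
  qed
  have PS: "?P (S f) = 0" if "f \<in> l2 G" for f
  proof -
    have "T (S f) = f - ?P f" using U(2)[OF Q[OF that]] by (simp add: S_def)
    then have "?P (S f) = ?P (f - ?P f)" using PT[of "S f"] by simp
    also have "\<dots> = 0"
      using bounded_op_diff[OF P that bounded_op_mem[OF P that]] kernel_proj_idem by simp
    finally show ?thesis .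
  qed
  have MS: "M (S f) = f - ?P f" if "f \<in> l2 G" for f
    using U(2)[OF Q[OF that]] PS[OF that] by (simp add: S_def T_def)
  have SM: "S (M f) = f - ?P f" if "f \<in> l2 G" for f
  proof -
    have "T (f - ?P f) = M f"
      unfolding T_def
      using bounded_op_diff[OF P that bounded_op_mem[OF P that]] kernel_proj_idem
        bounded_op_diff[OF bounded_op_M that bounded_op_mem[OF P that]] M_kernel_proj by simp
    then have "U (M f) = f - ?P f" using UT Q[OF that] M_supported by blast
    then show ?thesis by (simp add: S_def kernel_proj_M)
  qed
  show ?thesis using that[OF bS S_supp MS SM PS] .
qed

text \<open>Strong coupling for \<open>A = -1\<close>, \<open>B = -P\<close> and \<beta> =
  1/\<zeta>: the equation \<open>-f + M f / \<zeta> = g / \<zeta>\<close> is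
  \<open>(M - \<zeta>) f = g\<close>, so large coupling means small \<zeta>. This supplies the
  witness for \<open>riesz_radius\<close>.\<close>

lemma spectrum_isolated: "\<exists>\<epsilon>>0. op_spectrum G M \<inter> cball 0 \<epsilon> \<subseteq> {0}"
proof -
  obtain S where S: "bounded_op G G S" "\<And>f. f \<in> l2 G \<Longrightarrow> S f \<in> supported N"
    "\<And>f. f \<in> l2 G \<Longrightarrow> M (S f) = f - kernel_proj f" "\<And>f. f \<in> l2 G \<Longrightarrow> S (M f) = f - kernel_proj f"
    using reduced_inverse_exists by metis
  note G = positive_mass_axioms and P = bounded_op_kernel_proj
  have neg: "bounded_op G G (\<lambda>f. - f)"
    using bounded_op_cmul[OF bounded_op_id G, of "-1"] by (simp add: fun_Compl_def)
  have negP: "bounded_op G G (\<lambda>f. - kernel_proj f)" by (rule bounded_op_comp[OF P G neg])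
  have Pn: "kernel_proj (- f) = - kernel_proj f" if "f \<in> l2 G" for f
    using bounded_op_uminus[OF P that] .
  note Pm = bounded_op_mem[OF P]
  define A B where "A = (\<lambda>f::'v \<Rightarrow> complex. - f)" and "B = (\<lambda>f. - kernel_proj f)"
  have bA: "bounded_op G G A" and bB: "bounded_op G G B" using neg negP by (simp_all add: A_def B_def)
  have PB: "kernel_proj (B f) = B f" "B (kernel_proj f) = B f" "kernel_proj (A (B f)) = kernel_proj f"
    "B (A (kernel_proj f)) = kernel_proj f" if "f \<in> l2 G" for f
    using Pn[OF Pm[OF that]] by (simp_all add: A_def B_def kernel_proj_idem)
  have "\<exists>C>0. \<exists>b>0. \<forall>\<beta>::complex. cmod \<beta> \<ge> b \<longrightarrow>
        (\<forall>f\<in>l2 G. (\<lambda>x. A f x + \<beta> * M f x) = 0 \<longrightarrow> f = 0) \<and>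
        (\<forall>g\<in>l2 G. \<exists>f\<in>l2 G. (\<lambda>x. A f x + \<beta> * M f x) = g \<and>
           l2_norm G (f - B g) \<le> C / cmod \<beta> * l2_norm G g)"
    by (rule strong_coupling[OF bA bounded_op_M P S(1) bB finite_N N_verts S(2-4) M_kernel_proj kernel_proj_M PB])
  then obtain C b where C: "C > 0" "b > 0" and *: "\<forall>\<beta>::complex. cmod \<beta> \<ge> b \<longrightarrow>
        (\<forall>f\<in>l2 G. (\<lambda>x. A f x + \<beta> * M f x) = 0 \<longrightarrow> f = 0) \<and>
        (\<forall>g\<in>l2 G. \<exists>f\<in>l2 G. (\<lambda>x. A f x + \<beta> * M f x) = g \<and>
           l2_norm G (f - B g) \<le> C / cmod \<beta> * l2_norm G g)"
    by (elim exE conjE)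
  have inj: "f = 0" if "cmod \<beta> \<ge> b" "f \<in> l2 G" "(\<lambda>x. (- f) x + \<beta> * M f x) = 0" for \<beta> f
    using *[rule_format, OF that(1), THEN conjunct1, rule_format, OF that(2)] that(3) by (simp add: A_def)
  have ex: "\<exists>f\<in>l2 G. (\<lambda>x. (- f) x + \<beta> * M f x) = g \<and>
         l2_norm G (f - (- kernel_proj g)) \<le> C / cmod \<beta> * l2_norm G g"
    if "cmod \<beta> \<ge> b" "g \<in> l2 G" for \<beta> g
    using *[rule_format, OF that(1), THEN conjunct2, rule_format, OF that(2)] by (simp only: A_def B_def)
  obtain p where p: "p > 0" "\<And>f. f \<in> l2 G \<Longrightarrow> l2_norm G (kernel_proj f) \<le> p * l2_norm G f"
    using bounded_op_bound[OF P] by blast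
  have "\<zeta> \<in> resolvent_set G M" if \<zeta>: "\<zeta> \<noteq> 0" "cmod \<zeta> \<le> 1 / b" for \<zeta>
  \<comment> \<open>For \<open>h = g / \<zeta>\<close> the solution differs from
    \<open>- P h\<close> by at most \<open>C * cmod \<zeta>\<close> times the norm of
    \<open>h\<close>, and \<open>p\<close> bounds \<open>P\<close>.\<close>
  proof (rule resolvent_setI[where K="(C * cmod \<zeta> + p) * cmod (1 / \<zeta>)"])
    have b: "cmod (1 / \<zeta>) \<ge> b" using \<zeta> C(2) by (simp add: norm_divide field_simps)
    show "f = 0" if f: "f \<in> l2 G" "(\<lambda>x. M f x - \<zeta> * f x) = 0" for f
    proof (rule inj[OF b f(1)])
      show "(\<lambda>x. (- f) x + 1 / \<zeta> * M f x) = 0"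
        using f(2) \<zeta>(1) by (simp add: fun_eq_iff field_simps)
    qed
    show "\<exists>f\<in>l2 G. (\<lambda>x. M f x - \<zeta> * f x) = g \<and> l2_norm G f \<le> (C * cmod \<zeta> + p) * cmod (1 / \<zeta>) * l2_norm G g"
      if g: "g \<in> l2 G" for g
    proof -
      define h where "h = (\<lambda>x. 1 / \<zeta> * g x)"
      have h: "h \<in> l2 G" unfolding h_def by (rule l2_scale_mem[OF g])
      obtain f where f: "f \<in> l2 G" "(\<lambda>x. (- f) x + 1 / \<zeta> * M f x) = h"
        "l2_norm G (f - (- kernel_proj h)) \<le> C / cmod (1 / \<zeta>) * l2_norm G h"
        using ex[OF b h] by blast
      have "(- f) x + 1 / \<zeta> * M f x = 1 / \<zeta> * g x" for x
        using fun_cong[OF f(2), of x] by (simp add: h_def)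
      then have eq: "(\<lambda>x. M f x - \<zeta> * f x) = g" using \<zeta>(1) by (simp add: fun_eq_iff field_simps)
      have "f = (f - (- kernel_proj h)) + (- kernel_proj h)" by simp
      then have "l2_norm G f \<le> l2_norm G (f - (- kernel_proj h)) + l2_norm G (- kernel_proj h)"
        using l2_triangle[OF l2_diff_mem[OF f(1) l2_uminus_mem[OF Pm[OF h]]] l2_uminus_mem[OF Pm[OF h]]] by metis
      also have "\<dots> \<le> C / cmod (1 / \<zeta>) * l2_norm G h + p * l2_norm G h"
        using f(3) p(2)[OF h] by (simp add: l2_norm_uminus)
      also have "\<dots> = (C * cmod \<zeta> + p) * (cmod (1 / \<zeta>) * l2_norm G g)"
        unfolding h_def l2_norm_scale using \<zeta>(1) by (simp add: norm_divide field_simps)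
      finally show ?thesis using f(1) eq by (auto simp: mult.assoc)
    qed
  qed (use bounded_op_mem[OF bounded_op_M] M_add M_scale in auto)
  then have "op_spectrum G M \<inter> cball 0 (1 / b) \<subseteq> {0}"
    unfolding op_spectrum_def mem_cball dist_0_norm subset_iff Int_iff Compl_iff singleton_iff by blast
  then show ?thesis using C(2) by (intro exI[of _ "1 / b"]) simp
qed

section \<open>The Riesz projection of a reach indicator and the reduced masses\<close>

lemma J_down_indicator:
  assumes R: "R \<in> Rs" shows "J_down G F (indicator R) = indicator {R}"
proof
  fix S show "J_down G F (indicator R) S = indicator {R} S"
  proof (cases "S \<in> Rs")
    case True
    show ?thesis
    proof (rule J_down_cabal_const[OF True])
      fix r assume r: "r \<in> cabal S"
      then have "r \<in> R \<longleftrightarrow> S = R" using cabal_reaches[OF r True _ R] cabal_subset by blast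
      then show "indicator R r = (indicator {R} S :: complex)" by (simp add: indicator_def)
    qed
  next
    case False
    then have "S \<noteq> R" using R by blast
    then show ?thesis using False J_down_outside by simp
  qed
qed

lemma J_up_indicator:
  assumes R: "R \<in> Rs" shows "J_up G F (indicator {R}) = \<gamma> R"
proof
  fix x
  have "(\<Sum>S | S \<in> Rs \<and> x \<in> S. indicator {R} S * \<gamma> S x) = (\<Sum>S\<in>{S \<in> Rs. x \<in> S} \<inter> {R}. \<gamma> S x)"
    by (subst sum.inter_restrict[OF finite_reaches_at]) (auto simp: indicator_def intro!: sum.cong)
  also have "\<dots> = \<gamma> R x"
    using right_kernel_vec(3)[OF R, of x] R by (cases "x \<in> R") auto
  finally show "J_up G F (indicator {R}) x = \<gamma> R x" by (simp add: J_up_eq)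
qed

text \<open>Split \<open>indicator R = \<gamma> R + g\<close> with \<open>P g = 0\<close>. On
  \<open>\<gamma> R\<close> the resolvent is multiplication by \<open>-1/\<zeta>\<close>, and on
  \<open>g\<close> it extends holomorphically over 0 by the reduced inverse. The integrand is
  therefore \<open>(\<gamma> R x - \<zeta> * r \<zeta> x) / \<zeta>\<close>, and Cauchy's formula at
  0 gives \<open>\<gamma> R x\<close>.\<close>

lemma riesz_projection_indicator:
  assumes R: "R \<in> Rs"
  shows "riesz_projection G M (indicator R) = \<gamma> R"
proof
  fix x
  note G = positive_mass_axioms and P = bounded_op_kernel_proj
  note bM = bounded_op_M
  define \<epsilon> where "\<epsilon> = riesz_radius G M"
  have eps: "\<epsilon> > 0 \<and> op_spectrum G M \<inter> cball 0 \<epsilon> \<subseteq> {0}"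
    unfolding \<epsilon>_def riesz_radius_def using someI_ex[OF spectrum_isolated] .
  have res: "\<zeta> \<in> resolvent_set G M" if "\<zeta> \<in> cball 0 \<epsilon>" "\<zeta> \<noteq> 0" for \<zeta>
    using eps that by (auto simp: op_spectrum_def)
  obtain S where S: "bounded_op G G S"
    "\<And>f. f \<in> l2 G \<Longrightarrow> M (S f) = f - kernel_proj f" "\<And>f. f \<in> l2 G \<Longrightarrow> S (M f) = f - kernel_proj f"
    "\<And>f. f \<in> l2 G \<Longrightarrow> kernel_proj (S f) = 0"
    using reduced_inverse_exists by metis
  have "(indicator R :: 'v \<Rightarrow> complex) \<in> supported R" by (simp add: supported_def)
  then have \<chi>: "(indicator R :: 'v \<Rightarrow> complex) \<in> l2 G"
    using supported_l2[OF finite_reach[OF R] reach_subset[OF R]] by blast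
  have \<gamma>: "\<gamma> R \<in> l2 G" by (rule right_kernel_vec_l2[OF R])
  have P\<chi>: "kernel_proj (indicator R) = \<gamma> R"
    unfolding kernel_proj_def J_down_indicator[OF R] J_up_indicator[OF R] ..
  have M\<gamma>: "M (\<gamma> R) = 0" using right_kernel_vec(1)[OF R] by (simp add: lapsum_eq_0_iff_M)
  define g :: "'v \<Rightarrow> complex" where "g = indicator R - \<gamma> R"
  have g: "g \<in> l2 G" using \<chi> \<gamma> l2_diff_mem by (simp add: g_def)
  have Pg: "kernel_proj g = 0"
    using bounded_op_diff[OF P \<chi> \<gamma>] P\<chi> kernel_proj_idem[of "indicator R"] by (simp add: g_def)
  \<comment> \<open>At 0 the resolvent does not exist; on the range of \<open>1 - P\<close> its
    place is taken by \<open>S\<close>.\<close>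
  define U where "U = (\<lambda>\<zeta>. if \<zeta> = 0 then S else resolvent G M \<zeta>)"
  define r where "r = (\<lambda>\<zeta>. U \<zeta> g)"
  have bU: "bounded_op G G (U \<zeta>)" if "\<zeta> \<in> cball 0 \<epsilon>" for \<zeta>
    using S(1) resolvent_eqs(1)[OF res[OF that]] by (simp add: U_def)
  have r: "r \<zeta> \<in> l2 G" if "\<zeta> \<in> cball 0 \<epsilon>" for \<zeta>
    using bounded_op_mem[OF bU[OF that] g] by (simp add: r_def)
  have req: "M (r \<zeta>) x - \<zeta> * r \<zeta> x = g x" if "\<zeta> \<in> cball 0 \<epsilon>" for \<zeta> x
  proof (cases "\<zeta> = 0")
    case True
    then show ?thesis using S(2)[OF g] Pg by (simp add: r_def U_def)
  next
    case False
    then show ?thesis using fun_cong[OF resolvent_eqs(2)[OF res[OF that False] g], of x]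
      by (simp add: r_def U_def)
  qed
  have Pr: "kernel_proj (r \<zeta>) = 0" if z: "\<zeta> \<in> cball 0 \<epsilon>" for \<zeta>
  proof (cases "\<zeta> = 0")
    case True
    then show ?thesis using S(4)[OF g] by (simp add: r_def U_def)
  next
    case False
    have "g + (\<lambda>x. \<zeta> * r \<zeta> x) = M (r \<zeta>)" using req[OF z] by (simp add: fun_eq_iff algebra_simps)
    then have "kernel_proj (g + (\<lambda>x. \<zeta> * r \<zeta> x)) = 0" by (simp add: kernel_proj_M)
    then have "(\<lambda>x. \<zeta> * kernel_proj (r \<zeta>) x) = 0"
      by (simp only: kernel_proj_add kernel_proj_scale Pg) simp
    then show ?thesis using False by (simp add: fun_eq_iff)
  qed
  have UM: "U \<zeta> (\<lambda>x. M h x - \<zeta> * h x) = h"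
    if "\<zeta> \<in> cball 0 \<epsilon>" "h \<in> l2 G" "kernel_proj h = 0" for \<zeta> h
    using S(3)[OF that(2)] that(3) resolvent_eqs(3)[OF res[OF that(1)] that(2)] by (simp add: U_def)
  \<comment> \<open>The first resolvent identity: \<open>r \<xi> - r \<zeta>\<close> has zero
    projection, so \<open>U \<zeta>\<close> undoes \<open>M - \<zeta>\<close> on it even for
    \<open>\<zeta> = 0\<close>.\<close>
  have diff: "r \<xi> - r \<zeta> = (\<lambda>x. (\<xi> - \<zeta>) * U \<zeta> (r \<xi>) x)"
    if z: "\<zeta> \<in> cball 0 \<epsilon>" "\<xi> \<in> cball 0 \<epsilon>" for \<zeta> \<xi>
  proof -
    have m: "r \<xi> - r \<zeta> \<in> l2 G" using l2_diff_mem r z by blast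
    have "kernel_proj (r \<xi> - r \<zeta>) = 0"
      using bounded_op_diff[OF P r[OF z(2)] r[OF z(1)]] Pr z by simp
    then have "r \<xi> - r \<zeta> = U \<zeta> (\<lambda>x. M (r \<xi> - r \<zeta>) x - \<zeta> * (r \<xi> - r \<zeta>) x)"
      using UM[OF z(1) m] by simp
    also have "(\<lambda>x. M (r \<xi> - r \<zeta>) x - \<zeta> * (r \<xi> - r \<zeta>) x) = (\<lambda>x. (\<xi> - \<zeta>) * r \<xi> x)"
    proof
      fix x
      show "M (r \<xi> - r \<zeta>) x - \<zeta> * (r \<xi> - r \<zeta>) x = (\<xi> - \<zeta>) * r \<xi> x"
        using req[OF z(1), of x] req[OF z(2), of x]
        by (simp add: bounded_op_diff[OF bM r[OF z(2)] r[OF z(1)]] algebra_simps)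
    qed
    also have "U \<zeta> \<dots> = (\<lambda>x. (\<xi> - \<zeta>) * U \<zeta> (r \<xi>) x)"
      by (rule bounded_op_scale[OF bU[OF z(1)] r[OF z(2)]])
    finally show ?thesis .
  qed
  have deriv: "((\<lambda>\<xi>. r \<xi> x) has_field_derivative U \<zeta> (r \<zeta>) x) (at \<zeta> within cball 0 \<epsilon>)"
    if z: "\<zeta> \<in> cball 0 \<epsilon>" for \<zeta>
  proof -
    note b = bU[OF z]
    obtain k where k: "k > 0" "\<And>f. f \<in> l2 G \<Longrightarrow> l2_norm G (U \<zeta> f) \<le> k * l2_norm G f"
      using bounded_op_bound[OF b] by blast
    obtain c where c: "c \<ge> 0" "\<And>f. f \<in> l2 G \<Longrightarrow> cmod (f x) \<le> c * l2_norm G f"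
      using l2_point_bound[of x] by blast
    show ?thesis
    \<comment> \<open>The remainder is \<open>(\<xi> - \<zeta>)^2\<close> times
      \<open>U \<zeta> (U \<zeta> (r \<xi>))\<close>. The radius \<open>1 / (2 * k)\<close> keeps
      the norm of \<open>r \<xi>\<close> below twice that of \<open>r \<zeta>\<close>, a bound
      independent of \<xi>.\<close>
    proof (rule has_field_derivative_quadratic[where \<delta>="1 / (2 * k)" and C="c * (k * (k * (2 * l2_norm G (r \<zeta>))))"])
      fix \<xi> assume xi: "\<xi> \<in> cball 0 \<epsilon>" and close: "cmod (\<xi> - \<zeta>) < 1 / (2 * k)"
      note rx = r[OF xi] and rz = r[OF z]
      note Ur = bounded_op_mem[OF b rx]
      have "l2_norm G (r \<xi> - r \<zeta>) = cmod (\<xi> - \<zeta>) * l2_norm G (U \<zeta> (r \<xi>))"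
        unfolding diff[OF z xi] by (rule l2_norm_scale)
      also have "\<dots> \<le> 1 / (2 * k) * (k * l2_norm G (r \<xi>))"
        using close k(2)[OF rx] k(1) by (intro mult_mono) auto
      finally have half: "l2_norm G (r \<xi> - r \<zeta>) \<le> l2_norm G (r \<xi>) / 2" using k(1) by simp
      have "l2_norm G (r \<xi>) \<le> l2_norm G (r \<zeta>) + l2_norm G (r \<xi> - r \<zeta>)"
        using l2_triangle[OF rz l2_diff_mem[OF rx rz]] by simp
      then have n: "l2_norm G (r \<xi>) \<le> 2 * l2_norm G (r \<zeta>)" using half by simp
      have "U \<zeta> (r \<xi>) - U \<zeta> (r \<zeta>) = U \<zeta> (r \<xi> - r \<zeta>)"
        by (rule bounded_op_diff[OF b rx rz, symmetric])
      also have "\<dots> = (\<lambda>x. (\<xi> - \<zeta>) * U \<zeta> (U \<zeta> (r \<xi>)) x)"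
        unfolding diff[OF z xi] by (rule bounded_op_scale[OF b Ur])
      finally have "U \<zeta> (r \<xi>) x - U \<zeta> (r \<zeta>) x = (\<xi> - \<zeta>) * U \<zeta> (U \<zeta> (r \<xi>)) x"
        by (simp add: fun_eq_iff)
      moreover have "r \<xi> x - r \<zeta> x = (\<xi> - \<zeta>) * U \<zeta> (r \<xi>) x"
        using fun_cong[OF diff[OF z xi], of x] by simp
      ultimately have "r \<xi> x - r \<zeta> x - (\<xi> - \<zeta>) * U \<zeta> (r \<zeta>) x = (\<xi> - \<zeta>) * ((\<xi> - \<zeta>) * U \<zeta> (U \<zeta> (r \<xi>)) x)"
        by (metis right_diff_distrib)
      then have "cmod (r \<xi> x - r \<zeta> x - (\<xi> - \<zeta>) * U \<zeta> (r \<zeta>) x) = cmod (U \<zeta> (U \<zeta> (r \<xi>)) x) * (cmod (\<xi> - \<zeta>))\<^sup>2"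
        by (simp add: norm_mult power2_eq_square)
      also have "cmod (U \<zeta> (U \<zeta> (r \<xi>)) x) \<le> c * (k * (k * (2 * l2_norm G (r \<zeta>))))"
      proof -
        have "l2_norm G (U \<zeta> (U \<zeta> (r \<xi>))) \<le> k * l2_norm G (U \<zeta> (r \<xi>))" by (rule k(2)[OF Ur])
        also have "\<dots> \<le> k * (k * l2_norm G (r \<xi>))" using k(2)[OF rx] k(1) by simp
        also have "\<dots> \<le> k * (k * (2 * l2_norm G (r \<zeta>)))" using n k(1) by simp
        finally show ?thesis
          using c(2)[OF bounded_op_mem[OF b Ur]] c(1) by (meson mult_left_mono order_trans)
      qed
      finally show "cmod (r \<xi> x - r \<zeta> x - (\<xi> - \<zeta>) * U \<zeta> (r \<zeta>) x)
          \<le> c * (k * (k * (2 * l2_norm G (r \<zeta>)))) * (cmod (\<xi> - \<zeta>))\<^sup>2"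
        by (simp add: mult_right_mono)
    qed (use k in simp)
  qed
  have hol: "(\<lambda>\<zeta>. \<gamma> R x - \<zeta> * r \<zeta> x) holomorphic_on cball 0 \<epsilon>"
  proof (intro holomorphic_intros)
    show "(\<lambda>\<zeta>. r \<zeta> x) holomorphic_on cball 0 \<epsilon>"
      unfolding holomorphic_on_def field_differentiable_def using deriv by blast
  qed
  have "((\<lambda>\<zeta>. (\<gamma> R x - \<zeta> * r \<zeta> x) / (\<zeta> - 0)) has_contour_integral (2 * of_real pi * \<i> * (\<gamma> R x - 0 * r 0 x)))
      (circlepath 0 \<epsilon>)"
    using eps by (intro Cauchy_integral_circlepath_simple[OF hol]) auto
  then have quot: "((\<lambda>\<zeta>. (\<gamma> R x - \<zeta> * r \<zeta> x) / \<zeta>) has_contour_integral (2 * of_real pi * \<i> * \<gamma> R x))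
      (circlepath 0 \<epsilon>)" by simp
  have int: "((\<lambda>\<zeta>. - resolvent G M \<zeta> (indicator R) x) has_contour_integral (2 * of_real pi * \<i> * \<gamma> R x))
      (circlepath 0 \<epsilon>)"
  proof (rule has_contour_integral_eq[OF quot])
    fix \<zeta> assume "\<zeta> \<in> path_image (circlepath 0 \<epsilon>)"
    then have z: "\<zeta> \<in> cball 0 \<epsilon>" "\<zeta> \<noteq> 0" using eps by auto
    \<comment> \<open>The resolvent value is found by exhibiting the preimage of
      \<open>indicator R\<close>: \<open>M\<close> kills \<open>\<gamma> R\<close>, so
      \<open>M - \<zeta>\<close> sends \<open>- \<gamma> R / \<zeta>\<close> to
      \<open>\<gamma> R\<close>, and \<open>r \<zeta>\<close> to \<open>g\<close>.\<close>
    let ?h = "r \<zeta> - (\<lambda>x. 1 / \<zeta> * \<gamma> R x)"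
    have m: "?h \<in> l2 G" using l2_diff_mem[OF r[OF z(1)] l2_scale_mem[OF \<gamma>]] .
    have "(\<lambda>x. M ?h x - \<zeta> * ?h x) = indicator R"
    proof
      fix x
      have "M ?h = M (r \<zeta>) - M (\<lambda>x. 1 / \<zeta> * \<gamma> R x)"
        by (rule bounded_op_diff[OF bM r[OF z(1)] l2_scale_mem[OF \<gamma>]])
      also have "\<dots> = M (r \<zeta>)" unfolding M_scale M\<gamma> by (simp add: fun_eq_iff)
      finally have "M ?h = M (r \<zeta>)" .
      then show "M ?h x - \<zeta> * ?h x = indicator R x"
        using req[OF z(1), of x] z(2) by (simp add: g_def algebra_simps)
    qed
    then have "resolvent G M \<zeta> (indicator R) x = r \<zeta> x - 1 / \<zeta> * \<gamma> R x"
      using fun_cong[OF resolvent_eqs(3)[OF res[OF z] m], of x] by simp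
    then show "(\<gamma> R x - \<zeta> * r \<zeta> x) / \<zeta> = - resolvent G M \<zeta> (indicator R) x"
      using z(2) by (simp add: field_simps)
  qed
  show "riesz_projection G M (indicator R) x = \<gamma> R x"
    unfolding riesz_projection_def \<epsilon>_def[symmetric] contour_integral_unique[OF int] by simp
qed

lemma reduced_mass_eq:
  assumes R: "R \<in> Rs"
  shows "reduced_mass G F R = (\<Sum>x\<in>R. Re (\<gamma> R x) * mass G x)"
proof -
  have "l2_inner G (indicator R) (\<gamma> R) = infsum (\<lambda>x. \<gamma> R x * of_real (mass G x)) R"
    unfolding l2_inner_def using reach_subset[OF R] by (intro infsum_cong_neutral) auto
  then show ?thesis
    unfolding reduced_mass_def riesz_projection_indicator[OF R] using finite_reach[OF R]
    by simp
qed

lemma reduced_mass_pos: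
  assumes R: "R \<in> Rs" shows "reduced_mass G F R > 0"
proof -
  obtain r where r: "r \<in> cabal R" using reachE[OF R] .
  then have rR: "r \<in> R" "r \<in> verts G" using cabal_subset reach_subset[OF R] by blast+
  show ?thesis
    unfolding reduced_mass_eq[OF R]
  proof (rule sum_pos2[OF finite_reach[OF R] rR(1)])
    show "Re (\<gamma> R r) * mass G r > 0" using right_kernel_vec_cabal[OF R R r] mass_pos[OF rR(2)] by simp
    show "Re (\<gamma> R i) * mass G i \<ge> 0" if "i \<in> R" for i
      using right_kernel_vec_nonneg[OF R, of i] mass_pos[of i] that reach_subset[OF R]
      by (simp add: less_imp_le subset_iff)
  qed
qed

text \<open>Off \<open>N\<close> the reduced graph carries the masses of \<open>G\<close>, so the
  transfer maps preserve the weighted squares of those coordinates.\<close>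

lemma reduced_mass_isolated: "x \<in> verts G \<Longrightarrow> x \<notin> N \<Longrightarrow> reduced_mass G F {x} = mass G x"
  using reduced_mass_eq[of "{x}"] isolated_reach(1)[of x "{x}"] by (simp add: right_kernel_vec_isolated)

end

section \<open>The reduced Laplacian and the limit of strong coupling\<close>

context wdigraph
begin

lemma wt_eq_0: "v \<in> verts G \<Longrightarrow> w \<in> verts G \<Longrightarrow> (v, w) \<notin> edges G \<Longrightarrow> wt G v w = 0"
  using wt_nonneg wt_pos_iff by fastforce

lemma neighbours:
  assumes "x \<in> verts G"
  shows "finite (edges G `` {x})" "edges G `` {x} \<subseteq> verts G"
    "\<And>y. y \<in> verts G - edges G `` {x} \<Longrightarrow> wt G x y = 0"
  using locally_finite[OF assms] edges_subset wt_eq_0[OF assms] by (auto simp: Image_def)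

lemma laplacian_graph_eq:
  "x \<in> verts G \<Longrightarrow> laplacian G f x = (\<Sum>y\<in>edges G `` {x}. of_real (wt G x y) * (f x - f y)) / of_real (mass G x)"
  using laplacian_eq[OF _ neighbours] by blast

text \<open>A Schur test: Cauchy-Schwarz with each weight split into two square roots uses the
  in-degree bound, and after exchanging the sums the out-degree bound applies to each column. The
  resulting factor \<open>2 * K * (K + K)\<close> for the squares is the norm bound
  \<open>2 * K\<close>.\<close>

lemma bounded_op_laplacian: "bounded_op G G (laplacian G)"
proof -
  interpret positive_mass G by unfold_locales (rule mass_pos)
  let ?E = "\<lambda>x. edges G `` {x}"
  obtain K where K: "K > 0" "\<And>v. v \<in> verts G \<Longrightarrow> in_deg G v \<le> K * mass G v \<and> out_deg G v \<le> K * mass G v"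
    using bounded_degrees by blast
  have in_le: "(\<Sum>y\<in>?E x. wt G x y) \<le> K * mass G x" if x: "x \<in> verts G" for x
  proof -
    have "in_deg G x = infsum (\<lambda>y. wt G x y) (?E x)"
      unfolding in_deg_def using neighbours[OF x] by (intro infsum_cong_neutral) auto
    then show ?thesis using K(2)[OF x] neighbours[OF x] by simp
  qed
  have out_le: "(\<Sum>x | x \<in> X \<and> (x, y) \<in> edges G. wt G x y) \<le> K * mass G y"
    if y: "y \<in> verts G" and X: "finite X" "X \<subseteq> verts G" for X y
  proof -
    let ?A = "{x. (x, y) \<in> edges G}"
    have fin: "finite ?A" "?A \<subseteq> verts G" using locally_finite[OF y] edges_subset by auto
    have "out_deg G y = infsum (\<lambda>x. wt G x y) ?A"
      unfolding out_deg_def using fin y wt_eq_0 by (intro infsum_cong_neutral) auto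
    then have "out_deg G y = (\<Sum>x\<in>?A. wt G x y)" using fin by simp
    moreover have "(\<Sum>x | x \<in> X \<and> (x, y) \<in> edges G. wt G x y) \<le> (\<Sum>x\<in>?A. wt G x y)"
      using fin y wt_nonneg by (intro sum_mono2) auto
    ultimately show ?thesis using K(2)[OF y] by simp
  qed
  have pt: "(cmod (laplacian G f x))\<^sup>2 * mass G x \<le>
      2 * K * (K * mass G x * (cmod (f x))\<^sup>2 + (\<Sum>y\<in>?E x. wt G x y * (cmod (f y))\<^sup>2))"
    if x: "x \<in> verts G" for f x
  proof -
    have m: "mass G x > 0" using mass_pos[OF x] .
    have a: "wt G x y \<ge> 0" if "y \<in> ?E x" for y using that neighbours(2)[OF x] wt_nonneg[OF x] by blast
    let ?d = "\<lambda>y. cmod (f x - f y)"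
    have "cmod (laplacian G f x) * mass G x = cmod (\<Sum>y\<in>?E x. of_real (wt G x y) * (f x - f y))"
      using m by (simp add: laplacian_graph_eq[OF x] norm_divide)
    also have "\<dots> \<le> (\<Sum>y\<in>?E x. wt G x y * ?d y)"
      using a by (intro order.trans[OF norm_sum] sum_mono) (simp add: norm_mult)
    finally have "(cmod (laplacian G f x) * mass G x)\<^sup>2 \<le> (\<Sum>y\<in>?E x. wt G x y * ?d y)\<^sup>2"
      using m by (intro power_mono) auto
    also have "(\<Sum>y\<in>?E x. wt G x y * ?d y) = (\<Sum>y\<in>?E x. sqrt (wt G x y) * (sqrt (wt G x y) * ?d y))"
      using a by (intro sum.cong) (auto simp: mult.assoc[symmetric])
    also have "\<dots>\<^sup>2 \<le> (\<Sum>y\<in>?E x. (sqrt (wt G x y))\<^sup>2) * (\<Sum>y\<in>?E x. (sqrt (wt G x y) * ?d y)\<^sup>2)"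
      by (rule Cauchy_Schwarz_ineq_sum)
    also have "\<dots> = (\<Sum>y\<in>?E x. wt G x y) * (\<Sum>y\<in>?E x. wt G x y * (?d y)\<^sup>2)"
      using a by (simp add: power_mult_distrib)
    also have "\<dots> \<le> (K * mass G x) * (\<Sum>y\<in>?E x. wt G x y * (2 * (cmod (f x))\<^sup>2 + 2 * (cmod (f y))\<^sup>2))"
    proof (intro mult_mono in_le[OF x] sum_mono mult_left_mono a)
      fix y
      have "(?d y)\<^sup>2 \<le> (cmod (f x) + cmod (f y))\<^sup>2" by (intro power_mono norm_triangle_ineq4) auto
      also have "\<dots> \<le> 2 * (cmod (f x))\<^sup>2 + 2 * (cmod (f y))\<^sup>2"
        using sum_squares_bound[of "cmod (f x)" "cmod (f y)"] by (simp add: power2_sum)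
      finally show "(?d y)\<^sup>2 \<le> 2 * (cmod (f x))\<^sup>2 + 2 * (cmod (f y))\<^sup>2" .
    qed (use a K m in \<open>auto intro!: sum_nonneg\<close>)
    also have "(\<Sum>y\<in>?E x. wt G x y * (2 * (cmod (f x))\<^sup>2 + 2 * (cmod (f y))\<^sup>2)) =
        2 * ((\<Sum>y\<in>?E x. wt G x y) * (cmod (f x))\<^sup>2 + (\<Sum>y\<in>?E x. wt G x y * (cmod (f y))\<^sup>2))"
      by (simp add: distrib_left sum.distrib sum_distrib_left sum_distrib_right mult_ac)
    also have "(K * mass G x) * \<dots> \<le> (K * mass G x) *
        (2 * (K * mass G x * (cmod (f x))\<^sup>2 + (\<Sum>y\<in>?E x. wt G x y * (cmod (f y))\<^sup>2)))"
      using K(1) m in_le[OF x] by (intro mult_left_mono add_mono mult_right_mono) auto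
    finally have "(cmod (laplacian G f x))\<^sup>2 * mass G x * mass G x \<le>
      2 * K * (K * mass G x * (cmod (f x))\<^sup>2 + (\<Sum>y\<in>?E x. wt G x y * (cmod (f y))\<^sup>2)) * mass G x"
      by (simp add: power_mult_distrib power2_eq_square mult_ac)
    then show ?thesis using m by simp
  qed
  have bd: "laplacian G f \<in> l2 G \<and> l2_norm G (laplacian G f) \<le> 2 * K * l2_norm G f" if f: "f \<in> l2 G" for f
  proof -
    have "(\<Sum>x\<in>X. (cmod (laplacian G f x))\<^sup>2 * mass G x) \<le> (2 * K * l2_norm G f)\<^sup>2"
      if X: "finite X" "X \<subseteq> verts G" for X
    proof -
      \<comment> \<open>The in-neighbourhoods of the points of \<open>X\<close> are collected in one
        finite set so that the double sum can be exchanged.\<close>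
      define Y where "Y = (\<Union>x\<in>X. ?E x)"
      have Y: "finite Y" "Y \<subseteq> verts G" unfolding Y_def using X neighbours(1,2) by auto
      have E: "?E x = {y \<in> Y. (x, y) \<in> edges G}" if "x \<in> X" for x using that by (auto simp: Y_def)
      have "(\<Sum>x\<in>X. \<Sum>y\<in>?E x. wt G x y * (cmod (f y))\<^sup>2) =
          (\<Sum>x\<in>X. \<Sum>y\<in>{y \<in> Y. (x, y) \<in> edges G}. wt G x y * (cmod (f y))\<^sup>2)"
        using E by (intro sum.cong) auto
      also have "\<dots> = (\<Sum>y\<in>Y. \<Sum>x\<in>{x \<in> X. (x, y) \<in> edges G}. wt G x y * (cmod (f y))\<^sup>2)"
        by (rule sum.swap_restrict[OF X(1) Y(1)])
      also have "\<dots> = (\<Sum>y\<in>Y. (\<Sum>x\<in>{x \<in> X. (x, y) \<in> edges G}. wt G x y) * (cmod (f y))\<^sup>2)"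
        by (simp add: sum_distrib_right)
      also have "\<dots> \<le> (\<Sum>y\<in>Y. K * mass G y * (cmod (f y))\<^sup>2)"
        using Y(2) out_le[OF _ X] by (intro sum_mono mult_right_mono) auto
      also have "\<dots> = K * (\<Sum>y\<in>Y. (cmod (f y))\<^sup>2 * mass G y)"
        by (simp add: sum_distrib_left mult_ac)
      also have "\<dots> \<le> K * (l2_norm G f)\<^sup>2" using K(1) l2_sum_le[OF f Y] by simp
      finally have 1: "(\<Sum>x\<in>X. \<Sum>y\<in>?E x. wt G x y * (cmod (f y))\<^sup>2) \<le> K * (l2_norm G f)\<^sup>2" .
      have "(\<Sum>x\<in>X. K * mass G x * (cmod (f x))\<^sup>2) = K * (\<Sum>x\<in>X. (cmod (f x))\<^sup>2 * mass G x)"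
        by (simp add: sum_distrib_left mult_ac)
      also have "\<dots> \<le> K * (l2_norm G f)\<^sup>2" using K(1) l2_sum_le[OF f X] by simp
      finally have 2: "(\<Sum>x\<in>X. K * mass G x * (cmod (f x))\<^sup>2) \<le> K * (l2_norm G f)\<^sup>2" .
      have "(\<Sum>x\<in>X. (cmod (laplacian G f x))\<^sup>2 * mass G x) \<le>
          (\<Sum>x\<in>X. 2 * K * (K * mass G x * (cmod (f x))\<^sup>2 + (\<Sum>y\<in>?E x. wt G x y * (cmod (f y))\<^sup>2)))"
        using X by (intro sum_mono pt) auto
      also have "\<dots> = 2 * K * ((\<Sum>x\<in>X. K * mass G x * (cmod (f x))\<^sup>2) + (\<Sum>x\<in>X. \<Sum>y\<in>?E x. wt G x y * (cmod (f y))\<^sup>2))"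
        unfolding sum_distrib_left[symmetric] sum.distrib ..
      also have "\<dots> \<le> 2 * K * (K * (l2_norm G f)\<^sup>2 + K * (l2_norm G f)\<^sup>2)"
        using K(1) 1 2 by (intro mult_left_mono add_mono) auto
      finally show ?thesis by (simp add: power2_eq_square mult_ac)
    qed
    then show ?thesis
      using l2_boundedI[of "laplacian G f" "2 * K * l2_norm G f"] K(1) by (auto simp: laplacian_def)
  qed
  have "laplacian G (f + g) x = (laplacian G f + laplacian G g) x" for f g x
    by (cases "x \<in> verts G")
      (simp_all add: laplacian_graph_eq sum.distrib[symmetric] add_divide_distrib[symmetric] algebra_simps,
        simp_all add: laplacian_def)
  moreover have "laplacian G (\<lambda>x. c * f x) x = c * laplacian G f x" for c f x
    by (cases "x \<in> verts G")
      (simp_all add: laplacian_graph_eq sum_distrib_left algebra_simps, simp_all add: laplacian_def)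
  ultimately show ?thesis unfolding bounded_op_alt using bd by blast
qed

end

section \<open>The reduced Laplacian as a compression\<close>

context clustered
begin

text \<open>The weights of complementary edge sets add. Hence the Laplacian of the remaining edges
  is bounded, and it agrees with that of \<open>G\<close> on functions annihilated by
  \<open>M\<close>.\<close>

lemma laplacian_complement:
  "laplacian (restrict_edges G (edges G - F)) f = laplacian G f - M f"
proof
  fix x
  show "laplacian (restrict_edges G (edges G - F)) f x = (laplacian G f - M f) x"
  proof (cases "x \<in> verts G")
    case True
    let ?g = "\<lambda>y. of_real (wt G x y) * (f x - f y)"
    have "laplacian (restrict_edges G (edges G - F)) f x =
        (\<Sum>y\<in>(edges G - F) `` {x}. of_real (wt (restrict_edges G (edges G - F)) x y) * (f x - f y)) /
        of_real (mass (restrict_edges G (edges G - F)) x)"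
      using True neighbours[OF True]
      by (intro laplacian_eq) (auto simp: restrict_edges_def intro: finite_subset[of _ "edges G `` {x}"])
    also have "\<dots> = (\<Sum>y\<in>(edges G - F) `` {x}. ?g y) / of_real (mass G x)"
      unfolding restrict_edges_def by (intro arg_cong2[where f="(/)"] sum.cong) auto
    also have "(edges G - F) `` {x} = edges G `` {x} - F `` {x}" by auto
    also have "(\<Sum>y\<in>edges G `` {x} - F `` {x}. ?g y) = (\<Sum>y\<in>edges G `` {x}. ?g y) - lapsum f x"
      unfolding lapsum_def using neighbours(1)[OF True] F_edges by (intro sum_diff) auto
    finally show ?thesis by (simp add: laplacian_graph_eq[OF True] laplacian_F diff_divide_distrib)
  next
    case False
    then show ?thesis by (simp add: laplacian_def restrict_edges_def)
  qed
qed

abbreviation "H \<equiv> reduced_graph G F"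

lemma reduced_graph_simps [simp]: "verts H = Rs" "mass H = reduced_mass G F" "wt H = reduced_wt G F"
  by (simp_all add: reduced_graph_def)

lemma positive_mass_H: "positive_mass H"
  by unfold_locales (simp add: reduced_mass_pos)

text \<open>Apart from the finitely many reaches inside \<open>N\<close>, a reach is a singleton,
  identified with its vertex by \<open>the_elem\<close>.\<close>

lemma bounded_op_J_down: "bounded_op G H (J_down G F)"
proof (rule bounded_opI_finite[OF positive_mass_H J_down_add J_down_scale _ finite_reaches_N, where \<iota>="the_elem"])
  have single: "\<exists>x\<in>verts G - N. R = {x}" if "R \<in> verts H - {R \<in> Rs. R \<subseteq> N}" for R
    using that reach_cases[of R] by auto
  show "inj_on the_elem (verts H - {R \<in> Rs. R \<subseteq> N})"
  proof (rule inj_onI)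
    fix R S assume RS: "R \<in> verts H - {R \<in> Rs. R \<subseteq> N}" "S \<in> verts H - {R \<in> Rs. R \<subseteq> N}" "the_elem R = the_elem S"
    obtain x y where "R = {x}" "S = {y}" using single RS(1,2) by blast
    then show "R = S" using RS(3) by simp
  qed
  show "the_elem ` (verts H - {R \<in> Rs. R \<subseteq> N}) \<subseteq> verts G"
  proof (rule image_subsetI)
    fix R assume "R \<in> verts H - {R \<in> Rs. R \<subseteq> N}"
    then obtain x where "x \<in> verts G" "R = {x}" using single by blast
    then show "the_elem R \<in> verts G" by simp
  qed
  show "(cmod (J_down G F f R))\<^sup>2 * mass H R \<le> (cmod (f (the_elem R)))\<^sup>2 * mass G (the_elem R)"
    if R: "R \<in> verts H - {R \<in> Rs. R \<subseteq> N}" for f R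
    using single[OF R] by (auto simp: J_down_isolated reduced_mass_isolated)
qed (auto simp: J_down_outside bounded_functional_J_down)

lemma bounded_op_J_up: "bounded_op H G (J_up G F)"
proof (rule positive_mass.bounded_opI_finite[OF positive_mass_H positive_mass_axioms J_up_add J_up_scale _ finite_N, where \<iota>="\<lambda>x. {x}"])
  show "positive_mass.bounded_functional H (\<lambda>f. J_up G F f y)" if "y \<in> N" for y
    unfolding J_up_N[OF that] mult.commute[of _ "\<gamma> _ y"]
    by (intro positive_mass.bounded_functional_sum[OF positive_mass_H]
        positive_mass.bounded_functional_point[OF positive_mass_H])
  show "(\<lambda>x. {x}) ` (verts G - N) \<subseteq> verts H" using isolated_reach(1) by auto
  show "(cmod (J_up G F f y))\<^sup>2 * mass G y \<le> (cmod (f {y}))\<^sup>2 * mass H {y}" if "y \<in> verts G - N" for f y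
    using that by (simp add: J_up_isolated reduced_mass_isolated)
qed (auto simp: J_up_outside)

text \<open>The partition of unity turns the sum over \<open>S\<close> of
  \<open>\<gamma> S s * (g R - g S)\<close> into \<open>g R - J_up G F g s\<close>, and
  \<open>g R\<close> is the value of \<open>J_up G F g\<close> on the cabal, where the left kernel
  vector lives. So row \<open>R\<close> is an average of rows of the Laplacian of \<open>G\<close>;
  the reduced mass cancels.\<close>

lemma laplacian_reduced:
  "laplacian H g = J_down G F (laplacian G (J_up G F g))"
proof
  fix R
  show "laplacian H g R = J_down G F (laplacian G (J_up G F g)) R"
  proof (cases "R \<in> Rs")
    case False
    then show ?thesis by (simp add: laplacian_def J_down_outside)
  next
    case True
    note R = True
    let ?l = "\<lambda>r. complex_of_real (\<l> R r)" and ?a = "\<lambda>r s. complex_of_real (wt G r s)"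
    have RV: "R \<subseteq> verts G" and finR: "finite R" using reach_subset[OF R] finite_reach[OF R] by auto
    \<comment> \<open>There may be infinitely many reaches; only those meeting the finitely many
      in-neighbours of \<open>R\<close>, collected in \<open>Y\<close>, contribute to row
      \<open>R\<close>.\<close>
    define Nb where "Nb = (\<Union>r\<in>R. edges G `` {r})"
    have Nb: "finite Nb" "Nb \<subseteq> verts G" unfolding Nb_def using RV finR neighbours(1,2) by auto
    have Nb0: "wt G r s = 0" if "r \<in> R" "s \<in> verts G - Nb" for r s
      using that RV wt_eq_0[of r s] by (auto simp: Nb_def)
    define Y where "Y = (\<Union>s\<in>Nb. {S \<in> Rs. s \<in> S})"
    have Y: "finite Y" "Y \<subseteq> Rs" unfolding Y_def using Nb(1) finite_reaches_at by auto
    define c where "c = (\<lambda>S. \<Sum>r\<in>R. \<Sum>s\<in>Nb. ?l r * ?a r s * \<gamma> S s)"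
    have c: "complex_of_real (reduced_wt G F R S) = of_real (reduced_mass G F R) * c S" if S: "S \<in> Rs" for S
    proof -
      have "(\<Sum>s\<in>S. ?l r * ?a r s * \<gamma> S s) = (\<Sum>s\<in>Nb. ?l r * ?a r s * \<gamma> S s)" if r: "r \<in> R" for r
      proof -
        have "(\<Sum>s\<in>S. ?l r * ?a r s * \<gamma> S s) = (\<Sum>s\<in>S \<inter> Nb. ?l r * ?a r s * \<gamma> S s)"
          using Nb0[OF r] reach_subset[OF S] finite_reach[OF S] by (intro sum.mono_neutral_right) auto
        also have "\<dots> = (\<Sum>s\<in>Nb. ?l r * ?a r s * \<gamma> S s)"
          using right_kernel_vec(3)[OF S] Nb(1) by (intro sum.mono_neutral_left) auto
        finally show ?thesis .
      qed
      moreover have "complex_of_real (\<Sum>(r, s)\<in>R \<times> S. \<l> R r * wt G r s * Re (\<gamma> S s)) =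
          (\<Sum>r\<in>R. \<Sum>s\<in>S. ?l r * ?a r s * \<gamma> S s)"
        unfolding sum.cartesian_product[symmetric] by (simp flip: right_kernel_vec_real[OF S])
      ultimately show ?thesis by (simp add: reduced_wt_def c_def)
    qed
    have wt0: "wt H R S = 0" if "S \<in> verts H - Y" for S
    proof -
      have "\<gamma> S s = 0" if "s \<in> Nb" for s
        using right_kernel_vec(3)[of S s] \<open>S \<in> verts H - Y\<close> that by (auto simp: Y_def)
      then have "c S = 0" by (simp add: c_def)
      then show ?thesis using c[of S] that by simp
    qed
    have m: "reduced_mass G F R \<noteq> 0" using reduced_mass_pos[OF R] by simp
    have "laplacian H g R = (\<Sum>S\<in>Y. of_real (wt H R S) * (g R - g S)) / of_real (mass H R)"
      using R Y wt0 by (intro laplacian_eq) auto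
    also have "\<dots> = (\<Sum>S\<in>Y. of_real (reduced_mass G F R) * (c S * (g R - g S))) / of_real (reduced_mass G F R)"
      using Y(2) c by (intro arg_cong2[where f="(/)"] sum.cong) auto
    also have "\<dots> = (\<Sum>S\<in>Y. c S * (g R - g S))"
      using m by (simp add: sum_distrib_left[symmetric])
    also have "\<dots> = (\<Sum>S\<in>Y. \<Sum>r\<in>R. \<Sum>s\<in>Nb. ?l r * ?a r s * (\<gamma> S s * (g R - g S)))"
      by (simp add: c_def sum_distrib_right mult.assoc)
    also have "\<dots> = (\<Sum>r\<in>R. \<Sum>S\<in>Y. \<Sum>s\<in>Nb. ?l r * ?a r s * (\<gamma> S s * (g R - g S)))"
      by (rule sum.swap)
    also have "\<dots> = (\<Sum>r\<in>R. \<Sum>s\<in>Nb. \<Sum>S\<in>Y. ?l r * ?a r s * (\<gamma> S s * (g R - g S)))"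
      by (intro sum.cong refl sum.swap)
    also have "\<dots> = (\<Sum>r\<in>R. \<Sum>s\<in>Nb. ?l r * ?a r s * (g R - J_up G F g s))"
    proof (intro sum.cong refl)
      fix r s assume s: "s \<in> Nb"
      have Ys: "S \<in> Y" if "S \<in> Rs" "s \<in> S" for S using that s by (auto simp: Y_def)
      have "(\<Sum>S\<in>Y. \<gamma> S s * (g R - g S)) = (\<Sum>S\<in>Y. \<gamma> S s) * g R - (\<Sum>S\<in>Y. g S * \<gamma> S s)"
        by (simp add: right_diff_distrib sum_subtractf sum_distrib_left mult.commute)
      also have "\<dots> = g R - J_up G F g s"
        using sum_right_kernel_vec[OF _ Y(1) Ys Y(2)] sum_reaches_at[OF Y(1) Ys Y(2)] s Nb(2)
        by (auto simp: J_up_eq)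
      finally show "(\<Sum>S\<in>Y. ?l r * ?a r s * (\<gamma> S s * (g R - g S))) = ?l r * ?a r s * (g R - J_up G F g s)"
        by (simp add: sum_distrib_left[symmetric])
    qed
    also have "\<dots> = (\<Sum>r\<in>R. of_real (\<l> R r * mass G r) * laplacian G (J_up G F g) r)"
    proof (rule sum.cong[OF refl])
      fix r assume r: "r \<in> R"
      then have rV: "r \<in> verts G" using RV by blast
      show "(\<Sum>s\<in>Nb. ?l r * ?a r s * (g R - J_up G F g s)) = of_real (\<l> R r * mass G r) * laplacian G (J_up G F g) r"
      \<comment> \<open>Off the cabal both sides vanish with \<open>\<l> R r\<close>; on it
        \<open>g R\<close> may be read as \<open>J_up G F g r\<close>.\<close>
      proof (cases "r \<in> cabal R")
        case True
        have "(\<Sum>s\<in>Nb. ?l r * ?a r s * (g R - J_up G F g s)) =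
            (\<Sum>s\<in>edges G `` {r}. ?l r * ?a r s * (g R - J_up G F g s))"
          using Nb r wt_eq_0[OF rV] by (intro sum.mono_neutral_right) (auto simp: Nb_def)
        then show ?thesis
          unfolding laplacian_graph_eq[OF rV] J_up_cabal[OF True R]
          using mass_pos[OF rV] by (simp add: sum_distrib_left[symmetric] mult.assoc)
      qed (simp add: left_kernel_vec_cabal[OF R])
    qed
    finally show ?thesis by (simp add: J_down_eq[OF R])
  qed
qed

text \<open>\<open>J_down\<close> is a left inverse of \<open>J_up\<close>, so the resolvent
  equations of the reduced Laplacian, transported to \<open>G\<close>, become exactly the identities
  for \<open>B\<close> that the abstract lemma requires.\<close>

lemma strong_coupling_limit:
  assumes z: "z \<in> resolvent_set H (laplacian H)"
  shows "\<exists>C>0. \<exists>b>0. \<forall>\<beta>\<ge>b. z \<in> resolvent_set G (coupled_laplacian G F \<beta>) \<and>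
      bounded_op G G (reduction_error G F z \<beta>) \<and>
      (\<forall>f\<in>l2 G. l2_norm G (reduction_error G F z \<beta> f) \<le> C / \<beta> * l2_norm G f)"
proof -
  note GM = positive_mass_axioms and P = bounded_op_kernel_proj and bM = bounded_op_M
  note bJd = bounded_op_J_down and bJu = bounded_op_J_up
  define r where "r = resolvent H (laplacian H) z"
  note res = positive_mass.resolvent_eqs[OF positive_mass_H z, folded r_def]
  define L0 where "L0 = laplacian (restrict_edges G (edges G - F))"
  define A where "A = (\<lambda>f. L0 f - (\<lambda>x. z * f x))"
  define B where "B = (\<lambda>f. J_up G F (r (J_down G F f)))"
  have bL0: "bounded_op G G L0"
    unfolding L0_def laplacian_complement by (intro bounded_op_minus bounded_op_laplacian bM GM)
  have bA: "bounded_op G G A"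
    unfolding A_def by (intro bounded_op_minus bL0 bounded_op_cmul bounded_op_id GM)
  have bB: "bounded_op G G B"
    unfolding B_def
    by (rule bounded_op_comp[OF bounded_op_comp[OF bJd positive_mass_H res(1)] positive_mass_H bJu])
  have Hout: "g R = 0" if "g \<in> l2 H" "R \<notin> Rs" for g R using that by (simp add: l2_def)
  have JdJu: "J_down G F (J_up G F g) = g" if "g \<in> l2 H" for g
    using Hout[OF that] by (rule J_down_J_up_id)
  \<comment> \<open>\<open>M\<close> vanishes on the range of \<open>J_up\<close>, so removing the
    cluster edges does not change the compressed Laplacian.\<close>
  have JAJ: "J_down G F (A (J_up G F g)) = (\<lambda>R. laplacian H g R - z * g R)" if g: "g \<in> l2 H" for g
  proof -
    have Jg: "J_up G F g \<in> l2 G" using bounded_op_mem[OF bJu g] .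
    have L0g: "L0 (J_up G F g) = laplacian G (J_up G F g)"
      by (simp add: L0_def laplacian_complement M_J_up)
    have m: "laplacian G (J_up G F g) \<in> l2 G" using bounded_op_mem[OF bounded_op_laplacian Jg] .
    have "J_down G F (A (J_up G F g)) =
        J_down G F (laplacian G (J_up G F g)) - J_down G F (\<lambda>x. z * J_up G F g x)"
      unfolding A_def L0g by (rule bounded_op_diff[OF bJd m l2_scale_mem[OF Jg]])
    then show ?thesis
      by (simp add: laplacian_reduced J_down_scale JdJu[OF g] fun_eq_iff)
  qed
  have rm: "r (J_down G F f) \<in> l2 H" if "f \<in> l2 G" for f
    using bounded_op_mem[OF res(1) bounded_op_mem[OF bJd that]] .
  have PB: "kernel_proj (B f) = B f" if "f \<in> l2 G" for f
    unfolding B_def kernel_proj_def by (simp only: JdJu[OF rm[OF that]])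
  have BP: "B (kernel_proj f) = B f" for f by (simp only: B_def J_down_kernel_proj)
  have PAB: "kernel_proj (A (B f)) = kernel_proj f" if f: "f \<in> l2 G" for f
    unfolding B_def kernel_proj_def
    by (simp only: JAJ[OF rm[OF f]] res(2)[OF bounded_op_mem[OF bJd f]])
  have BAP: "B (A (kernel_proj f)) = kernel_proj f" if f: "f \<in> l2 G" for f
    unfolding B_def kernel_proj_def
    by (simp only: JAJ[OF bounded_op_mem[OF bJd f]] res(3)[OF bounded_op_mem[OF bJd f]])
  obtain S where S: "bounded_op G G S" "\<And>f. f \<in> l2 G \<Longrightarrow> S f \<in> supported N"
    "\<And>f. f \<in> l2 G \<Longrightarrow> M (S f) = f - kernel_proj f" "\<And>f. f \<in> l2 G \<Longrightarrow> S (M f) = f - kernel_proj f"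
    using reduced_inverse_exists by metis
  have "\<exists>C>0. \<exists>b>0. \<forall>\<beta>::complex. cmod \<beta> \<ge> b \<longrightarrow>
        (\<forall>f\<in>l2 G. (\<lambda>x. A f x + \<beta> * M f x) = 0 \<longrightarrow> f = 0) \<and>
        (\<forall>g\<in>l2 G. \<exists>f\<in>l2 G. (\<lambda>x. A f x + \<beta> * M f x) = g \<and>
           l2_norm G (f - B g) \<le> C / cmod \<beta> * l2_norm G g)"
    by (rule strong_coupling[OF bA bM P S(1) bB finite_N N_verts S(2-4) M_kernel_proj kernel_proj_M PB BP PAB BAP])
  then obtain C b where C: "C > 0" "b > 0" and *: "\<forall>\<beta>::complex. cmod \<beta> \<ge> b \<longrightarrow>
        (\<forall>f\<in>l2 G. (\<lambda>x. A f x + \<beta> * M f x) = 0 \<longrightarrow> f = 0) \<and>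
        (\<forall>g\<in>l2 G. \<exists>f\<in>l2 G. (\<lambda>x. A f x + \<beta> * M f x) = g \<and>
           l2_norm G (f - B g) \<le> C / cmod \<beta> * l2_norm G g)"
    by (elim exE conjE)
  obtain k where k: "k > 0" "\<And>f. f \<in> l2 G \<Longrightarrow> l2_norm G (B f) \<le> k * l2_norm G f"
    using bounded_op_bound[OF bB] by blast
  have main: "z \<in> resolvent_set G (coupled_laplacian G F \<beta>) \<and>
      bounded_op G G (reduction_error G F z \<beta>) \<and>
      (\<forall>f\<in>l2 G. l2_norm G (reduction_error G F z \<beta> f) \<le> C / \<beta> * l2_norm G f)"
    if \<beta>: "\<beta> \<ge> b" for \<beta> :: real
  proof -
    let ?L = "coupled_laplacian G F \<beta>"
    have b: "cmod (of_real \<beta>) \<ge> b" and n\<beta>: "cmod (of_real \<beta>) = \<beta>" using \<beta> C by auto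
    have L: "?L = (\<lambda>f. L0 f + (\<lambda>x. of_real \<beta> * M f x))"
      by (simp add: coupled_laplacian_def L0_def fun_eq_iff)
    have bL: "bounded_op G G ?L"
      unfolding L by (intro bounded_op_plus bL0 bounded_op_cmul bM GM)
    have Lz: "(\<lambda>x. ?L f x - z * f x) = (\<lambda>x. A f x + of_real \<beta> * M f x)" for f
      by (simp add: L A_def fun_eq_iff)
    have inj: "f = 0" if "f \<in> l2 G" "(\<lambda>x. ?L f x - z * f x) = 0" for f
      using *[rule_format, OF b, THEN conjunct1, rule_format, OF that(1)] that(2) by (simp only: Lz)
    have ex: "\<exists>f\<in>l2 G. (\<lambda>x. ?L f x - z * f x) = g \<and> l2_norm G (f - B g) \<le> C / \<beta> * l2_norm G g"
      if "g \<in> l2 G" for g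
      using *[rule_format, OF b, THEN conjunct2, rule_format, OF that] by (simp only: Lz n\<beta>)
    have zres: "z \<in> resolvent_set G ?L"
    proof (rule resolvent_setI[where K="C / \<beta> + k"])
      show "\<exists>f\<in>l2 G. (\<lambda>x. ?L f x - z * f x) = g \<and> l2_norm G f \<le> (C / \<beta> + k) * l2_norm G g" if g: "g \<in> l2 G" for g
      proof -
        obtain f where f: "f \<in> l2 G" "(\<lambda>x. ?L f x - z * f x) = g" "l2_norm G (f - B g) \<le> C / \<beta> * l2_norm G g"
          using ex[OF g] by blast
        note Bg = bounded_op_mem[OF bB g]
        have "l2_norm G f \<le> l2_norm G (f - B g) + l2_norm G (B g)"
          using l2_triangle[OF l2_diff_mem[OF f(1) Bg] Bg] by simp
        also have "\<dots> \<le> (C / \<beta> + k) * l2_norm G g" using f(3) k(2)[OF g] by (simp add: distrib_right)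
        finally show ?thesis using f by blast
      qed
    qed (use bounded_op_mem[OF bL] bounded_op_add[OF bL] bounded_op_scale[OF bL] inj in auto)
    have err: "reduction_error G F z \<beta> = (\<lambda>f. resolvent G ?L z f - B f)"
      by (simp add: reduction_error_def B_def r_def fun_eq_iff)
    have "bounded_op G G (reduction_error G F z \<beta>)"
      unfolding err by (intro bounded_op_minus resolvent_eqs(1)[OF zres] bB GM)
    moreover have "l2_norm G (reduction_error G F z \<beta> g) \<le> C / \<beta> * l2_norm G g" if g: "g \<in> l2 G" for g
    proof -
      obtain f where f: "f \<in> l2 G" "(\<lambda>x. ?L f x - z * f x) = g" "l2_norm G (f - B g) \<le> C / \<beta> * l2_norm G g"
        using ex[OF g] by blast
      then have "resolvent G ?L z g = f" using resolvent_eqs(3)[OF zres f(1)] by simp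
      then show ?thesis using f(3) by (simp add: err)
    qed
    ultimately show ?thesis using zres by blast
  qed
  show ?thesis using C main by blast
qed

end

section \<open>From norm estimates to the operator norm\<close>

context positive_mass
begin

text \<open>A real supremum needs a nonempty set bounded above; the zero function provides an
  element and also the lower bound used in the squeeze to 0.\<close>

lemma op_norm_le:
  assumes "\<And>f. f \<in> l2 G \<Longrightarrow> l2_norm G (T f) \<le> c * l2_norm G f" and c: "c \<ge> 0"
  shows "0 \<le> op_norm G G T \<and> op_norm G G T \<le> c"
proof -
  let ?X = "{f \<in> l2 G. l2_norm G f \<le> 1}"
  have 0: "0 \<in> ?X" by (simp add: l2_norm_def)
  have le: "l2_norm G (T f) \<le> c" if "f \<in> ?X" for f
  proof -
    have "c * l2_norm G f \<le> c * 1" using that c by (intro mult_left_mono) auto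
    then show ?thesis using assms(1)[of f] that by simp
  qed
  have "0 \<le> l2_norm G (T 0)" by simp
  also have "\<dots> \<le> op_norm G G T"
    unfolding op_norm_def using le by (intro cSUP_upper 0 bdd_aboveI2[where M=c])
  finally have "0 \<le> op_norm G G T" .
  moreover have "op_norm G G T \<le> c"
    unfolding op_norm_def by (rule cSUP_least) (use 0 le in blast)+
  ultimately show ?thesis ..
qed

end

theorem theorem4p8:
  fixes G :: "'v wgraph" and \<E> :: "('v \<times> 'v) set set" and z :: complex
  assumes "wdigraph G"
    and "directed_clusters G \<E>"
    and "z \<noteq> 0"
    and "z \<in> resolvent_set (reduced_graph G (\<Union>\<E>)) (laplacian (reduced_graph G (\<Union>\<E>)))"
  shows "(\<exists>C>0. \<exists>\<beta>\<^sub>0>0. \<forall>\<beta>\<ge>\<beta>\<^sub>0.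
            z \<in> resolvent_set G (coupled_laplacian G (\<Union>\<E>) \<beta>) \<and>
            bounded_op G G (reduction_error G (\<Union>\<E>) z \<beta>) \<and>
            op_norm G G (reduction_error G (\<Union>\<E>) z \<beta>) \<le> C / \<beta>) \<and>
         ((\<lambda>\<beta>. op_norm G G (reduction_error G (\<Union>\<E>) z \<beta>)) \<longlongrightarrow> 0) at_top"
proof -
  let ?F = "\<Union>\<E>"
  interpret wdigraph G by fact
  interpret clustered G ?F
    using assms(2) by unfold_locales (auto simp: directed_clusters_def)
  obtain C b where C: "C > 0" "b > 0" and main: "\<And>\<beta>. \<beta> \<ge> b \<Longrightarrow>
      z \<in> resolvent_set G (coupled_laplacian G ?F \<beta>) \<and> bounded_op G G (reduction_error G ?F z \<beta>) \<and>
      (\<forall>f\<in>l2 G. l2_norm G (reduction_error G ?F z \<beta> f) \<le> C / \<beta> * l2_norm G f)"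
    using strong_coupling_limit[OF assms(4)] by blast
  have norm: "0 \<le> op_norm G G (reduction_error G ?F z \<beta>) \<and> op_norm G G (reduction_error G ?F z \<beta>) \<le> C / \<beta>"
    if "\<beta> \<ge> b" for \<beta>
    using main[OF that] C that by (intro op_norm_le) auto
  have "((\<lambda>\<beta>. C / \<beta>) \<longlongrightarrow> 0) at_top"
    by (intro tendsto_divide_0[OF tendsto_const] filterlim_at_top_imp_at_infinity filterlim_ident)
  moreover have "\<forall>\<^sub>F \<beta> in at_top. 0 \<le> op_norm G G (reduction_error G ?F z \<beta>)"
    "\<forall>\<^sub>F \<beta> in at_top. op_norm G G (reduction_error G ?F z \<beta>) \<le> C / \<beta>"
    using norm by (auto intro: eventually_at_top_linorderI[of b])
  ultimately have "((\<lambda>\<beta>. op_norm G G (reduction_error G ?F z \<beta>)) \<longlongrightarrow> 0) at_top"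
    by (rule tendsto_sandwich[OF _ _ tendsto_const, rotated 2])
  then show ?thesis using C main norm by blast
qed

end
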